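(* Let $R^{(1)}=A_1^{(1)}$ and $(p,q,r,s)=(2,1,2,3)$ for the second Painlevé equation (P$_{\rm II}$), and $R^{(1)}=A_2^{(1)}$ and $(p,q,r,s)=(1,1,1,2)$ for the fourth Painlevé equation (P$_{\rm IV}$). Let the extended affine Weyl group $\widetilde W(R^{(1)})\cong\mathrm{Aut}(R^{(1)})\ltimes W(R^{(1)})$ act on $(x,y,z)$ and the parameters by the rational transformations listed in the context. Then: (i) The transformation group $\widetilde W(R^{(1)})$ is extended to a rational transformation group on $\mathbb{C}P^3(p,q,r,s)$. (ii) For each element $\sigma\in W(R^{(1)})$, the action of $\sigma$ on the infinity set $\mathbb{C}P^2(p,q,r)$ is trivial: $\sigma|_{\mathbb{C}P^2(p,q,r)}=\mathrm{id}$. Hence the transformation group $\widetilde W(R^{(1)})$ is reduced to $\mathrm{Aut}(R^{(1)})$ on $\mathbb{C}P^2(p,q,r)$. (iii) The foliation on $\mathbb{C}P^2(p,q,r)$ is $\mathrm{Aut}(R^{(1)})$-invariant.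
   Context: (P$_{\rm II}$): $dx/dz=2y^3+yz+\alpha$, $dy/dz=x$. (P$_{\rm IV}$): $dx/dz=-x^2+2xy+2xz-2\theta_\infty$, $dy/dz=-y^2+2xy-2yz-2\kappa_0$. Spaces. $\mathbb{C}P^3(p,q,r,s)$ is the quotient of $\mathbb{C}^4\setminus\{0\}$ by $(x,y,z,\varepsilon)\sim(\lambda^px,\lambda^qy,\lambda^rz,\lambda^s\varepsilon)$, $\lambda\in\mathbb{C}^*$. Its inhomogeneous coordinates $(x,y,z)$, $(Y_1,Z_1,\varepsilon_1)$, $(X_2,Z_2,\varepsilon_2)$, $(X_3,Y_3,\varepsilon_3)$ are related by $$x=\varepsilon_1^{-p/s}=X_2\varepsilon_2^{-p/s}=X_3\varepsilon_3^{-p/s},\quad y=Y_1\varepsilon_1^{-q/s}=\varepsilon_2^{-q/s}=Y_3\varepsilon_3^{-q/s},\quad z=Z_1\varepsilon_1^{-r/s}=Z_2\varepsilon_2^{-r/s}=\varepsilon_3^{-r/s},$$ each chart being divided by the corresponding cyclic group; in particular the $(x,y,z)$-chart is $\mathbb{C}^3/\mathbb{Z}_s$ with $\mathbb{Z}_s$ generated by $(x,y,z)\mapsto(\omega^px,\omega^qy,\omega^rz)$, $\omega=e^{2\pi i/s}$. One has the disjoint decomposition $\mathbb{C}P^3(p,q,r,s)=\mathbb{C}^3/\mathbb{Z}_s\cup\mathbb{C}P^2(p,q,r)$, where the infinity set is $\mathbb{C}P^2(p,q,r)=\{\varepsilon_1=0\}\cup\{\varepsilon_2=0\}\cup\{\varepsilon_3=0\}$.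 Foliation. The Painlevé equation, rewritten in each chart as an autonomous polynomial (or rational) vector field, leaves $\mathbb{C}P^2(p,q,r)$ invariant, and the foliation on $\mathbb{C}P^2(p,q,r)$ is the one by its integral curves. On $\{\varepsilon_3=0\}$ it is given for (P$_{\rm II}$) by $\dot X_3=4Y_3^3+2Y_3$, $\dot Y_3=2X_3$ (level curves of $X_3^2-Y_3^4-Y_3^2$), and for (P$_{\rm IV}$) by $\dot X_3=-X_3^2+2X_3Y_3+2X_3$, $\dot Y_3=-Y_3^2+2X_3Y_3-2Y_3$ (level curves of $X_3^2Y_3-X_3Y_3^2-2X_3Y_3$). Group for (P$_{\rm II}$). $\widetilde W(A_1^{(1)})=\langle s_1,\pi\rangle$, $\mathrm{Aut}(A_1^{(1)})=\langle\pi\rangle\cong\mathbb{Z}_2$, and $W(A_1^{(1)})$ is generated by $s_1$ and $\pi s_1\pi$. The variable $z$ is fixed, and - $s_1$: $\alpha\mapsto-\alpha+1$, $\ x\mapsto x+\dfrac{(2\alpha-1)y}{y^2-x+z/2}+\dfrac{(\alpha-1/2)^2}{(y^2-x+z/2)^2}$, $\ y\mapsto y+\dfrac{\alpha-1/2}{y^2-x+z/2}$; - $\pi$: $\alpha\mapsto-\alpha$, $x\mapsto-x$, $y\mapsto-y$. Group for (P$_{\rm IV}$). $\widetilde W(A_2^{(1)})=\langle s_0,s_1,s_2,\sigma_1,\sigma_2\rangle$, $W(A_2^{(1)})=\langle s_0,s_1,s_2\rangle$, $\mathrm{Aut}(A_2^{(1)})=\langle\sigma_1,\sigma_2\rangle\cong\mathfrak{S}_3$,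 acting on $(\kappa_0,\theta_\infty;x,y,z)$ by - $s_0$: $\bigl(1+\theta_\infty,\ \kappa_0-1;\ x+\frac{2(1-\kappa_0+\theta_\infty)}{x-y-2z},\ y+\frac{2(1-\kappa_0+\theta_\infty)}{x-y-2z},\ z\bigr)$; - $s_1$: $(-\kappa_0,\ \theta_\infty-\kappa_0;\ x-2\kappa_0/y,\ y,\ z)$; - $s_2$: $(\kappa_0-\theta_\infty,\ -\theta_\infty;\ x,\ y-2\theta_\infty/x,\ z)$; - $\sigma_1$: $(-\theta_\infty,\ -\kappa_0;\ -iy,\ -ix,\ iz)$; - $\sigma_2$: $(\kappa_0,\ \kappa_0-\theta_\infty-1;\ ix,\ i(x-y-2z),\ iz)$. These transformations send the Painlevé equation to the Painlevé equation of the same type with the changed parameters. Triviality on $\mathbb{C}P^2(p,q,r)$ is understood as an identity of rational maps. *)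

theory Defs
  imports "HOL-Analysis.Analysis" "HOL-Algebra.Generated_Groups"
begin

section \<open>Polynomial and rational maps, generic identities\<close>

inductive poly_fun :: "(complex ^ 'n \<Rightarrow> complex) \<Rightarrow> bool" where
  const: "poly_fun (\<lambda>_. c)"
| coord: "poly_fun (\<lambda>v. v $ i)"
| add: "poly_fun f \<Longrightarrow> poly_fun g \<Longrightarrow> poly_fun (\<lambda>v. f v + g v)"
| mult: "poly_fun f \<Longrightarrow> poly_fun g \<Longrightarrow> poly_fun (\<lambda>v. f v * g v)"

text \<open>A property holds generically if it holds on a nonempty Zariski open set.\<close>

definition generically :: "(complex ^ 'n \<Rightarrow> bool) \<Rightarrow> bool" where
  "generically P \<longleftrightarrow> (\<exists>h. poly_fun h \<and> (\<exists>v. h v \<noteq> 0) \<and> (\<forall>v. h v \<noteq> 0 \<longrightarrow> P v))"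

text \<open>Rational maps of affine space are total HOL functions here; the values on the zero set of
  the denominators are irrelevant, since such functions are only used modulo generic equality.\<close>

definition rational_map :: "(complex ^ 'n \<Rightarrow> complex ^ 'n) \<Rightarrow> bool" where
  "rational_map f \<longleftrightarrow> (\<forall>i. \<exists>N D. poly_fun N \<and> poly_fun D \<and> (\<exists>v. D v \<noteq> 0) \<and>
     (\<forall>v. D v \<noteq> 0 \<longrightarrow> f v $ i = N v / D v))"

definition aff_eq :: "((complex ^ 'n \<Rightarrow> complex ^ 'n) \<times> (complex ^ 'n \<Rightarrow> complex ^ 'n)) set" where
  "aff_eq = {(f, g). rational_map f \<and> rational_map g \<and> generically (\<lambda>v. f v = g v)}"


section \<open>Weighted projective spaces\<close>

definition wscale :: "nat ^ 'n \<Rightarrow> complex \<Rightarrow> complex ^ 'n \<Rightarrow> complex ^ 'n" where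
  "wscale w c v = (\<chi> i. c ^ (w $ i) * v $ i)"

definition wrel :: "nat ^ 'n \<Rightarrow> ((complex ^ 'n) \<times> (complex ^ 'n)) set" where
  "wrel w = {(u, v). u \<noteq> 0 \<and> v \<noteq> 0 \<and> (\<exists>c. c \<noteq> 0 \<and> v = wscale w c u)}"

definition wproj :: "nat ^ 'n \<Rightarrow> (complex ^ 'n) set set" where
  "wproj w = (UNIV - {0}) // wrel w"

definition pt :: "nat ^ 'n \<Rightarrow> complex ^ 'n \<Rightarrow> (complex ^ 'n) set" where
  "pt w v = wrel w `` {v}"

text \<open>A rational self-map of \<open>wproj w\<close> is represented by a tuple of polynomials, not all zero,
  whose \<open>i\<close>-th entry is weighted homogeneous of degree \<open>d * w $ i\<close>. As soon as one weight is 1,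
  as for all weights used below, every dominant rational self-map has such a representative:
  normalise the coordinate of weight 1 to 1 and clear denominators.\<close>

definition hom_tuple :: "nat ^ 'n \<Rightarrow> (complex ^ 'n \<Rightarrow> complex ^ 'n) \<Rightarrow> bool" where
  "hom_tuple w F \<longleftrightarrow> (\<forall>i. poly_fun (\<lambda>v. F v $ i)) \<and> (\<exists>v. F v \<noteq> 0) \<and>
     (\<exists>d. \<forall>c v. F (wscale w c v) = wscale w (c ^ d) (F v))"

definition proj_eq ::
  "nat ^ 'n \<Rightarrow> ((complex ^ 'n \<Rightarrow> complex ^ 'n) \<times> (complex ^ 'n \<Rightarrow> complex ^ 'n)) set" where
  "proj_eq w = {(F, G). hom_tuple w F \<and> hom_tuple w G \<and> generically (\<lambda>v. (F v, G v) \<in> wrel w)}"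


section \<open>Groups of birational maps\<close>

text \<open>\<open>E\<close> is a partial equivalence relation on self-maps (\<open>aff_eq\<close> or \<open>proj_eq w\<close>). The elements
  of the group are the classes of those maps that have an inverse modulo \<open>E\<close>.\<close>

definition bir_group :: "(('a \<Rightarrow> 'a) \<times> ('a \<Rightarrow> 'a)) set \<Rightarrow> ('a \<Rightarrow> 'a) set monoid" where
  "bir_group E =
    \<lparr>carrier = {E `` {f} | f. \<exists>g. (f, f) \<in> E \<and> (g, g) \<in> E \<and> (f \<circ> g, id) \<in> E \<and> (g \<circ> f, id) \<in> E},
     mult = (\<lambda>A B. \<Union>f\<in>A. \<Union>g\<in>B. E `` {f \<circ> g}),
     one = E `` {id}\<rparr>"

text \<open>Transformations that act on parameters as well: \<open>(\<phi>, A)\<close> sends a point \<open>v\<close> over the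
  parameter value \<open>a\<close> to the point \<open>A a v\<close> over the parameter value \<open>\<phi> a\<close>.\<close>

definition param_group :: "'c monoid \<Rightarrow> (('p \<Rightarrow> 'p) \<times> ('p \<Rightarrow> 'c)) monoid" where
  "param_group G =
    \<lparr>carrier = {(\<phi>, A). bij \<phi> \<and> (\<forall>a. A a \<in> carrier G)},
     mult = (\<lambda>(\<phi>, A) (\<psi>, B). (\<phi> \<circ> \<psi>, \<lambda>a. A (\<psi> a) \<otimes>\<^bsub>G\<^esub> B a)),
     one = (id, \<lambda>_. \<one>\<^bsub>G\<^esub>)\<rparr>"

type_synonym 'n maps = "(complex ^ 'n \<Rightarrow> complex ^ 'n) set"
type_synonym ('p, 'n) param_maps = "('p \<Rightarrow> 'p) \<times> ('p \<Rightarrow> 'n maps)"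

definition Bir_aff :: "('p, 3) param_maps monoid" where
  "Bir_aff = param_group (bir_group aff_eq)"

definition Bir_wproj :: "nat ^ 'n \<Rightarrow> 'n maps monoid" where
  "Bir_wproj w = bir_group (proj_eq w)"

definition Bir_param_wproj :: "nat ^ 'n \<Rightarrow> ('p, 'n) param_maps monoid" where
  "Bir_param_wproj w = param_group (Bir_wproj w)"

text \<open>Image of a set of points under a rational map (where the map is defined).\<close>

definition rat_image ::
  "nat ^ 'n \<Rightarrow> 'n maps \<Rightarrow> (complex ^ 'n) set set \<Rightarrow> (complex ^ 'n) set set" where
  "rat_image w B L = {pt w (F v) | F v. F \<in> B \<and> v \<noteq> 0 \<and> F v \<noteq> 0 \<and> pt w v \<in> L}"


section \<open>The affine chart and the infinity set of a three-dimensional weighted projective space\<close>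

definition wt4 :: "nat \<Rightarrow> nat \<Rightarrow> nat \<Rightarrow> nat \<Rightarrow> nat ^ 4" where
  "wt4 p q r s = vector [p, q, r, s]"

definition wt3 :: "nat \<Rightarrow> nat \<Rightarrow> nat \<Rightarrow> nat ^ 3" where
  "wt3 p q r = vector [p, q, r]"

definition app4 :: "complex ^ 3 \<Rightarrow> complex \<Rightarrow> complex ^ 4" where
  "app4 v e = vector [v $ 1, v $ 2, v $ 3, e]"

lemma vector_4:
  "(vector [w, x, y, z] :: 'a::zero ^ 4) $ 1 = w"
  "(vector [w, x, y, z] :: 'a ^ 4) $ 2 = x"
  "(vector [w, x, y, z] :: 'a ^ 4) $ 3 = y"
  "(vector [w, x, y, z] :: 'a ^ 4) $ 4 = z"
  unfolding vector_def by simp_all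

lemmas coord_defs = wt4_def wt3_def app4_def vector_4 vector_3

text \<open>The affine chart \<open>(x, y, z) \<mapsto> [x, y, z, 1]\<close> is the quotient by the cyclic group of order
  \<open>s\<close>, and \<open>(x, y, z) \<mapsto> [x, y, z, 0]\<close> identifies \<open>wproj (wt3 p q r)\<close> with the infinity set.\<close>

lemma wscale_app4: "wscale (wt4 p q r s) c (app4 v e) = app4 (wscale (wt3 p q r) c v) (c ^ s * e)"
  by (simp add: wscale_def vec_eq_iff forall_4 coord_defs)

lemma app4_eq_iff: "app4 u d = app4 v e \<longleftrightarrow> u = v \<and> d = e"
  by (auto simp: vec_eq_iff forall_4 forall_3 coord_defs)

lemma app4_eq_0_iff: "app4 u d = 0 \<longleftrightarrow> u = 0 \<and> d = 0"
  by (auto simp: vec_eq_iff forall_4 forall_3 coord_defs)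

lemma affine_chart:
  assumes "s > 0"
  shows "(app4 u 1, app4 v 1) \<in> wrel (wt4 p q r s) \<longleftrightarrow> (\<exists>c. c ^ s = 1 \<and> v = wscale (wt3 p q r) c u)"
proof -
  have "c \<noteq> 0" if "c ^ s = 1" for c :: complex
    using that assms by (auto simp: power_0_left)
  then show ?thesis
    by (auto simp: wrel_def wscale_app4 app4_eq_iff app4_eq_0_iff)
qed

lemma infinity_set:
  "(app4 u 0, app4 v 0) \<in> wrel (wt4 p q r s) \<longleftrightarrow> (u, v) \<in> wrel (wt3 p q r)"
  by (auto simp: wrel_def wscale_app4 app4_eq_iff app4_eq_0_iff)

text \<open>\<open>B\<close> extends the rational map \<open>A\<close> of the affine chart.\<close>

definition extends :: "nat ^ 4 \<Rightarrow> 4 maps \<Rightarrow> 3 maps \<Rightarrow> bool" where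
  "extends w B A \<longleftrightarrow> (\<exists>F\<in>B. \<exists>f\<in>A. generically (\<lambda>v. (F (app4 v 1), app4 (f v) 1) \<in> wrel w))"

text \<open>\<open>B\<close> is defined at the generic point of the infinity set, maps the infinity set to itself
  and coincides there with \<open>C\<close>.\<close>

definition restricts_to :: "nat ^ 4 \<Rightarrow> 4 maps \<Rightarrow> 3 maps \<Rightarrow> bool" where
  "restricts_to w B C \<longleftrightarrow> (\<exists>F\<in>B. \<exists>G\<in>C. generically (\<lambda>u. (F (app4 u 0), app4 (G u) 0) \<in> wrel w))"

definition extension_hom ::
  "nat ^ 4 \<Rightarrow> ('p, 3) param_maps set \<Rightarrow> (('p, 3) param_maps \<Rightarrow> ('p, 4) param_maps) \<Rightarrow> bool" where
  "extension_hom w W ext \<longleftrightarrow>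
     group_hom (Bir_aff\<lparr>carrier := W\<rparr>) (Bir_param_wproj w) ext \<and>
     (\<forall>\<sigma>\<in>W. fst (ext \<sigma>) = fst \<sigma> \<and> (\<forall>a. extends w (snd (ext \<sigma>) a) (snd \<sigma> a)))"

text \<open>The restricted map \<open>res \<tau>\<close> is required to be the same for all parameter values.\<close>

definition restriction_hom ::
  "nat ^ 4 \<Rightarrow> nat ^ 3 \<Rightarrow> ('p, 4) param_maps set \<Rightarrow> (('p, 4) param_maps \<Rightarrow> 3 maps) \<Rightarrow> bool" where
  "restriction_hom w w' W res \<longleftrightarrow>
     group_hom (Bir_param_wproj w\<lparr>carrier := W\<rparr>) (Bir_wproj w') res \<and>
     (\<forall>\<tau>\<in>W. \<forall>a. restricts_to w (snd \<tau> a) (res \<tau>))"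


section \<open>The foliation on the infinity set\<close>

text \<open>Let \<open>V\<close> be a vector field in homogeneous coordinates with
  \<open>V (wscale w c v) = c * wscale w c (V v)\<close>. In the inhomogeneous chart \<open>v $ k = 1\<close> the curves
  defined by \<open>V\<close> are, up to the choice of time, the integral curves of the following vector
  field; see \<open>chart_field_transform\<close>.\<close>

definition chart_field ::
  "nat ^ 'n \<Rightarrow> 'n \<Rightarrow> (complex ^ 'n \<Rightarrow> complex ^ 'n) \<Rightarrow> complex ^ 'n \<Rightarrow> complex ^ 'n" where
  "chart_field w k V v =
     (\<chi> i. of_nat (w $ k) * v $ k * V v $ i - of_nat (w $ i) * v $ i * V v $ k)"

lemma chart_field_transform:
  fixes V :: "complex ^ 'n \<Rightarrow> complex ^ 'n" and v :: "complex \<Rightarrow> complex ^ 'n"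
  assumes hom: "\<And>c u. V (wscale w c u) = (\<chi> i. c * wscale w c (V u) $ i)"
    and D: "open D" "t \<in> D"
    and v: "\<And>i. ((\<lambda>t. v t $ i) has_field_derivative V (v t) $ i) (at t)"
    and l: "(l has_field_derivative l') (at t)" "l t \<noteq> 0"
    and k: "\<And>t. t \<in> D \<Longrightarrow> wscale w (l t) (v t) $ k = 1" "w $ k > 0"
  shows "((\<lambda>t. wscale w (l t) (v t) $ i) has_field_derivative
           chart_field w k V (wscale w (l t) (v t)) $ i / (of_nat (w $ k) * l t)) (at t)"
proof -
  define u where "u = wscale w (l t) (v t)"
  have der: "((\<lambda>t. wscale w (l t) (v t) $ i) has_field_derivative
      (of_nat (w $ i) * (l' / l t) * u $ i + V u $ i / l t)) (at t)" for i
  proof -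
    have "((\<lambda>t. l t ^ (w $ i) * v t $ i) has_field_derivative
        (of_nat (w $ i) * l t ^ (w $ i - 1) * l') * v t $ i + V (v t) $ i * l t ^ (w $ i)) (at t)"
      by (auto intro!: derivative_eq_intros v l simp: algebra_simps)
    moreover have "(of_nat (w $ i) * l t ^ (w $ i - 1) * l') * v t $ i
        = of_nat (w $ i) * (l' / l t) * u $ i"
      using l(2) by (cases "w $ i") (auto simp: u_def wscale_def)
    moreover have "V (v t) $ i * l t ^ (w $ i) = V u $ i / l t"
      using l(2) unfolding u_def hom by (simp add: wscale_def)
    ultimately show ?thesis by (simp add: wscale_def)
  qed
  have "((\<lambda>t. wscale w (l t) (v t) $ k) has_field_derivative 0) (at t)"
    by (rule DERIV_cong_ev[THEN iffD2, OF refl _ refl, where g1 = "\<lambda>_. 1"])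
      (use D k in \<open>auto simp: eventually_nhds\<close>)
  from DERIV_unique[OF this der[of k]]
  have "of_nat (w $ k) * (l' / l t) * u $ k + V u $ k / l t = 0" by simp
  moreover have uk: "u $ k = 1" using k D by (simp add: u_def)
  ultimately have "l' / l t = - V u $ k / (of_nat (w $ k) * l t)"
    using k(2) l(2) by (simp add: field_simps add_eq_0_iff)
  then have "of_nat (w $ i) * (l' / l t) * u $ i + V u $ i / l t
      = of_nat (w $ i) * (- V u $ k / (of_nat (w $ k) * l t)) * u $ i + V u $ i / l t"
    by (simp only:)
  also have "\<dots> = chart_field w k V u $ i / (of_nat (w $ k) * l t)"
    using k(2) l(2) uk by (simp add: chart_field_def field_simps)
  finally have "of_nat (w $ i) * (l' / l t) * u $ i + V u $ i / l t
      = chart_field w k V u $ i / (of_nat (w $ k) * l t)" .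
  with der[of i] show ?thesis by (simp add: u_def)
qed

text \<open>Integral curves are parametrised by a connected open set of complex times. A leaf consists
  of the points that can be reached through finitely many integral curves in the charts.\<close>

definition integral_curve ::
  "(complex ^ 'n \<Rightarrow> complex ^ 'n) \<Rightarrow> complex set \<Rightarrow> (complex \<Rightarrow> complex ^ 'n) \<Rightarrow> bool" where
  "integral_curve X D \<gamma> \<longleftrightarrow> open D \<and> connected D \<and>
     (\<forall>t\<in>D. \<forall>i. ((\<lambda>t. \<gamma> t $ i) has_field_derivative X (\<gamma> t) $ i) (at t))"

definition leaf_rel ::
  "nat ^ 'n \<Rightarrow> (complex ^ 'n \<Rightarrow> complex ^ 'n) \<Rightarrow> ((complex ^ 'n) set \<times> (complex ^ 'n) set) set" where
  "leaf_rel w V = {(pt w (\<gamma> t), pt w (\<gamma> t')) | k D \<gamma> t t'.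
     integral_curve (chart_field w k V) D \<gamma> \<and> (\<forall>t\<in>D. \<gamma> t $ k = 1) \<and> t \<in> D \<and> t' \<in> D}"

definition leaves ::
  "nat ^ 'n \<Rightarrow> (complex ^ 'n \<Rightarrow> complex ^ 'n) \<Rightarrow> (complex ^ 'n) set set set" where
  "leaves w V = wproj w // (leaf_rel w V)\<^sup>*"

definition at_infinity_set :: "(complex ^ 4 \<Rightarrow> complex ^ 4) \<Rightarrow> complex ^ 3 \<Rightarrow> complex ^ 3" where
  "at_infinity_set V u = (let a = V (app4 u 0) in vector [a $ 1, a $ 2, a $ 3])"


section \<open>The second Painleve equation\<close>

abbreviation PII_wt4 :: "nat ^ 4" where "PII_wt4 \<equiv> wt4 2 1 2 3"
abbreviation PII_wt3 :: "nat ^ 3" where "PII_wt3 \<equiv> wt3 2 1 2"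

text \<open>The equation as an autonomous system on the affine chart, and its homogeneous form.\<close>

definition PII :: "complex \<Rightarrow> complex ^ 3 \<Rightarrow> complex ^ 3" where
  "PII \<alpha> v = (let x = v $ 1; y = v $ 2; z = v $ 3 in vector [2 * y ^ 3 + y * z + \<alpha>, x, 1])"

definition PII_hom :: "complex \<Rightarrow> complex ^ 4 \<Rightarrow> complex ^ 4" where
  "PII_hom \<alpha> v = (let x = v $ 1; y = v $ 2; z = v $ 3; e = v $ 4 in
     vector [2 * y ^ 3 + y * z + \<alpha> * e, x, e, 0])"

lemma PII_hom_affine: "PII_hom \<alpha> (app4 v 1) = app4 (PII \<alpha> v) 0"
  by (simp add: PII_hom_def PII_def Let_def coord_defs)

lemma PII_hom_wscale: "PII_hom \<alpha> (wscale PII_wt4 c v) = (\<chi> i. c * wscale PII_wt4 c (PII_hom \<alpha> v) $ i)"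
  by (simp add: PII_hom_def wscale_def Let_def vec_eq_iff forall_4 coord_defs
      power2_eq_square power3_eq_cube algebra_simps)

text \<open>The foliation in the three charts of the infinity set.\<close>

lemma PII_charts_infinity:
  "chart_field PII_wt3 3 (at_infinity_set (PII_hom \<alpha>)) (vector [X, Y, 1]) =
     vector [4 * Y ^ 3 + 2 * Y, 2 * X, 0]"
  "chart_field PII_wt3 2 (at_infinity_set (PII_hom \<alpha>)) (vector [X, 1, Z]) =
     vector [2 + Z - 2 * X ^ 2, 0, - 2 * X * Z]"
  "chart_field PII_wt3 1 (at_infinity_set (PII_hom \<alpha>)) (vector [1, Y, Z]) =
     vector [0, 2 - 2 * Y ^ 4 - Y ^ 2 * Z, - 4 * Y ^ 3 * Z - 2 * Y * Z ^ 2]"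
  by (simp_all add: chart_field_def at_infinity_set_def PII_hom_def Let_def vec_eq_iff forall_3
      coord_defs power2_eq_square power3_eq_cube power4_eq_xxxx algebra_simps)

text \<open>Products of transformations are compositions of maps, the right factor acting first.\<close>

definition A1_s1 :: "(complex, 3) param_maps" where
  "A1_s1 = (\<lambda>\<alpha>. - \<alpha> + 1, \<lambda>\<alpha>. aff_eq `` {\<lambda>v.
     let x = v $ 1; y = v $ 2; z = v $ 3; f = y ^ 2 - x + z / 2 in
     vector [x + (2 * \<alpha> - 1) * y / f + (\<alpha> - 1 / 2) ^ 2 / f ^ 2, y + (\<alpha> - 1 / 2) / f, z]})"

definition A1_pi :: "(complex, 3) param_maps" where
  "A1_pi = (\<lambda>\<alpha>. - \<alpha>, \<lambda>_. aff_eq `` {\<lambda>v. vector [- v $ 1, - v $ 2, v $ 3]})"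

definition A1_ext_Weyl :: "(complex, 3) param_maps set" where
  "A1_ext_Weyl = generate Bir_aff {A1_s1, A1_pi}"

definition A1_Weyl :: "(complex, 3) param_maps set" where
  "A1_Weyl = generate Bir_aff {A1_s1, A1_pi \<otimes>\<^bsub>Bir_aff\<^esub> A1_s1 \<otimes>\<^bsub>Bir_aff\<^esub> A1_pi}"

definition A1_Aut :: "(complex, 3) param_maps set" where
  "A1_Aut = generate Bir_aff {A1_pi}"


section \<open>The fourth Painleve equation\<close>

abbreviation PIV_wt4 :: "nat ^ 4" where "PIV_wt4 \<equiv> wt4 1 1 1 2"
abbreviation PIV_wt3 :: "nat ^ 3" where "PIV_wt3 \<equiv> wt3 1 1 1"

text \<open>The parameters are the pairs \<open>(\<kappa>\<^sub>0, \<theta>\<^sub>\<infinity>)\<close>.\<close>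

definition PIV :: "complex \<times> complex \<Rightarrow> complex ^ 3 \<Rightarrow> complex ^ 3" where
  "PIV = (\<lambda>(\<kappa>, \<theta>) v. let x = v $ 1; y = v $ 2; z = v $ 3 in
     vector [- (x ^ 2) + 2 * x * y + 2 * x * z - 2 * \<theta>, - (y ^ 2) + 2 * x * y - 2 * y * z - 2 * \<kappa>, 1])"

definition PIV_hom :: "complex \<times> complex \<Rightarrow> complex ^ 4 \<Rightarrow> complex ^ 4" where
  "PIV_hom = (\<lambda>(\<kappa>, \<theta>) v. let x = v $ 1; y = v $ 2; z = v $ 3; e = v $ 4 in
     vector [- (x ^ 2) + 2 * x * y + 2 * x * z - 2 * \<theta> * e,
             - (y ^ 2) + 2 * x * y - 2 * y * z - 2 * \<kappa> * e, e, 0])"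

lemma PIV_hom_affine: "PIV_hom a (app4 v 1) = app4 (PIV a v) 0"
  by (simp add: PIV_hom_def PIV_def Let_def coord_defs split: prod.split)

lemma PIV_hom_wscale: "PIV_hom a (wscale PIV_wt4 c v) = (\<chi> i. c * wscale PIV_wt4 c (PIV_hom a v) $ i)"
  by (simp add: PIV_hom_def wscale_def Let_def vec_eq_iff forall_4 coord_defs
      power2_eq_square algebra_simps split: prod.split)

lemma PIV_charts_infinity:
  "chart_field PIV_wt3 3 (at_infinity_set (PIV_hom a)) (vector [X, Y, 1]) =
     vector [- (X ^ 2) + 2 * X * Y + 2 * X, - (Y ^ 2) + 2 * X * Y - 2 * Y, 0]"
  "chart_field PIV_wt3 2 (at_infinity_set (PIV_hom a)) (vector [X, 1, Z]) =
     vector [3 * X - 3 * X ^ 2 + 4 * X * Z, 0, Z - 2 * X * Z + 2 * Z ^ 2]"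
  "chart_field PIV_wt3 1 (at_infinity_set (PIV_hom a)) (vector [1, Y, Z]) =
     vector [0, 3 * Y - 3 * Y ^ 2 - 4 * Y * Z, Z - 2 * Y * Z - 2 * Z ^ 2]"
  by (simp_all add: chart_field_def at_infinity_set_def PIV_hom_def Let_def vec_eq_iff forall_3
      coord_defs power2_eq_square algebra_simps split: prod.split)

type_synonym PIV_maps = "(complex \<times> complex, 3) param_maps"

definition A2_s0 :: PIV_maps where
  "A2_s0 = (\<lambda>(\<kappa>, \<theta>). (1 + \<theta>, \<kappa> - 1), \<lambda>(\<kappa>, \<theta>). aff_eq `` {\<lambda>v.
     let x = v $ 1; y = v $ 2; z = v $ 3 in
     vector [x + 2 * (1 - \<kappa> + \<theta>) / (x - y - 2 * z), y + 2 * (1 - \<kappa> + \<theta>) / (x - y - 2 * z), z]})"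

definition A2_s1 :: PIV_maps where
  "A2_s1 = (\<lambda>(\<kappa>, \<theta>). (- \<kappa>, \<theta> - \<kappa>), \<lambda>(\<kappa>, \<theta>). aff_eq `` {\<lambda>v.
     let x = v $ 1; y = v $ 2; z = v $ 3 in vector [x - 2 * \<kappa> / y, y, z]})"

definition A2_s2 :: PIV_maps where
  "A2_s2 = (\<lambda>(\<kappa>, \<theta>). (\<kappa> - \<theta>, - \<theta>), \<lambda>(\<kappa>, \<theta>). aff_eq `` {\<lambda>v.
     let x = v $ 1; y = v $ 2; z = v $ 3 in vector [x, y - 2 * \<theta> / x, z]})"

text \<open>The squares of the next two maps act on the coordinates by \<open>-1\<close>, which is the identity of
  the affine chart (the quotient by the cyclic group of order 2) but not of its cover. The
  relations of the symmetric group of degree 3 thus hold after extension to the weighted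
  projective space.\<close>

definition A2_sigma1 :: PIV_maps where
  "A2_sigma1 = (\<lambda>(\<kappa>, \<theta>). (- \<theta>, - \<kappa>), \<lambda>_. aff_eq `` {\<lambda>v.
     let x = v $ 1; y = v $ 2; z = v $ 3 in vector [- \<i> * y, - \<i> * x, \<i> * z]})"

definition A2_sigma2 :: PIV_maps where
  "A2_sigma2 = (\<lambda>(\<kappa>, \<theta>). (\<kappa>, \<kappa> - \<theta> - 1), \<lambda>_. aff_eq `` {\<lambda>v.
     let x = v $ 1; y = v $ 2; z = v $ 3 in vector [\<i> * x, \<i> * (x - y - 2 * z), \<i> * z]})"

definition A2_ext_Weyl :: "PIV_maps set" where
  "A2_ext_Weyl = generate Bir_aff {A2_s0, A2_s1, A2_s2, A2_sigma1, A2_sigma2}"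

definition A2_Weyl :: "PIV_maps set" where
  "A2_Weyl = generate Bir_aff {A2_s0, A2_s1, A2_s2}"

definition A2_Aut :: "PIV_maps set" where
  "A2_Aut = generate Bir_aff {A2_sigma1, A2_sigma2}"

end

theory Submission
  imports Defs "HOL-Complex_Analysis.Conformal_Mappings"
begin

text \<open>In weighted homogeneous coordinates each generator becomes a tuple of polynomials whose
  terms with a parameter carry a factor \<open>\<epsilon>\<close>. On \<open>\<epsilon> = 0\<close> such a tuple for a reflection is the identity
  multiplied by a scalar \<open>f\<close> (with its weights), while the diagram automorphisms are linear.
  The extension to the projective space and the restriction to infinity are uniquely determined by
  the given map, which makes them homomorphisms. Uniqueness rests on the fact that \<open>wrel\<close> is closed
  on pairs of nonzero vectors, so that a generic equality persists wherever both sides are defined.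
  The diagram automorphisms send the vector field at infinity to a constant multiple of itself and
  hence permute the leaves.\<close>


section \<open>Polynomial functions and generic properties\<close>

text \<open>Maps matter only modulo generic equality, and such an equality can be pulled back only
  along a dominant map, so the groups of birational maps presuppose that invertible maps are
  dominant. On the weighted space a tuple with an inverse separates only orbits, not vectors, and
  local injectivity on vectors has to be recovered from the scaling degree. The polynomial tuples
  arise as follows. The denominator \<open>f\<close> of a reflection is a weighted homogeneous form.
  Powers of \<epsilon> make the correction terms homogeneous, and the weighted action of the scalar
  \<open>f\<close> then clears the denominators. For the diagram automorphisms of the fourth
  equation the scalar -i removes the factors i: maps of order four on the cover become involutive
  tuples, at the cost of a sign in \<epsilon>. No defining relation of an affine Weyl group is ever
  verified. The braid relation of the two diagram automorphisms serves only to show that they act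
  faithfully at infinity.\<close>

lemma poly_fun_line:
  fixes h :: "complex ^ 'n \<Rightarrow> complex"
  assumes "poly_fun h"
  shows "\<exists>p. \<forall>t. h (a + t *s b) = poly p t"
  using assms
proof induction
  case (const c)
  show ?case by (rule exI[of _ "[:c:]"]) simp
next
  case (coord i)
  show ?case by (rule exI[of _ "[:a $ i, b $ i:]"]) simp
next
  case (add f g)
  then obtain p q where "\<forall>t. f (a + t *s b) = poly p t" "\<forall>t. g (a + t *s b) = poly q t" by blast
  then show ?case by (intro exI[of _ "p + q"]) simp
next
  case (mult f g)
  then obtain p q where "\<forall>t. f (a + t *s b) = poly p t" "\<forall>t. g (a + t *s b) = poly q t" by blast
  then show ?case by (intro exI[of _ "p * q"]) simp
qed

lemma poly_fun_continuous:
  fixes h :: "complex ^ 'n \<Rightarrow> complex"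
  assumes "poly_fun h"
  shows "continuous_on S h"
  using assms by induction (intro continuous_intros; assumption)+

lemma poly_fun_compose:
  fixes h :: "complex ^ 'n \<Rightarrow> complex" and F :: "complex ^ 'm \<Rightarrow> complex ^ 'n"
  assumes "poly_fun h" and F: "\<And>i. poly_fun (\<lambda>v. F v $ i)"
  shows "poly_fun (\<lambda>v. h (F v))"
  using assms(1) by induction (intro poly_fun.intros F; assumption)+

lemma poly_fun_uminus: "poly_fun f \<Longrightarrow> poly_fun (\<lambda>v. - f v)"
  using poly_fun.mult[OF poly_fun.const[of "-1"], of f] by simp

lemma poly_fun_diff: "poly_fun f \<Longrightarrow> poly_fun g \<Longrightarrow> poly_fun (\<lambda>v. f v - g v)"
  using poly_fun.add[OF _ poly_fun_uminus, of f g] by simp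

lemma poly_fun_power: "poly_fun f \<Longrightarrow> poly_fun (\<lambda>v. f v ^ k)"
  by (induction k) (auto intro: poly_fun.intros)

lemma poly_fun_divide: "poly_fun f \<Longrightarrow> poly_fun (\<lambda>v. f v / c)"
  using poly_fun.mult[OF _ poly_fun.const[of "inverse c"], of f] by (simp add: divide_inverse)

lemmas poly_fun_intros = poly_fun.intros poly_fun_uminus poly_fun_diff poly_fun_power

lemma open_nonzero_poly_fun:
  assumes "poly_fun h"
  shows "open {v. h v \<noteq> 0}"
  using open_Collect_neq[OF poly_fun_continuous[OF assms] continuous_on_const[of _ 0]] by simp

text \<open>On the line through \<open>u\<close> and \<open>v0\<close> the function is a nonzero
  polynomial in one variable with finitely many roots, whereas an open set around \<open>u\<close>
  contains infinitely many points of the line.\<close>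

lemma nonzero_poly_fun_dense:
  fixes h :: "complex ^ 'n \<Rightarrow> complex"
  assumes h: "poly_fun h" "h v0 \<noteq> 0" and U: "open U" "u \<in> U"
  shows "\<exists>v\<in>U. h v \<noteq> 0"
proof -
  obtain p where p: "\<And>t. h (u + t *s (v0 - u)) = poly p t"
    using poly_fun_line[OF h(1)] by blast
  have "poly p 1 \<noteq> 0" using h(2) p[of 1] by simp
  then have fin: "finite {t. poly p t = 0}" by (intro poly_roots_finite) auto
  define \<gamma> where "\<gamma> = (\<lambda>t::complex. u + t *s (v0 - u))"
  have "continuous_on UNIV \<gamma>"
    unfolding \<gamma>_def by (intro continuous_on_vec_lambda continuous_intros
        | simp add: vector_scalar_mult_def)+
  then have "open (\<gamma> -` U)" using U(1) by (simp add: open_vimage)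
  moreover have "0 \<in> \<gamma> -` U" using U(2) by (simp add: \<gamma>_def)
  ultimately have "infinite (\<gamma> -` U)"
    by (metis empty_iff finite_imp_not_open)
  then obtain t where "t \<in> \<gamma> -` U" "poly p t \<noteq> 0"
    using fin by (metis (mono_tags, lifting) finite_subset mem_Collect_eq subsetI)
  moreover have "h (\<gamma> t) = poly p t" unfolding \<gamma>_def by (rule p)
  ultimately show ?thesis by (intro bexI[of _ "\<gamma> t"]) auto
qed

lemma nonzero_poly_fun_mult:
  fixes h :: "complex ^ 'n \<Rightarrow> complex"
  assumes "poly_fun h" "\<exists>v. h v \<noteq> 0" "poly_fun k" "\<exists>v. k v \<noteq> 0"
  shows "\<exists>v. h v * k v \<noteq> 0"
  using nonzero_poly_fun_dense[OF assms(1) _ open_nonzero_poly_fun[OF assms(3)]] assms(2,4)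
  by auto

lemma genericallyI: "poly_fun h \<Longrightarrow> h v0 \<noteq> 0 \<Longrightarrow> (\<And>v. h v \<noteq> 0 \<Longrightarrow> P v) \<Longrightarrow> generically P"
  unfolding generically_def by blast

lemma generically_nonzero: "poly_fun h \<Longrightarrow> \<exists>v. h v \<noteq> 0 \<Longrightarrow> generically (\<lambda>v. h v \<noteq> 0)"
  unfolding generically_def by blast

lemma generically_True: "(\<And>v. P v) \<Longrightarrow> generically P"
  by (rule genericallyI[OF poly_fun.const[of 1]]) auto

lemma generically_mono: "generically P \<Longrightarrow> (\<And>v. P v \<Longrightarrow> Q v) \<Longrightarrow> generically Q"
  unfolding generically_def by blast

lemma generically_conj:
  assumes "generically P" "generically Q"
  shows "generically (\<lambda>v. P v \<and> Q v)"
proof -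
  obtain h k where "poly_fun h" "\<exists>v. h v \<noteq> 0" "\<And>v. h v \<noteq> 0 \<Longrightarrow> P v"
    and "poly_fun k" "\<exists>v. k v \<noteq> 0" "\<And>v. k v \<noteq> 0 \<Longrightarrow> Q v"
    using assms unfolding generically_def by blast
  then show ?thesis
    using nonzero_poly_fun_mult[of h k] unfolding generically_def
    by (intro exI[of _ "\<lambda>v. h v * k v"]) (auto intro: poly_fun.intros)
qed

lemma generically_mp2:
  "generically P \<Longrightarrow> generically Q \<Longrightarrow> (\<And>v. P v \<Longrightarrow> Q v \<Longrightarrow> R v) \<Longrightarrow> generically R"
  by (rule generically_mono[OF generically_conj[of P Q]]) auto

lemma generically_finite_all:
  assumes "\<And>i::'i::finite. generically (P i)"
  shows "generically (\<lambda>v. \<forall>i. P i v)"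
proof -
  have "generically (\<lambda>v. \<forall>i\<in>I. P i v)" if "finite I" for I
    using that by induction (use assms in \<open>auto intro: generically_True generically_conj\<close>)
  from this[OF finite[of UNIV]] show ?thesis by simp
qed

lemma generically_open_ex:
  assumes "generically P" "open U" "U \<noteq> {}"
  shows "\<exists>v\<in>U. P v"
  using assms nonzero_poly_fun_dense unfolding generically_def by blast

lemma generically_ex: "generically P \<Longrightarrow> \<exists>v. P v"
  using generically_open_ex[of P UNIV] by auto

text \<open>Used to pass from a generic statement to a statement at a prescribed point by taking
  limits.\<close>

lemma generically_sequence:
  assumes "generically P"
  obtains X where "\<And>n::nat. P (X n)" "X \<longlonglongrightarrow> v"
proof -
  have "\<exists>x\<in>ball v (inverse (Suc n)). P x" for n
    using generically_open_ex[OF assms, of "ball v (inverse (Suc n))"] by auto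
  then have "\<forall>n. \<exists>x. x \<in> ball v (inverse (Suc n)) \<and> P x" by blast
  from choice[OF this] obtain X where X: "\<And>n. X n \<in> ball v (inverse (Suc n))" "\<And>n. P (X n)"
    by blast
  have "dist (X n) v \<le> inverse (real (Suc n))" for n
    using X(1)[of n] by (simp add: dist_commute less_imp_le)
  then have "(\<lambda>n. dist (X n) v) \<longlonglongrightarrow> 0"
    by (intro tendsto_sandwich[OF _ _ tendsto_const LIMSEQ_inverse_real_of_nat] always_eventually allI)
       simp_all
  then have "X \<longlonglongrightarrow> v" by (rule tendsto_dist_iff[THEN iffD2])
  with X(2) show ?thesis by (rule that)
qed

section \<open>Rational functions\<close>

definition rat_fun :: "(complex ^ 'n \<Rightarrow> complex) \<Rightarrow> bool" where
  "rat_fun q \<longleftrightarrow> (\<exists>N D. poly_fun N \<and> poly_fun D \<and> (\<exists>v. D v \<noteq> 0) \<and> (\<forall>v. D v \<noteq> 0 \<longrightarrow> q v = N v / D v))"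

lemma rational_map_iff: "rational_map f \<longleftrightarrow> (\<forall>i. rat_fun (\<lambda>v. f v $ i))"
  by (simp add: rational_map_def rat_fun_def)

lemma rat_fun_poly: "poly_fun f \<Longrightarrow> rat_fun f"
  unfolding rat_fun_def by (intro exI[of _ f] exI[of _ "\<lambda>_. 1"]) (auto intro: poly_fun.intros)

text \<open>Multiplying numerator and denominator by the polynomial \<open>h\<close> of the generic
  set moves the exceptional points into the zero set of the denominator. A formula valid generically
  is thus enough.\<close>

lemma rat_funI:
  assumes "poly_fun N" "poly_fun D" "\<exists>v. D v \<noteq> 0" "generically (\<lambda>v. q v = N v / D v)"
  shows "rat_fun q"
proof -
  obtain h where h: "poly_fun h" "\<exists>v. h v \<noteq> 0" "\<And>v. h v \<noteq> 0 \<Longrightarrow> q v = N v / D v"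
    using assms(4) unfolding generically_def by blast
  show ?thesis unfolding rat_fun_def
    using nonzero_poly_fun_mult[OF assms(2,3) h(1,2)] h assms
    by (intro exI[of _ "\<lambda>v. N v * h v"] exI[of _ "\<lambda>v. D v * h v"]) (auto intro: poly_fun.intros)
qed

lemma rat_funE:
  assumes "rat_fun q"
  obtains N D where "poly_fun N" "poly_fun D" "\<exists>v. D v \<noteq> 0"
    "generically (\<lambda>v. D v \<noteq> 0 \<and> q v = N v / D v)"
proof -
  obtain N D where "poly_fun N" "poly_fun D" "\<exists>v. D v \<noteq> 0"
    "\<forall>v. D v \<noteq> 0 \<longrightarrow> q v = N v / D v" using assms unfolding rat_fun_def by blast
  then show ?thesis using that[of N D] unfolding generically_def by blast
qed

lemma rat_fun_cong: "rat_fun q \<Longrightarrow> generically (\<lambda>v. q' v = q v) \<Longrightarrow> rat_fun q'"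
  by (erule rat_funE, rule rat_funI) (auto elim: generically_mp2)

lemma rat_fun_add:
  assumes "rat_fun q" "rat_fun r" shows "rat_fun (\<lambda>v. q v + r v)"
proof -
  obtain N D where 1: "poly_fun N" "poly_fun D" "\<exists>v. D v \<noteq> 0"
    "generically (\<lambda>v. D v \<noteq> 0 \<and> q v = N v / D v)" using rat_funE[OF assms(1)] by blast
  obtain M C where 2: "poly_fun M" "poly_fun C" "\<exists>v. C v \<noteq> 0"
    "generically (\<lambda>v. C v \<noteq> 0 \<and> r v = M v / C v)" using rat_funE[OF assms(2)] by blast
  show ?thesis
    by (rule rat_funI[of "\<lambda>v. N v * C v + M v * D v" "\<lambda>v. D v * C v"])
       (use 1 2 nonzero_poly_fun_mult[OF 1(2,3) 2(2,3)] in
         \<open>auto intro!: poly_fun.intros intro: generically_mp2[OF 1(4) 2(4)] simp: field_simps\<close>)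
qed

lemma rat_fun_mult:
  assumes "rat_fun q" "rat_fun r" shows "rat_fun (\<lambda>v. q v * r v)"
proof -
  obtain N D where 1: "poly_fun N" "poly_fun D" "\<exists>v. D v \<noteq> 0"
    "generically (\<lambda>v. D v \<noteq> 0 \<and> q v = N v / D v)" using rat_funE[OF assms(1)] by blast
  obtain M C where 2: "poly_fun M" "poly_fun C" "\<exists>v. C v \<noteq> 0"
    "generically (\<lambda>v. C v \<noteq> 0 \<and> r v = M v / C v)" using rat_funE[OF assms(2)] by blast
  show ?thesis
    by (rule rat_funI[of "\<lambda>v. N v * M v" "\<lambda>v. D v * C v"])
       (use 1 2 nonzero_poly_fun_mult[OF 1(2,3) 2(2,3)] in
         \<open>auto intro!: poly_fun.intros intro: generically_mp2[OF 1(4) 2(4)]\<close>)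
qed

lemma rat_fun_inverse:
  assumes "rat_fun q" shows "rat_fun (\<lambda>v. inverse (q v))"
proof -
  obtain N D where *: "poly_fun N" "poly_fun D" "\<exists>v. D v \<noteq> 0"
    "generically (\<lambda>v. D v \<noteq> 0 \<and> q v = N v / D v)" using rat_funE[OF assms] by blast
  show ?thesis
  proof (cases "\<exists>v. N v \<noteq> 0")
    case True
    show ?thesis by (rule rat_funI[of D N]) (use * True in \<open>auto elim: generically_mono\<close>)
  next
    \<comment> \<open>Here \<open>q\<close> vanishes generically, and so does its inverse because
      \<open>inverse 0 = 0\<close>.\<close>
    case False
    show ?thesis
      by (rule rat_funI[of "\<lambda>_. 0" "\<lambda>_. 1"])
         (use * False in \<open>auto intro: poly_fun.intros elim: generically_mono\<close>)
  qed
qed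

lemma rat_fun_uminus: "rat_fun q \<Longrightarrow> rat_fun (\<lambda>v. - q v)"
  using rat_fun_mult[OF rat_fun_poly[OF poly_fun.const[of "-1"]], of q] by simp

lemma rat_fun_diff: "rat_fun q \<Longrightarrow> rat_fun r \<Longrightarrow> rat_fun (\<lambda>v. q v - r v)"
  using rat_fun_add[OF _ rat_fun_uminus, of q r] by simp

lemma rat_fun_divide: "rat_fun q \<Longrightarrow> rat_fun r \<Longrightarrow> rat_fun (\<lambda>v. q v / r v)"
  using rat_fun_mult[OF _ rat_fun_inverse, of q r] by (simp add: divide_inverse)

lemma rat_fun_power: "rat_fun q \<Longrightarrow> rat_fun (\<lambda>v. q v ^ k)"
  by (induction k) (auto intro: rat_fun_mult rat_fun_poly poly_fun.const)

lemmas rat_fun_intros = rat_fun_poly[OF poly_fun.const] rat_fun_poly[OF poly_fun.coord]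
  rat_fun_add rat_fun_mult rat_fun_divide rat_fun_power rat_fun_uminus rat_fun_diff

text \<open>The numerator is either identically zero or nonzero on a nonempty Zariski open set. This
  dichotomy lets \<open>dominantI\<close> assume only that no nonzero polynomial vanishes
  generically along the map.\<close>

lemma rat_fun_zero_cases:
  assumes "rat_fun q"
  shows "generically (\<lambda>v. q v = 0) \<or> generically (\<lambda>v. q v \<noteq> 0)"
proof -
  obtain N D where *: "poly_fun N" "poly_fun D" "\<exists>v. D v \<noteq> 0"
    "generically (\<lambda>v. D v \<noteq> 0 \<and> q v = N v / D v)" using rat_funE[OF assms] by blast
  show ?thesis
  proof (cases "\<exists>v. N v \<noteq> 0")
    case True
    then have "generically (\<lambda>v. N v \<noteq> 0)" using *(1) unfolding generically_def by blast
    have "generically (\<lambda>v. q v \<noteq> 0)"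
      by (rule generically_mp2[OF *(4) \<open>generically (\<lambda>v. N v \<noteq> 0)\<close>]) auto
    then show ?thesis ..
  next
    case False
    have "generically (\<lambda>v. q v = 0)" by (rule generically_mono[OF *(4)]) (use False in auto)
    then show ?thesis ..
  qed
qed

lemma rat_fun_poly_compose:
  assumes "poly_fun h" "rational_map f"
  shows "rat_fun (\<lambda>v. h (f v))"
  using assms(1)
  by induction (use assms(2) in \<open>auto simp: rational_map_iff intro: rat_fun_intros\<close>)

section \<open>Dominant maps\<close>

text \<open>Density of the image, stated in the form in which it is applied: generic properties pull
  back.\<close>

definition dominant :: "(complex ^ 'n \<Rightarrow> complex ^ 'n) \<Rightarrow> bool" where
  "dominant f \<longleftrightarrow> (\<forall>P. generically P \<longrightarrow> generically (\<lambda>v. P (f v)))"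

lemma dominantD: "dominant f \<Longrightarrow> generically P \<Longrightarrow> generically (\<lambda>v. P (f v))"
  unfolding dominant_def by blast

lemma dominantI:
  fixes f :: "complex ^ 'n \<Rightarrow> complex ^ 'n"
  assumes f: "rational_map f"
    and ne: "\<And>h. poly_fun h \<Longrightarrow> \<exists>v. h v \<noteq> 0 \<Longrightarrow> \<not> generically (\<lambda>v. h (f v) = 0)"
  shows "dominant f"
  unfolding dominant_def
proof safe
  fix P :: "complex ^ 'n \<Rightarrow> bool" assume "generically P"
  then obtain h where h: "poly_fun h" "\<exists>v. h v \<noteq> 0" "\<And>v. h v \<noteq> 0 \<Longrightarrow> P v"
    unfolding generically_def by blast
  have "generically (\<lambda>v. h (f v) \<noteq> 0)"
    using rat_fun_zero_cases[OF rat_fun_poly_compose[OF h(1) f]] ne[OF h(1,2)] by blast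
  then show "generically (\<lambda>v. P (f v))" using h(3) by (rule generically_mono)
qed

lemma rational_map_continuous:
  fixes f :: "complex ^ 'n \<Rightarrow> complex ^ 'n"
  assumes "rational_map f"
  shows "\<exists>D. poly_fun D \<and> (\<exists>v. D v \<noteq> 0) \<and> continuous_on {v. D v \<noteq> 0} f"
proof -
  have "\<forall>i. \<exists>N D. poly_fun N \<and> poly_fun D \<and> (\<exists>v. D v \<noteq> 0) \<and> (\<forall>v. D v \<noteq> 0 \<longrightarrow> f v $ i = N v / D v)"
    using assms unfolding rational_map_def .
  then obtain N D where ND: "\<And>i. poly_fun (N i)" "\<And>i. poly_fun (D i)" "\<And>i. \<exists>v. D i v \<noteq> 0"
    "\<And>i v. D i v \<noteq> 0 \<Longrightarrow> f v $ i = N i v / D i v" by metis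
  have "generically (\<lambda>v. \<forall>i. D i v \<noteq> 0)"
    by (rule generically_finite_all, rule generically_nonzero) (use ND in blast)+
  then obtain h where h: "poly_fun h" "\<exists>v. h v \<noteq> 0" "\<And>v i. h v \<noteq> 0 \<Longrightarrow> D i v \<noteq> 0"
    unfolding generically_def by blast
  have "continuous_on {v. h v \<noteq> 0} (\<lambda>v. \<chi> i. N i v / D i v)"
    by (intro continuous_on_vec_lambda continuous_on_divide poly_fun_continuous ND) (use h in auto)
  then have "continuous_on {v. h v \<noteq> 0} f"
    by (rule continuous_on_cong[THEN iffD1, OF refl, rotated]) (use ND h in \<open>auto simp: vec_eq_iff\<close>)
  with h show ?thesis by blast
qed

text \<open>Invariance of domain replaces the dimension argument: an injective rational map cannot
  send a nonempty open set into a hypersurface.\<close>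

lemma inj_not_in_hypersurface:
  fixes f :: "complex ^ 'n \<Rightarrow> complex ^ 'n"
  assumes "open U" "U \<noteq> {}" "continuous_on U f" "inj_on f U" "poly_fun h" "\<exists>v. h v \<noteq> 0"
  shows "\<exists>v\<in>U. h (f v) \<noteq> 0"
proof -
  have "open (f ` U)" using invariance_of_domain[OF assms(3,1,4)] .
  moreover obtain u where "u \<in> U" using assms(2) by blast
  ultimately show ?thesis using nonzero_poly_fun_dense[of h _ "f ` U" "f u"] assms(5,6) by blast
qed

text \<open>On a nonempty open set \<open>f\<close> is continuous and, having the left inverse
  \<open>k\<close>, injective, so its image there cannot lie in a hypersurface. The function
  \<open>k\<close> is arbitrary.\<close>

lemma dominant_if_left_inverse:
  fixes f :: "complex ^ 'n \<Rightarrow> complex ^ 'n"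
  assumes f: "rational_map f" and k: "generically (\<lambda>v. k (f v) = v)"
  shows "dominant f"
proof (rule dominantI[OF f], rule notI)
  fix h :: "complex ^ 'n \<Rightarrow> complex" assume h: "poly_fun h" "\<exists>v. h v \<noteq> 0" "generically (\<lambda>v. h (f v) = 0)"
  obtain D where D: "poly_fun D" "\<exists>v. D v \<noteq> 0" "continuous_on {v. D v \<noteq> 0} f"
    using rational_map_continuous[OF f] by blast
  have "generically (\<lambda>v. (k (f v) = v \<and> h (f v) = 0) \<and> D v \<noteq> 0)"
    by (intro generically_conj generically_nonzero k h(3) D)
  then obtain g where g: "poly_fun g" "\<exists>v. g v \<noteq> 0"
    "\<And>v. g v \<noteq> 0 \<Longrightarrow> (k (f v) = v \<and> h (f v) = 0) \<and> D v \<noteq> 0" unfolding generically_def by blast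
  have "inj_on f {v. g v \<noteq> 0}" using g(3) by (intro inj_on_inverseI[of _ k]) auto
  then have "\<exists>v\<in>{v. g v \<noteq> 0}. h (f v) \<noteq> 0"
    by (intro inj_not_in_hypersurface open_nonzero_poly_fun g h continuous_on_subset[OF D(3)])
       (use g in auto)
  with g(3) show False by auto
qed

text \<open>Dominance of \<open>g\<close> keeps the denominators of \<open>f\<close> from vanishing
  generically after substitution.\<close>

lemma rational_map_compose:
  assumes f: "rational_map f" and g: "rational_map g" "dominant g"
  shows "rational_map (f \<circ> g)"
  unfolding rational_map_iff
proof
  fix i
  obtain N D where *: "poly_fun N" "poly_fun D" "\<exists>v. D v \<noteq> 0"
    "generically (\<lambda>v. D v \<noteq> 0 \<and> f v $ i = N v / D v)"
    using f rat_funE[of "\<lambda>v. f v $ i"] unfolding rational_map_iff by blast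
  show "rat_fun (\<lambda>v. (f \<circ> g) v $ i)"
    by (rule rat_fun_cong[OF rat_fun_divide[OF rat_fun_poly_compose[OF *(1) g(1)]
          rat_fun_poly_compose[OF *(2) g(1)]]])
       (use dominantD[OF g(2) *(4)] in \<open>auto elim: generically_mono\<close>)
qed

section \<open>Weighted projective spaces\<close>

lemma wscale_1: "wscale w 1 v = v"
  by (simp add: wscale_def vec_eq_iff)

lemma wscale_wscale: "wscale w c (wscale w d v) = wscale w (c * d) v"
  by (simp add: wscale_def vec_eq_iff power_mult_distrib)

lemma wscale_zero_iff: "c \<noteq> 0 \<Longrightarrow> wscale w c v = 0 \<longleftrightarrow> v = 0"
  by (simp add: wscale_def vec_eq_iff)

lemma wrel_refl: "v \<noteq> 0 \<Longrightarrow> (v, v) \<in> wrel w"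
  unfolding wrel_def using wscale_1[of w v] by (auto intro!: exI[of _ 1])

lemma wrel_sym:
  assumes "(u, v) \<in> wrel w"
  shows "(v, u) \<in> wrel w"
proof -
  obtain c where c: "u \<noteq> 0" "v \<noteq> 0" "c \<noteq> 0" "v = wscale w c u" using assms by (auto simp: wrel_def)
  then have "u = wscale w (inverse c) v" "inverse c \<noteq> 0" by (simp_all add: wscale_wscale wscale_1)
  with c(1,2) show ?thesis unfolding wrel_def by blast
qed

lemma wrel_trans:
  assumes "(u, v) \<in> wrel w" "(v, x) \<in> wrel w"
  shows "(u, x) \<in> wrel w"
proof -
  obtain c d where "c \<noteq> 0" "v = wscale w c u" "d \<noteq> 0" "x = wscale w d v" "u \<noteq> 0" "x \<noteq> 0"
    using assms by (auto simp: wrel_def)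
  then have "x = wscale w (d * c) u" "d * c \<noteq> 0" "u \<noteq> 0" "x \<noteq> 0" by (simp_all add: wscale_wscale)
  then show ?thesis unfolding wrel_def by blast
qed

lemma wrel_nonzero: "(u, v) \<in> wrel w \<Longrightarrow> u \<noteq> 0 \<and> v \<noteq> 0"
  by (auto simp: wrel_def)

lemma wrel_wscale: "v \<noteq> 0 \<Longrightarrow> c \<noteq> 0 \<Longrightarrow> (v, wscale w c v) \<in> wrel w"
  by (auto simp: wrel_def wscale_zero_iff)

lemma wrel_wscale': "v \<noteq> 0 \<Longrightarrow> c \<noteq> 0 \<Longrightarrow> (wscale w c v, v) \<in> wrel w"
  by (rule wrel_sym[OF wrel_wscale])

lemma equiv_wrel: "equiv (UNIV - {0}) (wrel w)"
proof (rule equivI)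
  show "wrel w \<subseteq> (UNIV - {0}) \<times> (UNIV - {0})" by (auto dest: wrel_nonzero)
qed (auto intro: refl_onI symI transI wrel_refl wrel_sym wrel_trans)

lemma pt_eq_iff: "u \<noteq> 0 \<Longrightarrow> v \<noteq> 0 \<Longrightarrow> pt w u = pt w v \<longleftrightarrow> (u, v) \<in> wrel w"
  unfolding pt_def using equiv_wrel eq_equiv_class_iff by fastforce

lemma pt_in_wproj: "v \<noteq> 0 \<Longrightarrow> pt w v \<in> wproj w"
  unfolding pt_def wproj_def by (rule quotientI) simp

lemma wprojE: assumes "p \<in> wproj w" obtains v where "v \<noteq> 0" "p = pt w v"
  using assms unfolding wproj_def pt_def by (auto elim!: quotientE)

text \<open>At a coordinate where the limit \<open>a\<close> is nonzero, the powers of the scalars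
  \<open>c n\<close> converge, so the scalars are bounded and a subsequence converges to some
  \<open>l\<close>. Since all weights are positive, \<open>l = 0\<close> would force
  \<open>b = 0\<close>.\<close>

lemma wrel_limit:
  fixes w :: "nat ^ 'n" and a b :: "complex ^ 'n"
  assumes w: "\<And>i. w $ i > 0" and X: "\<And>n. (X n, Y n) \<in> wrel w" "X \<longlonglongrightarrow> a" "Y \<longlonglongrightarrow> b"
    and ab: "a \<noteq> 0" "b \<noteq> 0"
  shows "(a, b) \<in> wrel w"
proof -
  have "\<forall>n. \<exists>c. c \<noteq> 0 \<and> Y n = wscale w c (X n)" using X(1) by (auto simp: wrel_def)
  then obtain c where c: "\<And>n. c n \<noteq> 0" "\<And>n. Y n = wscale w (c n) (X n)" by metis
  have Xi: "(\<lambda>n. X n $ i) \<longlonglongrightarrow> a $ i" and Yi: "(\<lambda>n. Y n $ i) \<longlonglongrightarrow> b $ i" for i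
    using X(2,3) by (auto intro: tendsto_vec_nth)
  obtain i where i: "a $ i \<noteq> 0" using ab(1) by (auto simp: vec_eq_iff)
  have Yc: "Y n $ i = c n ^ (w $ i) * X n $ i" for n i using c(2)[of n] by (simp add: wscale_def)
  have "eventually (\<lambda>n. X n $ i \<noteq> 0) sequentially"
    using Xi i by (rule tendsto_imp_eventually_ne)
  then have "eventually (\<lambda>n. Y n $ i / X n $ i = c n ^ (w $ i)) sequentially"
    by eventually_elim (simp add: Yc)
  then have lim: "(\<lambda>n. c n ^ (w $ i)) \<longlonglongrightarrow> b $ i / a $ i"
    using tendsto_divide[OF Yi Xi i] tendsto_cong by fast
  then have "Bseq (\<lambda>n. c n ^ (w $ i))" by (metis convergent_def convergent_imp_Bseq)
  then obtain K where K: "\<And>n. norm (c n) ^ (w $ i) \<le> K"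
    unfolding Bseq_def by (auto simp: norm_power)
  have "norm (c n) \<le> max 1 K" for n
  proof (cases "norm (c n) \<le> 1")
    case False
    then have "norm (c n) ^ 1 \<le> norm (c n) ^ (w $ i)" using w[of i] by (intro power_increasing) auto
    with K[of n] show ?thesis by simp
  qed simp
  then have "bounded (range c)" unfolding bounded_iff by blast
  then obtain l r where r: "strict_mono r" "(c \<circ> r) \<longlonglongrightarrow> l"
    using bounded_imp_convergent_subsequence[of c] by blast
  have bl: "b $ i = l ^ (w $ i) * a $ i" for i
  proof (rule LIMSEQ_unique)
    show "((\<lambda>n. Y n $ i) \<circ> r) \<longlonglongrightarrow> b $ i" using Yi r(1) by (rule LIMSEQ_subseq_LIMSEQ)
    have "(\<lambda>n. (c \<circ> r) n ^ (w $ i) * ((\<lambda>n. X n $ i) \<circ> r) n) \<longlonglongrightarrow> l ^ (w $ i) * a $ i"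
      by (intro tendsto_mult tendsto_power r(2) LIMSEQ_subseq_LIMSEQ[OF Xi r(1)])
    then show "((\<lambda>n. Y n $ i) \<circ> r) \<longlonglongrightarrow> l ^ (w $ i) * a $ i" by (simp add: o_def Yc)
  qed
  have "l \<noteq> 0"
  proof
    assume "l = 0"
    then have "b $ i = 0" for i using bl[of i] w[of i] by (simp add: power_0_left)
    then have "b = 0" by (simp add: vec_eq_iff)
    with ab show False by simp
  qed
  with bl ab show ?thesis unfolding wrel_def by (auto simp: wscale_def vec_eq_iff)
qed

lemma wrel_generically_imp:
  fixes F G :: "complex ^ 'm \<Rightarrow> complex ^ 'n"
  assumes w: "\<And>i. w $ i > 0" and "continuous_on UNIV F" "continuous_on UNIV G"
    and gen: "generically (\<lambda>v. (F v, G v) \<in> wrel w)" and "F v \<noteq> 0" "G v \<noteq> 0"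
  shows "(F v, G v) \<in> wrel w"
proof -
  obtain X where X: "\<And>n. (F (X n), G (X n)) \<in> wrel w" "X \<longlonglongrightarrow> v"
    using generically_sequence[OF gen] by blast
  show ?thesis
    by (rule wrel_limit[OF w X(1)])
       (use assms X(2) in \<open>auto intro: continuous_on_tendsto_compose[where s=UNIV]\<close>)
qed

section \<open>Polynomial maps and weighted homogeneous tuples\<close>

definition poly_map :: "(complex ^ 'm \<Rightarrow> complex ^ 'n) \<Rightarrow> bool" where
  "poly_map F \<longleftrightarrow> (\<forall>i. poly_fun (\<lambda>v. F v $ i))"

lemma poly_map_continuous: "poly_map F \<Longrightarrow> continuous_on UNIV F"
  using continuous_on_vec_lambda[of UNIV "\<lambda>i v. F v $ i"] poly_fun_continuous
  unfolding poly_map_def by fastforce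

lemma poly_map_id: "poly_map (id :: complex ^ 'n \<Rightarrow> _)"
  by (simp add: poly_map_def poly_fun.coord)

lemma poly_map_compose: "poly_map F \<Longrightarrow> poly_map G \<Longrightarrow> poly_map (F \<circ> G)"
  unfolding poly_map_def using poly_fun_compose[of "\<lambda>v. F v $ _" G] by (auto simp: o_def)

lemma poly_map_rational: "poly_map F \<Longrightarrow> rational_map F"
  unfolding poly_map_def rational_map_iff by (simp add: rat_fun_poly)

lemma poly_map_nonzero:
  fixes F :: "complex ^ 'm \<Rightarrow> complex ^ 'n"
  assumes "poly_map F" "F v0 \<noteq> 0"
  shows "generically (\<lambda>v. F v \<noteq> 0)"
proof -
  obtain i where "F v0 $ i \<noteq> 0" using assms(2) by (auto simp: vec_eq_iff)
  then show ?thesis using assms(1) unfolding poly_map_def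
    by (intro genericallyI[of "\<lambda>v. F v $ i" v0]) auto
qed

lemma hom_tuple_poly_map: "hom_tuple w F \<Longrightarrow> poly_map F"
  by (simp add: hom_tuple_def poly_map_def)

lemma hom_tuple_nonzero: "hom_tuple w F \<Longrightarrow> generically (\<lambda>v. F v \<noteq> 0)"
  using poly_map_nonzero[OF hom_tuple_poly_map] by (auto simp: hom_tuple_def)

lemma hom_tuple_wrel:
  assumes "hom_tuple w F" "(u, v) \<in> wrel w" "F u \<noteq> 0"
  shows "(F u, F v) \<in> wrel w"
proof -
  obtain c where "c \<noteq> 0" "v = wscale w c u" using assms(2) by (auto simp: wrel_def)
  moreover obtain d where "\<And>c v. F (wscale w c v) = wscale w (c ^ d) (F v)"
    using assms(1) by (auto simp: hom_tuple_def)
  ultimately show ?thesis using assms(3) by (simp add: wrel_wscale)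
qed

lemma hom_tuple_id: "hom_tuple w (id :: complex ^ 'n \<Rightarrow> complex ^ 'n)"
proof -
  have "\<exists>v :: complex ^ 'n. v \<noteq> 0" by (intro exI[of _ 1]) (simp add: vec_eq_iff)
  then show ?thesis
    by (auto simp: hom_tuple_def intro: poly_fun.coord exI[of _ 1])
qed

text \<open>Degrees multiply. Dominance of \<open>G\<close> prevents its image from lying in the
  common zero set of the entries of \<open>F\<close>.\<close>

lemma hom_tuple_compose:
  assumes F: "hom_tuple w F" and G: "hom_tuple w G" "dominant G"
  shows "hom_tuple w (F \<circ> G)"
proof -
  obtain d e where "\<And>c v. F (wscale w c v) = wscale w (c ^ d) (F v)"
    "\<And>c v. G (wscale w c v) = wscale w (c ^ e) (G v)"
    using F G(1) unfolding hom_tuple_def by blast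
  then have "(F \<circ> G) (wscale w c v) = wscale w (c ^ (e * d)) ((F \<circ> G) v)" for c v
    by (simp add: power_mult)
  moreover have "\<exists>v. (F \<circ> G) v \<noteq> 0"
    using generically_ex[OF dominantD[OF G(2) hom_tuple_nonzero[OF F]]] by simp
  moreover have "poly_map (F \<circ> G)"
    using F G(1) by (intro poly_map_compose hom_tuple_poly_map)
  ultimately show ?thesis unfolding hom_tuple_def poly_map_def by blast
qed

lemma proj_eqD: "(F, G) \<in> proj_eq w \<Longrightarrow> hom_tuple w F \<and> hom_tuple w G \<and> generically (\<lambda>v. (F v, G v) \<in> wrel w)"
  by (simp add: proj_eq_def)

lemma proj_eq_refl: "hom_tuple w F \<Longrightarrow> (F, F) \<in> proj_eq w"
  by (auto simp: proj_eq_def intro: wrel_refl generically_mono[OF hom_tuple_nonzero])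

lemma roots_of_unity_isolated:
  assumes "m > 0"
  shows "\<exists>\<delta>>0. \<forall>c::complex. c ^ m = 1 \<longrightarrow> norm (c - 1) < \<delta> \<longrightarrow> c = 1"
proof -
  have "finite {c::complex. c ^ m = 1}" using finite_roots_unity[of m] assms by simp
  then obtain \<delta> where "\<delta> > 0" "\<forall>c\<in>{c. c ^ m = 1}. c \<noteq> (1::complex) \<longrightarrow> \<delta> \<le> dist 1 c"
    using finite_set_avoid by blast
  then show ?thesis by (intro exI[of _ \<delta>]) (auto simp: dist_norm norm_minus_commute)
qed

text \<open>The weights for which the rational maps \<open>hom_tuple\<close> compose well: they are positive and
  the weight 1 occurs. The second index excludes the projective space consisting of one point.\<close>

locale weights =
  fixes w :: "nat ^ 'n" and j j' :: 'n
  assumes pos: "\<And>i. w $ i > 0" and one: "w $ j = 1" and two: "j' \<noteq> j"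
begin

lemma proj_eq_imp_wrel:
  assumes "(F, G) \<in> proj_eq w" "F v \<noteq> 0" "G v \<noteq> 0"
  shows "(F v, G v) \<in> wrel w"
  using assms by (intro wrel_generically_imp pos poly_map_continuous)
    (auto dest!: proj_eqD hom_tuple_poly_map)

text \<open>A coordinate of weight 1 determines the scalar, not merely a power of it.\<close>

lemma same_coordinate_imp_eq:
  assumes "(u, v) \<in> wrel w" "u $ j = v $ j" "u $ j \<noteq> 0"
  shows "u = v"
proof -
  obtain c where c: "v = wscale w c u" using assms(1) by (auto simp: wrel_def)
  then have "v $ j = c * u $ j" using one by (simp add: wscale_def)
  with assms have "c = 1" by simp
  with c show ?thesis by (simp add: wscale_1)
qed

text \<open>If \<open>K \<circ> F\<close> is the identity of the projective space, then two points with the same image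
  under \<open>F\<close> differ by a scalar, which is a root of unity of bounded order. Hence \<open>F\<close> is locally
  injective on \<open>complex ^ 'n\<close>.\<close>

lemma hom_tuple_dominant:
  assumes F: "hom_tuple w F" and KF: "generically (\<lambda>v. (K (F v), v) \<in> wrel w)"
  shows "dominant F"
proof (rule dominantI, rule poly_map_rational[OF hom_tuple_poly_map[OF F]], rule notI)
  fix h :: "complex ^ 'n \<Rightarrow> complex" assume h: "poly_fun h" "\<exists>v. h v \<noteq> 0" "generically (\<lambda>v. h (F v) = 0)"
  have "poly_map F" using F by (rule hom_tuple_poly_map)
  obtain i v1 where iv: "F v1 $ i \<noteq> 0"
    using generically_ex[OF hom_tuple_nonzero[OF F]] by (auto simp: vec_eq_iff)
  have i: "generically (\<lambda>v. F v $ i \<noteq> 0)"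
    by (rule genericallyI[of "\<lambda>v. F v $ i" v1]) (use iv \<open>poly_map F\<close> in \<open>auto simp: poly_map_def\<close>)
  have "(1::complex ^ 'n) $ j \<noteq> 0" by simp
  then have gj: "generically (\<lambda>v::complex^'n. v $ j \<noteq> 0)"
    by (intro genericallyI[of "\<lambda>v. v $ j" 1] poly_fun.coord)
  have "generically (\<lambda>v. (((K (F v), v) \<in> wrel w \<and> h (F v) = 0) \<and> F v $ i \<noteq> 0) \<and> v $ j \<noteq> 0)"
    by (intro generically_conj KF h(3) i gj)
  then obtain g where g: "poly_fun g" "\<exists>v. g v \<noteq> 0" and g': "\<And>v. g v \<noteq> 0 \<Longrightarrow>
      (K (F v), v) \<in> wrel w \<and> h (F v) = 0 \<and> F v $ i \<noteq> 0 \<and> v $ j \<noteq> 0"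
    unfolding generically_def by blast
  define U where "U = {v. g v \<noteq> 0}"
  have U: "open U" using open_nonzero_poly_fun[OF g(1)] by (simp add: U_def)
  obtain u where u: "u \<in> U" using g(2) by (auto simp: U_def)
  have fib: "(v, v') \<in> wrel w" if "v \<in> U" "v' \<in> U" "F v = F v'" for v v'
    using that g'[of v] g'[of v'] by (auto simp: U_def intro: wrel_trans wrel_sym)
  obtain d where d: "\<And>c v. F (wscale w c v) = wscale w (c ^ d) (F v)"
    using F by (auto simp: hom_tuple_def)
  \<comment> \<open>Positivity makes \<open>d * w $ i\<close> a genuine root-of-unity order below.
    In degree 0, scaling by 0 and \<open>0 ^ 0 = 1\<close> give \<open>F v = F 0\<close>, so
    \<open>F\<close> would be constant and points of \<open>U\<close> would all lie in one orbit. A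
    line in direction \<open>j'\<close> refutes this: coordinate \<open>j\<close>, of weight 1, is
    fixed along it, so distinct points of the line are not equivalent.\<close>
  have "d > 0"
  proof (rule ccontr)
    assume "\<not> d > 0"
    moreover have "wscale w 0 v = 0" for v using pos by (simp add: wscale_def vec_eq_iff)
    ultimately have const: "F v = F 0" for v using d[of 0 v] by (simp add: wscale_1)
    define \<gamma> where "\<gamma> = (\<lambda>t::complex. u + t *s axis j' 1)"
    have "continuous_on UNIV \<gamma>"
      unfolding \<gamma>_def by (intro continuous_on_vec_lambda continuous_intros
          | simp add: vector_scalar_mult_def)+
    then have "open (\<gamma> -` U)" using U(1) by (simp add: open_vimage)
    moreover have "0 \<in> \<gamma> -` U" using u by (simp add: \<gamma>_def)
    ultimately obtain t where t: "t \<in> \<gamma> -` U" "t \<noteq> 0"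
      by (metis (full_types) all_not_in_conv not_open_singleton singletonI subsetI subset_singletonD)
    have "(u, \<gamma> t) \<in> wrel w" using t(1) u const fib by (metis vimage_eq)
    then have "u = \<gamma> t"
      by (rule same_coordinate_imp_eq) (use g'[of u] u two in \<open>auto simp: U_def \<gamma>_def axis_def\<close>)
    then have "(t *s axis j' 1) $ j' = 0" by (simp add: \<gamma>_def)
    with t(2) show False by (simp add: axis_def)
  qed
  then obtain \<delta> where \<delta>: "\<delta> > 0" "\<And>c::complex. c ^ (d * w $ i) = 1 \<Longrightarrow> norm (c - 1) < \<delta> \<Longrightarrow> c = 1"
    using roots_of_unity_isolated[of "d * w $ i"] pos[of i] by auto
  have uj: "u $ j \<noteq> 0" using g'[of u] u by (simp add: U_def)
  \<comment> \<open>The first bound gives |v_j| > |u_j|/2 near \<open>u\<close>. The second gives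
    |v'_j - v_j| < \<delta> |u_j|/2, so that |c - 1| |v_j| < \<delta> |v_j| and the root of unity
    \<open>c\<close> must be 1.\<close>
  define \<epsilon> where "\<epsilon> = min (norm (u $ j) / 2) (\<delta> * norm (u $ j) / 4)"
  have "\<epsilon> > 0" using uj \<delta>(1) by (simp add: \<epsilon>_def)
  define U' where "U' = U \<inter> {v. norm (v $ j - u $ j) < \<epsilon>}"
  have "open {v::complex^'n. norm (v $ j - u $ j) < \<epsilon>}"
    by (intro open_Collect_less continuous_intros)
  then have U': "open U'" "u \<in> U'" using U u \<open>\<epsilon> > 0\<close> by (auto simp: U'_def)
  have inj: "inj_on F U'"
  proof (rule inj_onI)
    fix v v' assume v: "v \<in> U'" "v' \<in> U'" "F v = F v'"
    have "(v, v') \<in> wrel w" using v by (intro fib) (auto simp: U'_def)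
    then obtain c where c: "v' = wscale w c v" "c \<noteq> 0" by (auto simp: wrel_def)
    have "F v $ i = c ^ (d * w $ i) * F v $ i"
      using v(3) unfolding c d by (metis wscale_def power_mult vec_lambda_beta)
    moreover have "F v $ i \<noteq> 0" using g'[of v] v(1) by (simp add: U'_def U_def)
    ultimately have c1: "c ^ (d * w $ i) = 1" by simp
    have cj: "v' $ j = c * v $ j" using c one by (simp add: wscale_def)
    have n1: "norm (v $ j - u $ j) < \<epsilon>" "norm (v' $ j - u $ j) < \<epsilon>" using v by (auto simp: U'_def)
    have "norm (u $ j) \<le> norm (v $ j) + norm (v $ j - u $ j)"
      by (metis norm_triangle_sub norm_minus_commute)
    then have vj: "norm (u $ j) / 2 < norm (v $ j)" using n1 by (simp add: \<epsilon>_def)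
    have "norm (c - 1) * norm (v $ j) = norm (v' $ j - v $ j)"
      by (simp add: cj norm_mult[symmetric] algebra_simps)
    also have "\<dots> \<le> norm (v' $ j - u $ j) + norm (v $ j - u $ j)"
      by (metis dist_norm dist_triangle2)
    also have "\<dots> < \<delta> * (norm (u $ j) / 2)" using n1 by (simp add: \<epsilon>_def)
    also have "\<dots> < \<delta> * norm (v $ j)" using vj \<delta>(1) by (rule mult_strict_left_mono)
    finally have "norm (c - 1) < \<delta>" by (simp add: mult_less_cancel_right_disj)
    then have "c = 1" using \<delta>(2) c1 by blast
    then show "v = v'" using c by (simp add: wscale_1)
  qed
  have "\<exists>v\<in>U'. h (F v) \<noteq> 0"
    by (rule inj_not_in_hypersurface[OF U'(1) _ _ inj h(1,2)])
       (use U' poly_map_continuous[OF \<open>poly_map F\<close>] continuous_on_subset in auto)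
  then show False using g' by (auto simp: U'_def U_def)
qed

end

section \<open>Groups of birational maps\<close>

definition mod_inverse :: "(('a \<Rightarrow> 'a) \<times> ('a \<Rightarrow> 'a)) set \<Rightarrow> ('a \<Rightarrow> 'a) \<Rightarrow> ('a \<Rightarrow> 'a) \<Rightarrow> bool" where
  "mod_inverse E f g \<longleftrightarrow> (f, f) \<in> E \<and> (g, g) \<in> E \<and> (f \<circ> g, id) \<in> E \<and> (g \<circ> f, id) \<in> E"

locale bir_per =
  fixes E :: "(('a \<Rightarrow> 'a) \<times> ('a \<Rightarrow> 'a)) set"
  assumes E_sym: "(f, g) \<in> E \<Longrightarrow> (g, f) \<in> E"
    and E_trans: "(f, g) \<in> E \<Longrightarrow> (g, h) \<in> E \<Longrightarrow> (f, h) \<in> E"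
    and E_id: "(id, id) \<in> E"
    and E_comp: "(f, f') \<in> E \<Longrightarrow> (g, g') \<in> E \<Longrightarrow> mod_inverse E g k \<Longrightarrow> (f \<circ> g, f' \<circ> g') \<in> E"
begin

abbreviation Inv :: "('a \<Rightarrow> 'a) \<Rightarrow> ('a \<Rightarrow> 'a) \<Rightarrow> bool" where "Inv \<equiv> mod_inverse E"

lemma Inv_sym: "Inv f g \<Longrightarrow> Inv g f"
  by (auto simp: mod_inverse_def)

lemma Inv_id: "Inv id id"
  by (simp add: mod_inverse_def E_id)

lemma Inv_cong: assumes "Inv f k" "(f, f') \<in> E" shows "Inv f' k"
proof -
  have "(f \<circ> k, f' \<circ> k) \<in> E"
    using assms by (intro E_comp[OF _ _ Inv_sym[OF assms(1)]]) (auto simp: mod_inverse_def)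
  moreover have "(k \<circ> f, k \<circ> f') \<in> E"
    using assms by (intro E_comp[OF _ _ assms(1)]) (auto simp: mod_inverse_def)
  ultimately show ?thesis using assms unfolding mod_inverse_def by (metis E_sym E_trans)
qed

lemma Inv_comp:
  assumes "Inv f k" "Inv g l"
  shows "Inv (f \<circ> g) (l \<circ> k)"
proof -
  have *: "(f \<circ> g \<circ> (l \<circ> k), id) \<in> E" if "Inv f k" "Inv g l" for f g k l
  proof -
    have "((g \<circ> l) \<circ> k, id \<circ> k) \<in> E"
      using that by (intro E_comp[OF _ _ Inv_sym[OF that(1)]]) (auto simp: mod_inverse_def)
    then have "(k, (g \<circ> l) \<circ> k) \<in> E" by (simp add: E_sym)
    then have "(f \<circ> k, f \<circ> ((g \<circ> l) \<circ> k)) \<in> E"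
      using that by (intro E_comp[OF _ _ Inv_sym[OF that(1)]]) (auto simp: mod_inverse_def)
    then show ?thesis using that unfolding mod_inverse_def by (metis E_sym E_trans comp_assoc)
  qed
  moreover have "(f \<circ> g, f \<circ> g) \<in> E" "(l \<circ> k, l \<circ> k) \<in> E"
    using assms E_comp[OF _ _ assms(2), of f f] E_comp[OF _ _ Inv_sym[OF assms(1)], of l l]
    by (auto simp: mod_inverse_def)
  ultimately show ?thesis
    using *[OF assms] *[OF Inv_sym[OF assms(2)] Inv_sym[OF assms(1)]]
    unfolding mod_inverse_def by blast
qed

abbreviation cls :: "('a \<Rightarrow> 'a) \<Rightarrow> ('a \<Rightarrow> 'a) set" where "cls f \<equiv> E `` {f}"

lemma cls_eq_iff: "(f, f) \<in> E \<Longrightarrow> cls f = cls g \<longleftrightarrow> (f, g) \<in> E"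
  by (blast intro: E_sym E_trans)

lemma cls_self: "Inv f k \<Longrightarrow> f \<in> cls f"
  by (simp add: mod_inverse_def)

lemma carrier_iff: "A \<in> carrier (bir_group E) \<longleftrightarrow> (\<exists>f k. A = cls f \<and> Inv f k)"
  by (simp add: bir_group_def mod_inverse_def)

lemma cls_in_carrier: "Inv f k \<Longrightarrow> cls f \<in> carrier (bir_group E)"
  using carrier_iff by blast

lemma in_carrierD:
  assumes "A \<in> carrier (bir_group E)" "f \<in> A"
  shows "A = cls f \<and> (\<exists>k. Inv f k)"
proof -
  obtain g k where g: "A = cls g" "Inv g k" using assms(1) carrier_iff by blast
  then have "(g, f) \<in> E" using assms(2) by blast
  moreover have "(g, g) \<in> E" using g(2) by (simp add: mod_inverse_def)
  ultimately show ?thesis using g Inv_cong cls_eq_iff by blast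
qed

lemma mult_cls:
  assumes f: "(f, f) \<in> E" and g: "Inv g k"
  shows "cls f \<otimes>\<^bsub>bir_group E\<^esub> cls g = cls (f \<circ> g)"
proof -
  have ff: "(f \<circ> g, f \<circ> g) \<in> E" using f g by (intro E_comp[OF _ _ g]) (auto simp: mod_inverse_def)
  have eq: "cls (f' \<circ> g') = cls (f \<circ> g)" if "f' \<in> cls f" "g' \<in> cls g" for f' g'
    using that E_comp[OF _ _ g, of f f' g'] cls_eq_iff[OF ff] by auto
  have "cls f \<otimes>\<^bsub>bir_group E\<^esub> cls g = (\<Union>f'\<in>cls f. \<Union>g'\<in>cls g. cls (f' \<circ> g'))"
    by (simp only: bir_group_def monoid.select_convs)
  also have "\<dots> = (\<Union>f'\<in>cls f. \<Union>g'\<in>cls g. cls (f \<circ> g))"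
    by (intro SUP_cong refl eq)
  also have "\<dots> = cls (f \<circ> g)"
    using f cls_self[OF g] by (metis SUP_const empty_iff Image_singleton_iff)
  finally show ?thesis .
qed

lemma one_cls: "\<one>\<^bsub>bir_group E\<^esub> = cls id"
  by (simp add: bir_group_def)

lemma comp_in_mult:
  assumes "A \<in> carrier (bir_group E)" "B \<in> carrier (bir_group E)" "f \<in> A" "g \<in> B"
  shows "f \<circ> g \<in> A \<otimes>\<^bsub>bir_group E\<^esub> B"
proof -
  obtain k l where *: "A = cls f" "Inv f k" "B = cls g" "Inv g l"
    using in_carrierD assms by meson
  then have "A \<otimes>\<^bsub>bir_group E\<^esub> B = cls (f \<circ> g)" using mult_cls[of f g l] by (simp add: mod_inverse_def)
  then show ?thesis using cls_self[OF Inv_comp[OF *(2,4)]] by simp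
qed

lemma mult_cls_inverse:
  assumes "Inv f k"
  shows "cls k \<otimes>\<^bsub>bir_group E\<^esub> cls f = \<one>\<^bsub>bir_group E\<^esub>"
proof -
  have r: "(k, k) \<in> E" "(k \<circ> f, k \<circ> f) \<in> E"
    using assms Inv_comp[OF Inv_sym[OF assms] assms] by (simp_all add: mod_inverse_def)
  show ?thesis
    unfolding one_cls mult_cls[OF r(1) assms] cls_eq_iff[OF r(2)]
    using assms by (simp add: mod_inverse_def)
qed

lemma group_bir_group: "group (bir_group E)"
proof (rule groupI)
  fix A B assume "A \<in> carrier (bir_group E)" "B \<in> carrier (bir_group E)"
  then obtain f k g l where "A = cls f" "Inv f k" "B = cls g" "Inv g l" using carrier_iff by metis
  then show "A \<otimes>\<^bsub>bir_group E\<^esub> B \<in> carrier (bir_group E)"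
    using mult_cls[of f g l] Inv_comp[of f k g l] cls_in_carrier by (simp add: mod_inverse_def)
next
  show "\<one>\<^bsub>bir_group E\<^esub> \<in> carrier (bir_group E)" using cls_in_carrier[OF Inv_id] one_cls by simp
next
  fix A B C
  assume "A \<in> carrier (bir_group E)" "B \<in> carrier (bir_group E)" "C \<in> carrier (bir_group E)"
  then obtain f k g l h m where *: "A = cls f" "Inv f k" "B = cls g" "Inv g l" "C = cls h" "Inv h m"
    using carrier_iff by metis
  have r: "(f, f) \<in> E" "(g, g) \<in> E" "(f \<circ> g, f \<circ> g) \<in> E"
    using * Inv_comp[OF *(2,4)] by (simp_all add: mod_inverse_def)
  show "A \<otimes>\<^bsub>bir_group E\<^esub> B \<otimes>\<^bsub>bir_group E\<^esub> C = A \<otimes>\<^bsub>bir_group E\<^esub> (B \<otimes>\<^bsub>bir_group E\<^esub> C)"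
    unfolding *(1,3,5) mult_cls[OF r(1) *(4)] mult_cls[OF r(3) *(6)] mult_cls[OF r(2) *(6)]
      mult_cls[OF r(1) Inv_comp[OF *(4,6)]] by (simp only: comp_assoc)
next
  fix A assume "A \<in> carrier (bir_group E)"
  then obtain f k where *: "A = cls f" "Inv f k" using carrier_iff by metis
  show "\<one>\<^bsub>bir_group E\<^esub> \<otimes>\<^bsub>bir_group E\<^esub> A = A"
    unfolding one_cls * mult_cls[OF E_id *(2)] by simp
  have "cls k \<otimes>\<^bsub>bir_group E\<^esub> A = \<one>\<^bsub>bir_group E\<^esub>"
    unfolding * by (rule mult_cls_inverse[OF *(2)])
  then show "\<exists>B\<in>carrier (bir_group E). B \<otimes>\<^bsub>bir_group E\<^esub> A = \<one>\<^bsub>bir_group E\<^esub>"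
    using cls_in_carrier[OF Inv_sym[OF *(2)]] by blast
qed

end

interpretation aff: bir_per "aff_eq :: ((complex ^ 'n \<Rightarrow> complex ^ 'n) \<times> _) set"
proof (unfold_locales, goal_cases)
  case (1 f g)
  then show ?case by (auto simp: aff_eq_def elim: generically_mono)
next
  case (2 f g h)
  then show ?case by (auto simp: aff_eq_def elim: generically_mp2)
next
  case 3
  show ?case by (auto simp: aff_eq_def rational_map_iff intro: rat_fun_intros generically_True)
next
  case (4 f f' g g' k)
  have rat: "rational_map f" "rational_map f'" "rational_map g" "rational_map g'"
    and ff': "generically (\<lambda>v. f v = f' v)" and gg': "generically (\<lambda>v. g v = g' v)"
    and kg: "generically (\<lambda>v. k (g v) = v)"
    using 4 by (auto simp: aff_eq_def mod_inverse_def)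
  have dom: "dominant g" by (rule dominant_if_left_inverse[OF rat(3) kg])
  have dom': "dominant g'"
    by (rule dominant_if_left_inverse[OF rat(4), of k]) (rule generically_mp2[OF kg gg'], auto)
  have "generically (\<lambda>v. f (g v) = f' (g' v))"
    by (rule generically_mp2[OF dominantD[OF dom ff'] gg']) auto
  then show ?case using rational_map_compose[OF rat(1,3) dom] rational_map_compose[OF rat(2,4) dom']
    by (simp add: aff_eq_def)
qed

context weights
begin

sublocale proj: bir_per "proj_eq w"
proof (unfold_locales, goal_cases)
  case (1 f g)
  then show ?case by (auto simp: proj_eq_def elim: generically_mono intro: wrel_sym)
next
  case (2 f g h)
  then show ?case by (auto simp: proj_eq_def elim: generically_mp2 intro: wrel_trans)
next
  case 3
  show ?case by (rule proj_eq_refl[OF hom_tuple_id])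
next
  case (4 f f' g g' k)
  have hom: "hom_tuple w f" "hom_tuple w f'" "hom_tuple w g" "hom_tuple w g'" "hom_tuple w k"
    and ff': "generically (\<lambda>v. (f v, f' v) \<in> wrel w)" and gg': "generically (\<lambda>v. (g v, g' v) \<in> wrel w)"
    and kg: "generically (\<lambda>v. (k (g v), v) \<in> wrel w)"
    using 4 by (auto simp: proj_eq_def mod_inverse_def)
  have dom: "dominant g" by (rule hom_tuple_dominant[OF hom(3) kg])
  \<comment> \<open>The tuple \<open>k\<close> respects \<open>wrel\<close>, so a left inverse of
    \<open>g\<close> is also one of the equivalent tuple \<open>g'\<close>, which is therefore
    dominant too.\<close>
  have "generically (\<lambda>v. (k (g' v), v) \<in> wrel w)"
    by (rule generically_mp2[OF kg gg'])
      (metis hom_tuple_wrel[OF hom(5)] wrel_nonzero wrel_sym wrel_trans)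
  then have dom': "dominant g'" by (rule hom_tuple_dominant[OF hom(4)])
  have "generically (\<lambda>v. (f (g v), f' (g' v)) \<in> wrel w)"
    by (rule generically_mp2[OF dominantD[OF dom ff'] gg'])
      (metis hom_tuple_wrel[OF hom(2)] wrel_nonzero wrel_trans)
  then show ?case using hom_tuple_compose[OF hom(1,3) dom] hom_tuple_compose[OF hom(2,4) dom']
    by (simp add: proj_eq_def)
qed

lemma group_Bir_wproj: "group (Bir_wproj w)"
  unfolding Bir_wproj_def by (rule proj.group_bir_group)

end

lemma dominant_if_in_bir_aff:
  assumes "A \<in> carrier (bir_group aff_eq)" "f \<in> A"
  shows "dominant f"
  using aff.in_carrierD[OF assms]
  by (auto simp: aff_eq_def mod_inverse_def intro: dominant_if_left_inverse)

lemma (in weights) dominant_if_in_Bir_wproj: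
  assumes "B \<in> carrier (Bir_wproj w)" "F \<in> B"
  shows "hom_tuple w F" "dominant F"
  using proj.in_carrierD[of B F] assms hom_tuple_dominant unfolding Bir_wproj_def
  by (fastforce simp: proj_eq_def mod_inverse_def)+

section \<open>Transformations acting on parameters\<close>

lemma param_group_simps:
  "x \<in> carrier (param_group G) \<longleftrightarrow> bij (fst x) \<and> (\<forall>a. snd x a \<in> carrier G)"
  "x \<otimes>\<^bsub>param_group G\<^esub> y = (fst x \<circ> fst y, \<lambda>a. snd x (fst y a) \<otimes>\<^bsub>G\<^esub> snd y a)"
  "\<one>\<^bsub>param_group G\<^esub> = (id, \<lambda>_. \<one>\<^bsub>G\<^esub>)"
  by (cases x) (auto simp: param_group_def split: prod.splits)

lemma group_param_group:
  assumes "group G"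
  shows "group (param_group G)"
proof -
  interpret group G by fact
  show ?thesis
  proof (rule groupI)
    fix x y :: "('b \<Rightarrow> 'b) \<times> ('b \<Rightarrow> 'a)"
    assume "x \<in> carrier (param_group G)" "y \<in> carrier (param_group G)"
    then show "x \<otimes>\<^bsub>param_group G\<^esub> y \<in> carrier (param_group G)"
      by (auto simp: param_group_simps intro: bij_comp)
  next
    show "\<one>\<^bsub>param_group G\<^esub> \<in> carrier (param_group G)"
      by (simp add: param_group_simps)
  next
    fix x y z :: "('b \<Rightarrow> 'b) \<times> ('b \<Rightarrow> 'a)"
    assume "x \<in> carrier (param_group G)" "y \<in> carrier (param_group G)" "z \<in> carrier (param_group G)"
    then show "x \<otimes>\<^bsub>param_group G\<^esub> y \<otimes>\<^bsub>param_group G\<^esub> z = x \<otimes>\<^bsub>param_group G\<^esub> (y \<otimes>\<^bsub>param_group G\<^esub> z)"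
      by (auto simp: param_group_simps m_assoc)
  next
    fix x :: "('b \<Rightarrow> 'b) \<times> ('b \<Rightarrow> 'a)" assume x: "x \<in> carrier (param_group G)"
    then show "\<one>\<^bsub>param_group G\<^esub> \<otimes>\<^bsub>param_group G\<^esub> x = x"
      by (auto simp: param_group_simps prod_eq_iff)
    \<comment> \<open>The inverse map over the value \<open>a\<close> undoes the map that starts
      over the preimage of \<open>a\<close>.\<close>
    define y where "y = (the_inv (fst x), \<lambda>a. inv\<^bsub>G\<^esub> (snd x (the_inv (fst x) a)))"
    have "bij (fst x)" using x by (simp add: param_group_simps)
    then have "the_inv (fst x) \<circ> fst x = id"
      by (auto simp: fun_eq_iff the_inv_f_f bij_is_inj)
    then have "y \<otimes>\<^bsub>param_group G\<^esub> x = \<one>\<^bsub>param_group G\<^esub>"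
      using x by (auto simp: param_group_simps y_def fun_eq_iff)
    moreover have "y \<in> carrier (param_group G)"
      using x bij_betw_the_inv_into[of "fst x" UNIV UNIV] by (auto simp: param_group_simps y_def)
    ultimately show "\<exists>y\<in>carrier (param_group G). y \<otimes>\<^bsub>param_group G\<^esub> x = \<one>\<^bsub>param_group G\<^esub>" by blast
  qed
qed

lemma group_Bir_aff: "group (Bir_aff :: ('p, 3) param_maps monoid)"
  unfolding Bir_aff_def by (rule group_param_group[OF aff.group_bir_group])

lemma (in weights) group_Bir_param_wproj: "group (Bir_param_wproj w :: ('p, 'n) param_maps monoid)"
  unfolding Bir_param_wproj_def by (rule group_param_group[OF group_Bir_wproj])

section \<open>Homomorphisms on generated subgroups\<close>

text \<open>A multiplicative, single-valued relation that is defined on the generators and their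
  inverses contains the graph of a homomorphism on the generated subgroup. Uniqueness of the partner
  replaces the verification of the relations among the generators.\<close>

lemma hom_from_relation:
  assumes "group G" "group H" and K: "K \<subseteq> carrier G"
    and gen: "\<And>k. k \<in> K \<Longrightarrow> \<exists>t\<in>carrier H. R k t" "\<And>k. k \<in> K \<Longrightarrow> \<exists>t\<in>carrier H. R (inv\<^bsub>G\<^esub> k) t"
    and one: "R \<one>\<^bsub>G\<^esub> \<one>\<^bsub>H\<^esub>"
    and mult: "\<And>x y s t. \<lbrakk>x \<in> carrier G; y \<in> carrier G; s \<in> carrier H; t \<in> carrier H; R x s; R y t\<rbrakk>
      \<Longrightarrow> R (x \<otimes>\<^bsub>G\<^esub> y) (s \<otimes>\<^bsub>H\<^esub> t)"
    and uniq: "\<And>x s t. \<lbrakk>x \<in> carrier G; s \<in> carrier H; t \<in> carrier H; R x s; R x t\<rbrakk> \<Longrightarrow> s = t"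
  shows "\<exists>h. group_hom (G\<lparr>carrier := generate G K\<rparr>) H h \<and> (\<forall>x\<in>generate G K. R x (h x))"
proof -
  interpret G: group G by fact
  interpret H: group H by fact
  have ex: "\<exists>t\<in>carrier H. R x t" if "x \<in> generate G K" for x
    using that
  proof induction
    case (eng x y)
    then show ?case using mult[of x y] G.generate_in_carrier[OF K] H.m_closed by blast
  qed (use gen one in auto)
  define h where "h = (\<lambda>x. SOME t. t \<in> carrier H \<and> R x t)"
  have h: "h x \<in> carrier H" "R x (h x)" if "x \<in> generate G K" for x
    using someI_ex[of "\<lambda>t. t \<in> carrier H \<and> R x t"] ex[OF that] by (auto simp: h_def)
  have "h (x \<otimes>\<^bsub>G\<^esub> y) = h x \<otimes>\<^bsub>H\<^esub> h y" if "x \<in> generate G K" "y \<in> generate G K" for x y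
    using that h generate.eng[OF that] G.generate_in_carrier[OF K]
    by (intro uniq[of "x \<otimes>\<^bsub>G\<^esub> y"] mult) auto
  then have "h \<in> hom (G\<lparr>carrier := generate G K\<rparr>) H" by (simp add: hom_def h(1))
  moreover have "group (G\<lparr>carrier := generate G K\<rparr>)"
    by (rule G.subgroup_imp_group[OF G.generate_is_subgroup[OF K]])
  ultimately have "group_hom (G\<lparr>carrier := generate G K\<rparr>) H h"
    by (simp add: group_hom_def group_hom_axioms_def assms(2))
  then show ?thesis using h(2) by blast
qed

section \<open>Extension to the weighted projective space and restriction to infinity\<close>

lemma poly_map_app4: "poly_map (\<lambda>u. app4 u c)"
  by (auto simp: poly_map_def forall_4 coord_defs intro: poly_fun_intros)

lemma poly_map_app4_compose: "poly_map F \<Longrightarrow> poly_map (\<lambda>u. F (app4 u c))"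
  using poly_map_compose[OF _ poly_map_app4] by (simp add: o_def)

locale weighted_pair = w4: weights "wt4 p q r s" i i' + w3: weights "wt3 p q r" j j'
  for p q r s :: nat and i i' :: 4 and j j' :: 3
begin

abbreviation (input) "w4 \<equiv> wt4 p q r s"
abbreviation (input) "w3 \<equiv> wt3 p q r"

lemma s_pos: "s > 0"
  using w4.pos[of 4] by (simp add: coord_defs)

section \<open>Multiplicativity and uniqueness of the extension\<close>

lemma extends_one: "extends w4 \<one>\<^bsub>Bir_wproj w4\<^esub> \<one>\<^bsub>bir_group aff_eq\<^esub>"
proof -
  have "generically (\<lambda>v. (id (app4 v 1), app4 (id v) 1) \<in> wrel w4)"
    by (rule generically_True) (simp add: wrel_refl app4_eq_0_iff)
  moreover have "id \<in> \<one>\<^bsub>Bir_wproj w4\<^esub>" "id \<in> \<one>\<^bsub>bir_group aff_eq\<^esub>"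
    unfolding Bir_wproj_def by (simp_all add: w4.proj.one_cls w4.proj.E_id aff.one_cls aff.E_id)
  ultimately show ?thesis unfolding extends_def by blast
qed

text \<open>Since \<open>f'\<close> is dominant, the relation between \<open>F\<close> and
  \<open>f\<close> holds generically at \<open>f' v\<close>. Since \<open>F\<close> respects
  \<open>wrel\<close>, it may be applied to the relation between \<open>F'\<close> and
  \<open>f'\<close>.\<close>

lemma extends_mult:
  assumes B: "B \<in> carrier (Bir_wproj w4)" "B' \<in> carrier (Bir_wproj w4)"
    and A: "A \<in> carrier (bir_group aff_eq)" "A' \<in> carrier (bir_group aff_eq)"
    and ext: "extends w4 B A" "extends w4 B' A'"
  shows "extends w4 (B \<otimes>\<^bsub>Bir_wproj w4\<^esub> B') (A \<otimes>\<^bsub>bir_group aff_eq\<^esub> A')"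
proof -
  obtain F f F' f' where m: "F \<in> B" "f \<in> A" "F' \<in> B'" "f' \<in> A'"
    and Ff: "generically (\<lambda>v. (F (app4 v 1), app4 (f v) 1) \<in> wrel w4)"
    and Ff': "generically (\<lambda>v. (F' (app4 v 1), app4 (f' v) 1) \<in> wrel w4)"
    using ext unfolding extends_def by blast
  have hom: "hom_tuple w4 F" using w4.dominant_if_in_Bir_wproj[OF B(1) m(1)] by simp
  have "generically (\<lambda>v. (F (F' (app4 v 1)), app4 (f (f' v)) 1) \<in> wrel w4)"
    by (rule generically_mp2[OF Ff' dominantD[OF dominant_if_in_bir_aff[OF A(2) m(4)] Ff]])
      (metis hom_tuple_wrel[OF hom] wrel_nonzero wrel_sym wrel_trans)
  moreover have "F \<circ> F' \<in> B \<otimes>\<^bsub>Bir_wproj w4\<^esub> B'"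
    using w4.proj.comp_in_mult B m unfolding Bir_wproj_def by blast
  moreover have "f \<circ> f' \<in> A \<otimes>\<^bsub>bir_group aff_eq\<^esub> A'" using aff.comp_in_mult A m by blast
  ultimately show ?thesis unfolding extends_def
    by (intro bexI[of _ "F \<circ> F'"] bexI[of _ "f \<circ> f'"]) simp_all
qed

lemma affine_representative:
  assumes "v $ 4 \<noteq> 0"
  obtains c u where "c \<noteq> 0" "v = wscale w4 c (app4 u 1)"
proof -
  obtain c where c: "c \<noteq> 0" "v $ 4 = c ^ s"
    using exists_complex_root_nonzero[of "v $ 4" s] assms s_pos by auto
  define u :: "complex ^ 3" where "u = wscale w3 (inverse c) (vector [v $ 1, v $ 2, v $ 3])"
  have "v = wscale w4 c (app4 u 1)"
    using c by (simp add: wscale_app4 u_def wscale_wscale wscale_1)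
      (simp add: vec_eq_iff forall_4 coord_defs)
  with c that show ?thesis by blast
qed

text \<open>A generic statement on the slice \<epsilon> = 1 is not yet generic on
  \<open>complex ^ 4\<close>. Closedness of \<open>wrel\<close> first makes it valid at every point
  of the slice where both tuples are nonzero. Homogeneity then carries it to all vectors with
  \<epsilon> nonzero, since each of them is a scalar multiple of a vector of the slice.\<close>

lemma extends_unique:
  assumes B: "B \<in> carrier (Bir_wproj w4)" "B' \<in> carrier (Bir_wproj w4)"
    and A: "A \<in> carrier (bir_group aff_eq)" and ext: "extends w4 B A" "extends w4 B' A"
  shows "B = B'"
proof -
  obtain F f F' f' where m: "F \<in> B" "f \<in> A" "F' \<in> B'" "f' \<in> A"
    and Ff: "generically (\<lambda>v. (F (app4 v 1), app4 (f v) 1) \<in> wrel w4)"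
    and Ff': "generically (\<lambda>v. (F' (app4 v 1), app4 (f' v) 1) \<in> wrel w4)"
    using ext unfolding extends_def by blast
  have hom: "hom_tuple w4 F" "hom_tuple w4 F'"
    using w4.dominant_if_in_Bir_wproj B m by auto
  have "(f, f') \<in> aff_eq" using aff.in_carrierD[OF A m(2)] m(4) by blast
  then have ff': "generically (\<lambda>v. f v = f' v)" by (simp add: aff_eq_def)
  have "generically (\<lambda>v. (F (app4 v 1), F' (app4 v 1)) \<in> wrel w4)"
    by (rule generically_mp2[OF generically_conj[OF Ff Ff'] ff']) (metis wrel_sym wrel_trans)
  then have *: "(F (app4 u 1), F' (app4 u 1)) \<in> wrel w4" if "F (app4 u 1) \<noteq> 0" "F' (app4 u 1) \<noteq> 0" for u
    using that hom by (intro wrel_generically_imp[OF w4.pos, of "\<lambda>u. F (app4 u 1)" "\<lambda>u. F' (app4 u 1)"]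
        poly_map_continuous poly_map_app4_compose hom_tuple_poly_map)
  have "(1 :: complex ^ 4) $ 4 \<noteq> 0" by simp
  then have "generically (\<lambda>v :: complex ^ 4. v $ 4 \<noteq> 0)"
    by (intro generically_nonzero poly_fun.coord) blast
  then have "generically (\<lambda>v. v $ 4 \<noteq> 0 \<and> F v \<noteq> 0 \<and> F' v \<noteq> 0)"
    by (intro generically_conj hom_tuple_nonzero[OF hom(1)] hom_tuple_nonzero[OF hom(2)])
  then have "generically (\<lambda>v. (F v, F' v) \<in> wrel w4)"
  proof (rule generically_mono)
    fix v assume v: "v $ 4 \<noteq> 0 \<and> F v \<noteq> 0 \<and> F' v \<noteq> 0"
    then obtain c u where cu: "c \<noteq> 0" "v = wscale w4 c (app4 u 1)" using affine_representative by blast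
    then have r: "(v, app4 u 1) \<in> wrel w4" by (simp add: wrel_wscale' app4_eq_0_iff)
    have "(F v, F (app4 u 1)) \<in> wrel w4" "(F' v, F' (app4 u 1)) \<in> wrel w4"
      using hom_tuple_wrel[OF _ r] hom v by auto
    moreover from this have "(F (app4 u 1), F' (app4 u 1)) \<in> wrel w4" using * wrel_nonzero by blast
    ultimately show "(F v, F' v) \<in> wrel w4" by (metis wrel_sym wrel_trans)
  qed
  then have "(F, F') \<in> proj_eq w4" using hom by (simp add: proj_eq_def)
  moreover have "B = proj_eq w4 `` {F}" "B' = proj_eq w4 `` {F'}"
    using w4.proj.in_carrierD B m unfolding Bir_wproj_def by blast+
  ultimately show ?thesis using w4.proj.cls_eq_iff[OF proj_eq_refl[OF hom(1)]] by simp
qed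

section \<open>Multiplicativity and uniqueness of the restriction to infinity\<close>

lemma restricts_to_one: "restricts_to w4 \<one>\<^bsub>Bir_wproj w4\<^esub> \<one>\<^bsub>Bir_wproj w3\<^esub>"
proof -
  have "generically (\<lambda>u::complex^3. u \<noteq> 0)" using hom_tuple_nonzero[OF hom_tuple_id] by simp
  then have "generically (\<lambda>u. (id (app4 u 0), app4 (id u) 0) \<in> wrel w4)"
    by (rule generically_mono) (simp add: wrel_refl app4_eq_0_iff)
  moreover have "id \<in> \<one>\<^bsub>Bir_wproj w4\<^esub>" "id \<in> \<one>\<^bsub>Bir_wproj w3\<^esub>"
    unfolding Bir_wproj_def by (simp_all add: w4.proj.one_cls w4.proj.E_id w3.proj.one_cls w3.proj.E_id)
  ultimately show ?thesis unfolding restricts_to_def by blast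
qed

lemma restricts_to_mult:
  assumes B: "B \<in> carrier (Bir_wproj w4)" "B' \<in> carrier (Bir_wproj w4)"
    and C: "C \<in> carrier (Bir_wproj w3)" "C' \<in> carrier (Bir_wproj w3)"
    and res: "restricts_to w4 B C" "restricts_to w4 B' C'"
  shows "restricts_to w4 (B \<otimes>\<^bsub>Bir_wproj w4\<^esub> B') (C \<otimes>\<^bsub>Bir_wproj w3\<^esub> C')"
proof -
  obtain F G F' G' where m: "F \<in> B" "G \<in> C" "F' \<in> B'" "G' \<in> C'"
    and FG: "generically (\<lambda>v. (F (app4 v 0), app4 (G v) 0) \<in> wrel w4)"
    and FG': "generically (\<lambda>v. (F' (app4 v 0), app4 (G' v) 0) \<in> wrel w4)"
    using res unfolding restricts_to_def by blast
  have hom: "hom_tuple w4 F" using w4.dominant_if_in_Bir_wproj[OF B(1) m(1)] by simp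
  have "generically (\<lambda>v. (F (F' (app4 v 0)), app4 (G (G' v)) 0) \<in> wrel w4)"
    by (rule generically_mp2[OF FG' dominantD[OF w3.dominant_if_in_Bir_wproj(2)[OF C(2) m(4)] FG]])
      (metis hom_tuple_wrel[OF hom] wrel_nonzero wrel_sym wrel_trans)
  moreover have "F \<circ> F' \<in> B \<otimes>\<^bsub>Bir_wproj w4\<^esub> B'" "G \<circ> G' \<in> C \<otimes>\<^bsub>Bir_wproj w3\<^esub> C'"
    using w4.proj.comp_in_mult w3.proj.comp_in_mult B C m unfolding Bir_wproj_def by blast+
  ultimately show ?thesis unfolding restricts_to_def
    by (intro bexI[of _ "F \<circ> F'"] bexI[of _ "G \<circ> G'"]) simp_all
qed

text \<open>Two representatives of \<open>B\<close> agree generically on \<open>complex ^ 4\<close>,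
  which by itself says nothing on the hypersurface \<epsilon> = 0. By closedness they agree wherever
  both are nonzero, and the definition of \<open>restricts_to\<close> makes both nonzero at a
  generic point of infinity.\<close>

lemma restricts_to_unique:
  assumes B: "B \<in> carrier (Bir_wproj w4)"
    and C: "C \<in> carrier (Bir_wproj w3)" "C' \<in> carrier (Bir_wproj w3)"
    and res: "restricts_to w4 B C" "restricts_to w4 B C'"
  shows "C = C'"
proof -
  obtain F G F' G' where m: "F \<in> B" "G \<in> C" "F' \<in> B" "G' \<in> C'"
    and FG: "generically (\<lambda>v. (F (app4 v 0), app4 (G v) 0) \<in> wrel w4)"
    and FG': "generically (\<lambda>v. (F' (app4 v 0), app4 (G' v) 0) \<in> wrel w4)"
    using res unfolding restricts_to_def by blast
  have hom: "hom_tuple w3 G" "hom_tuple w3 G'"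
    using w3.dominant_if_in_Bir_wproj C m by auto
  have "(F, F') \<in> proj_eq w4"
    using w4.proj.in_carrierD[of B F] B m unfolding Bir_wproj_def by blast
  note FF' = w4.proj_eq_imp_wrel[OF this]
  have "generically (\<lambda>v. (G v, G' v) \<in> wrel w3)"
  proof (rule generically_mp2[OF FG FG'])
    fix v assume a: "(F (app4 v 0), app4 (G v) 0) \<in> wrel w4" "(F' (app4 v 0), app4 (G' v) 0) \<in> wrel w4"
    then have "(F (app4 v 0), F' (app4 v 0)) \<in> wrel w4" using FF' wrel_nonzero by blast
    with a have "(app4 (G v) 0, app4 (G' v) 0) \<in> wrel w4" by (metis wrel_sym wrel_trans)
    then show "(G v, G' v) \<in> wrel w3" by (simp add: infinity_set)
  qed
  then have "(G, G') \<in> proj_eq w3" using hom by (simp add: proj_eq_def)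
  moreover have "C = proj_eq w3 `` {G}" "C' = proj_eq w3 `` {G'}"
    using w3.proj.in_carrierD C m unfolding Bir_wproj_def by blast+
  ultimately show ?thesis using w3.proj.cls_eq_iff[OF proj_eq_refl[OF hom(1)]] by simp
qed

section \<open>Families of maps over the parameter space\<close>

definition extends_param :: "('p, 3) param_maps \<Rightarrow> ('p, 4) param_maps \<Rightarrow> bool" where
  "extends_param \<sigma> \<tau> \<longleftrightarrow> fst \<tau> = fst \<sigma> \<and> (\<forall>a. extends w4 (snd \<tau> a) (snd \<sigma> a))"

definition restricts_param :: "('p, 4) param_maps \<Rightarrow> 3 maps \<Rightarrow> bool" where
  "restricts_param \<tau> C \<longleftrightarrow> (\<forall>a. restricts_to w4 (snd \<tau> a) C)"

text \<open>The inverse of a generator is extended by \<open>\<tau>\<close> as well, although \<open>\<sigma>\<close> need not be an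
  involution: \<open>\<sigma> \<circ> \<sigma>\<close> may act on the affine chart as an element of the cyclic group.\<close>

definition generator_triple ::
  "('p, 3) param_maps \<Rightarrow> ('p, 4) param_maps \<Rightarrow> 3 maps \<Rightarrow> bool" where
  "generator_triple \<sigma> \<tau> C \<longleftrightarrow>
     \<sigma> \<in> carrier Bir_aff \<and> \<tau> \<in> carrier (Bir_param_wproj w4) \<and> C \<in> carrier (Bir_wproj w3) \<and>
     extends_param \<sigma> \<tau> \<and> extends_param (inv\<^bsub>Bir_aff\<^esub> \<sigma>) \<tau> \<and>
     \<tau> \<otimes>\<^bsub>Bir_param_wproj w4\<^esub> \<tau> = \<one>\<^bsub>Bir_param_wproj w4\<^esub> \<and> restricts_param \<tau> C"

lemma aff_mod_inverseI:
  fixes f g :: "complex ^ 3 \<Rightarrow> complex ^ 3"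
  assumes f: "rational_map f" and g: "rational_map g"
    and gf: "generically (\<lambda>v. g (f v) = v)" and fg: "generically (\<lambda>v. f (g v) = v)"
  shows "mod_inverse aff_eq f g"
proof -
  have "dominant f" "dominant g" using dominant_if_left_inverse f g gf fg by blast+
  then have "rational_map (f \<circ> g)" "rational_map (g \<circ> f)" using rational_map_compose f g by blast+
  moreover have "rational_map (id :: complex ^ 3 \<Rightarrow> complex ^ 3)"
    by (rule poly_map_rational[OF poly_map_id])
  ultimately show ?thesis
    using f g gf fg by (simp add: mod_inverse_def aff_eq_def generically_True)
qed

text \<open>The family \<open>g\<close> represents the inverse of the affine generator, with the
  same parameter map \<phi>. It is kept separate from \<open>f\<close> to allow automorphisms whose
  square is -1 on the cover, while a single family \<open>F\<close> extends both.\<close>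

lemma generator_tripleI:
  fixes \<phi> :: "'p \<Rightarrow> 'p"
  assumes \<phi>: "\<And>a. \<phi> (\<phi> a) = a"
    and f: "\<And>a. rational_map (f a)" and g: "\<And>a. rational_map (g a)"
    and gf: "\<And>a. generically (\<lambda>v. g (\<phi> a) (f a v) = v)"
    and fg: "\<And>a. generically (\<lambda>v. f (\<phi> a) (g a v) = v)"
    and F: "\<And>a. hom_tuple w4 (F a)" and FF: "\<And>a. generically (\<lambda>v. (F (\<phi> a) (F a v), v) \<in> wrel w4)"
    and Ff: "\<And>a. generically (\<lambda>v. (F a (app4 v 1), app4 (f a v) 1) \<in> wrel w4)"
    and Fg: "\<And>a. generically (\<lambda>v. (F a (app4 v 1), app4 (g a v) 1) \<in> wrel w4)"
    and G: "hom_tuple w3 G" and GG: "generically (\<lambda>u. (G (G u), u) \<in> wrel w3)"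
    and FG: "\<And>a. generically (\<lambda>u. (F a (app4 u 0), app4 (G u) 0) \<in> wrel w4)"
  shows "generator_triple (\<phi>, \<lambda>a. aff_eq `` {f a}) (\<phi>, \<lambda>a. proj_eq w4 `` {F a}) (proj_eq w3 `` {G})"
proof -
  have \<phi>\<phi>: "\<phi> \<circ> \<phi> = id" using \<phi> by auto
  then have bij: "bij \<phi>" by (metis o_bij)
  have fI: "mod_inverse aff_eq (f a) (g (\<phi> a))" for a
    using f g gf fg[of "\<phi> a"] by (intro aff_mod_inverseI) (auto simp: \<phi>)
  have FI: "mod_inverse (proj_eq w4) (F a) (F (\<phi> a))" for a
  proof -
    have dom: "dominant (F a)" for a by (rule w4.hom_tuple_dominant[OF F FF])
    have "(F (\<phi> a) \<circ> F a, id) \<in> proj_eq w4" for a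
      using hom_tuple_compose[OF F F dom] FF[of a] hom_tuple_id by (simp add: proj_eq_def)
    from this[of a] this[of "\<phi> a"] show ?thesis
      unfolding mod_inverse_def by (simp add: proj_eq_refl F \<phi>)
  qed
  have GI: "mod_inverse (proj_eq w3) G G"
    using hom_tuple_compose[OF G G w3.hom_tuple_dominant[OF G GG]] GG hom_tuple_id proj_eq_refl[OF G]
    by (simp add: mod_inverse_def proj_eq_def)
  let ?\<sigma> = "(\<phi>, \<lambda>a. aff_eq `` {f a}) :: ('p, 3) param_maps"
    and ?\<sigma>' = "(\<phi>, \<lambda>a. aff_eq `` {g a}) :: ('p, 3) param_maps"
    and ?\<tau> = "(\<phi>, \<lambda>a. proj_eq w4 `` {F a}) :: ('p, 4) param_maps"
  interpret A: group "Bir_aff :: ('p, 3) param_maps monoid" by (rule group_Bir_aff)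
  have gI: "mod_inverse aff_eq (g a) (f (\<phi> a))" for a
    using aff.Inv_sym[OF fI[of "\<phi> a"]] by (simp add: \<phi>)
  have \<sigma>: "?\<sigma> \<in> carrier Bir_aff" "?\<sigma>' \<in> carrier Bir_aff"
    using bij aff.cls_in_carrier[OF fI] aff.cls_in_carrier[OF gI]
    by (auto simp: Bir_aff_def param_group_simps)
  have "?\<sigma>' \<otimes>\<^bsub>Bir_aff\<^esub> ?\<sigma> = \<one>\<^bsub>Bir_aff\<^esub>"
    unfolding Bir_aff_def param_group_simps by (simp add: \<phi>\<phi> aff.mult_cls_inverse[OF fI])
  then have inv: "inv\<^bsub>Bir_aff\<^esub> ?\<sigma> = ?\<sigma>'" using A.inv_equality \<sigma> by blast
  have \<tau>: "?\<tau> \<in> carrier (Bir_param_wproj w4)"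
    using bij w4.proj.cls_in_carrier[OF FI] by (simp add: Bir_param_wproj_def Bir_wproj_def param_group_simps)
  have \<tau>\<tau>: "?\<tau> \<otimes>\<^bsub>Bir_param_wproj w4\<^esub> ?\<tau> = \<one>\<^bsub>Bir_param_wproj w4\<^esub>"
    unfolding Bir_param_wproj_def Bir_wproj_def param_group_simps
    by (simp add: \<phi>\<phi> w4.proj.mult_cls_inverse[OF FI])
  have C: "proj_eq w3 `` {G} \<in> carrier (Bir_wproj w3)"
    unfolding Bir_wproj_def by (rule w3.proj.cls_in_carrier[OF GI])
  have "extends_param ?\<sigma> ?\<tau>" "extends_param ?\<sigma>' ?\<tau>"
    using Ff Fg fI gI FI unfolding extends_param_def extends_def mod_inverse_def by fastforce+
  moreover have "restricts_param ?\<tau> (proj_eq w3 `` {G})"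
    using FG GI FI unfolding restricts_param_def restricts_to_def mod_inverse_def by fastforce
  ultimately show ?thesis using \<sigma> \<tau> \<tau>\<tau> C inv unfolding generator_triple_def by simp
qed

lemma extends_param_mult:
  assumes "\<sigma> \<in> carrier Bir_aff" "\<sigma>' \<in> carrier Bir_aff"
    "\<tau> \<in> carrier (Bir_param_wproj w4)" "\<tau>' \<in> carrier (Bir_param_wproj w4)" "extends_param \<sigma> \<tau>" "extends_param \<sigma>' \<tau>'"
  shows "extends_param (\<sigma> \<otimes>\<^bsub>Bir_aff\<^esub> \<sigma>') (\<tau> \<otimes>\<^bsub>Bir_param_wproj w4\<^esub> \<tau>')"
  using assms extends_mult
  by (simp add: extends_param_def Bir_param_wproj_def Bir_aff_def param_group_simps)

lemma restricts_param_mult: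
  assumes "\<tau> \<in> carrier (Bir_param_wproj w4)" "\<tau>' \<in> carrier (Bir_param_wproj w4)"
    "C \<in> carrier (Bir_wproj w3)" "C' \<in> carrier (Bir_wproj w3)"
    "restricts_param \<tau> C" "restricts_param \<tau>' C'"
  shows "restricts_param (\<tau> \<otimes>\<^bsub>Bir_param_wproj w4\<^esub> \<tau>') (C \<otimes>\<^bsub>Bir_wproj w3\<^esub> C')"
  using assms restricts_to_mult
  by (simp add: restricts_param_def Bir_param_wproj_def param_group_simps)

lemma extension_and_restriction:
  fixes K :: "(('p, 3) param_maps \<times> ('p, 4) param_maps \<times> 3 maps) set"
  assumes K: "\<And>\<sigma> \<tau> C. (\<sigma>, \<tau>, C) \<in> K \<Longrightarrow> generator_triple \<sigma> \<tau> C"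
  defines "W \<equiv> generate Bir_aff (fst ` K)"
  obtains ext res where "extension_hom w4 W ext" "restriction_hom w4 w3 (ext ` W) res"
    "\<And>\<sigma> \<tau> C. (\<sigma>, \<tau>, C) \<in> K \<Longrightarrow> ext \<sigma> = \<tau> \<and> res \<tau> = C"
proof -
  interpret A: group "Bir_aff :: ('p, 3) param_maps monoid" by (rule group_Bir_aff)
  interpret P: group "Bir_param_wproj w4 :: ('p, 4) param_maps monoid" by (rule w4.group_Bir_param_wproj)
  interpret Q: group "Bir_wproj w3" by (rule w3.group_Bir_wproj)
  have uext: "\<tau> = \<tau>'" if "\<sigma> \<in> carrier Bir_aff" "\<tau> \<in> carrier (Bir_param_wproj w4)"
      "\<tau>' \<in> carrier (Bir_param_wproj w4)" "extends_param \<sigma> \<tau>" "extends_param \<sigma> \<tau>'"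
    for \<sigma> and \<tau> \<tau>' :: "('p, 4) param_maps"
  proof -
    have "snd \<tau> a = snd \<tau>' a" for a
      using that by (intro extends_unique[of _ _ "snd \<sigma> a"])
        (auto simp: extends_param_def Bir_param_wproj_def Bir_aff_def param_group_simps)
    then show ?thesis using that by (auto simp: prod_eq_iff extends_param_def)
  qed
  \<comment> \<open>The map \<open>C\<close> is the restriction for every parameter value, so a
    single value determines it; \<open>undefined\<close> serves as that value.\<close>
  have ures: "C = C'" if "\<tau> \<in> carrier (Bir_param_wproj w4)" "C \<in> carrier (Bir_wproj w3)"
      "C' \<in> carrier (Bir_wproj w3)" "restricts_param \<tau> C" "restricts_param \<tau> C'"
    for \<tau> :: "('p, 4) param_maps" and C C'
    using that by (intro restricts_to_unique[of "snd \<tau> undefined"])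
      (auto simp: restricts_param_def Bir_param_wproj_def param_group_simps)
  have fK: "fst ` K \<subseteq> carrier Bir_aff" using K by (auto simp: generator_triple_def)
  have gen: "\<exists>\<tau>\<in>carrier (Bir_param_wproj w4). extends_param \<sigma> \<tau>"
    "\<exists>\<tau>\<in>carrier (Bir_param_wproj w4). extends_param (inv\<^bsub>Bir_aff\<^esub> \<sigma>) \<tau>" if "\<sigma> \<in> fst ` K" for \<sigma>
    using that K unfolding generator_triple_def by force+
  have one: "extends_param \<one>\<^bsub>Bir_aff\<^esub> (\<one>\<^bsub>Bir_param_wproj w4\<^esub> :: ('p, 4) param_maps)"
    by (simp add: extends_param_def Bir_aff_def Bir_param_wproj_def param_group_simps extends_one)
  have "\<exists>ext. group_hom (Bir_aff\<lparr>carrier := W\<rparr>) (Bir_param_wproj w4) ext \<and>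
      (\<forall>\<sigma>\<in>W. extends_param \<sigma> (ext \<sigma>))"
    unfolding W_def by (rule hom_from_relation[OF A.is_group P.is_group fK])
      (fact gen one extends_param_mult uext)+
  then obtain ext where ext: "group_hom (Bir_aff\<lparr>carrier := W\<rparr>) (Bir_param_wproj w4) ext"
    "\<And>\<sigma>. \<sigma> \<in> W \<Longrightarrow> extends_param \<sigma> (ext \<sigma>)" by blast
  interpret e: group_hom "Bir_aff\<lparr>carrier := W\<rparr>" "Bir_param_wproj w4" ext by (rule ext(1))
  have KW: "fst ` K \<subseteq> W" unfolding W_def by (auto intro: generate.incl)
  have extK: "ext \<sigma> = \<tau>" if "(\<sigma>, \<tau>, C) \<in> K" for \<sigma> \<tau> C
  proof -
    have "\<sigma> \<in> W" using imageI[OF that, of fst] KW by auto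
    then show ?thesis using K[OF that] ext(2)[of \<sigma>] e.hom_closed[of \<sigma>]
      by (intro uext[of \<sigma>]) (auto simp: generator_triple_def)
  qed
  have sW: "subgroup W Bir_aff" unfolding W_def by (rule A.generate_is_subgroup[OF fK])
  have "ext ` W = generate (Bir_param_wproj w4) (ext ` fst ` K)"
    using e.generate_img[of "fst ` K"] KW A.generate_consistent[OF KW sW] by (simp add: W_def)
  moreover have "ext (fst k) = fst (snd k)" if "k \<in> K" for k
    using extK[of "fst k" "fst (snd k)" "snd (snd k)"] that by simp
  then have "ext ` fst ` K = (fst \<circ> snd) ` K" by (simp add: image_image cong: image_cong_simp)
  ultimately have extW: "ext ` W = generate (Bir_param_wproj w4) ((fst \<circ> snd) ` K)" by simp
  have sK: "(fst \<circ> snd) ` K \<subseteq> carrier (Bir_param_wproj w4)" using K by (auto simp: generator_triple_def)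
  have gen: "\<exists>C\<in>carrier (Bir_wproj w3). restricts_param \<tau> C"
    "\<exists>C\<in>carrier (Bir_wproj w3). restricts_param (inv\<^bsub>Bir_param_wproj w4\<^esub> \<tau>) C"
    if \<tau>: "\<tau> \<in> (fst \<circ> snd) ` K" for \<tau>
  proof -
    obtain k where "k \<in> K" "\<tau> = fst (snd k)" using \<tau> by auto
    then have t: "generator_triple (fst k) \<tau> (snd (snd k))" by (intro K) simp
    then show "\<exists>C\<in>carrier (Bir_wproj w3). restricts_param \<tau> C" by (auto simp: generator_triple_def)
    moreover have "inv\<^bsub>Bir_param_wproj w4\<^esub> \<tau> = \<tau>"
      using t by (intro P.inv_equality) (auto simp: generator_triple_def)
    ultimately show "\<exists>C\<in>carrier (Bir_wproj w3). restricts_param (inv\<^bsub>Bir_param_wproj w4\<^esub> \<tau>) C"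
      by simp
  qed
  have one: "restricts_param (\<one>\<^bsub>Bir_param_wproj w4\<^esub> :: ('p, 4) param_maps) \<one>\<^bsub>Bir_wproj w3\<^esub>"
    by (simp add: restricts_param_def Bir_param_wproj_def param_group_simps restricts_to_one)
  have "\<exists>res. group_hom (Bir_param_wproj w4\<lparr>carrier := ext ` W\<rparr>) (Bir_wproj w3) res \<and>
      (\<forall>\<tau>\<in>ext ` W. restricts_param \<tau> (res \<tau>))"
    unfolding extW by (rule hom_from_relation[OF P.is_group Q.is_group sK])
      (fact gen one restricts_param_mult ures)+
  then obtain res where res: "group_hom (Bir_param_wproj w4\<lparr>carrier := ext ` W\<rparr>) (Bir_wproj w3) res"
    "\<And>\<tau>. \<tau> \<in> ext ` W \<Longrightarrow> restricts_param \<tau> (res \<tau>)" by blast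
  interpret r: group_hom "Bir_param_wproj w4\<lparr>carrier := ext ` W\<rparr>" "Bir_wproj w3" res by (rule res(1))
  have resK: "res \<tau> = C" if "(\<sigma>, \<tau>, C) \<in> K" for \<sigma> \<tau> C
  proof -
    have "\<tau> \<in> ext ` W"
      unfolding extW using imageI[OF that, of "fst \<circ> snd"] by (intro generate.incl) simp
    then show ?thesis using K[OF that] res(2)[of \<tau>] r.hom_closed[of \<tau>]
      by (intro ures[of \<tau>]) (auto simp: generator_triple_def)
  qed
  show ?thesis
  proof (rule that)
    show "extension_hom w4 W ext" using ext unfolding extension_hom_def extends_param_def by simp
    show "restriction_hom w4 w3 (ext ` W) res"
      using res unfolding restriction_hom_def restricts_param_def by simp
  next
    fix \<sigma> \<tau> C assume "(\<sigma>, \<tau>, C) \<in> K"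
    then show "ext \<sigma> = \<tau> \<and> res \<tau> = C" using extK resK by (intro conjI)
  qed
qed

end

section \<open>Leaves and their linear symmetries\<close>

lemma sym_leaf_rel: "sym (leaf_rel w V)"
  unfolding leaf_rel_def sym_def by blast

lemma leaf_rel_wproj: "leaf_rel w V \<subseteq> wproj w \<times> wproj w"
proof -
  have "v \<noteq> 0" if "v $ k = 1" for v :: "complex ^ 'n" and k using that by auto
  then show ?thesis unfolding leaf_rel_def by (fastforce intro: pt_in_wproj)
qed

lemma leaf_rel_rtrancl_wproj: "(x, y) \<in> (leaf_rel w V)\<^sup>* \<Longrightarrow> x \<in> wproj w \<Longrightarrow> y \<in> wproj w"
  by (induction rule: rtrancl_induct) (use leaf_rel_wproj in auto)

text \<open>The term with \<open>b\<close> is a multiple of the Euler field. Near \<open>t0\<close> some coordinate \<open>k\<close> does not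
  vanish; rescaling it to 1 cancels the Euler component and leaves the chart field up to a
  nonvanishing factor, which is absorbed by a change of time.\<close>

lemma tangent_curve_local:
  fixes V :: "complex ^ 'n \<Rightarrow> complex ^ 'n" and \<mu> :: "complex \<Rightarrow> complex ^ 'n"
  assumes hom: "\<And>c u. V (wscale w c u) = (\<chi> i. c * wscale w c (V u) $ i)"
    and pos: "\<And>i. w $ i > 0" and D: "open D" "t0 \<in> D" and a: "a \<noteq> 0"
    and der: "\<And>t i. t \<in> D \<Longrightarrow> ((\<lambda>t. \<mu> t $ i) has_field_derivative
        a * V (\<mu> t) $ i + b t * of_nat (w $ i) * \<mu> t $ i) (at t)"
    and nz: "\<And>t. t \<in> D \<Longrightarrow> \<mu> t \<noteq> 0"
  shows "\<exists>e>0. ball t0 e \<subseteq> D \<and> (\<forall>t\<in>ball t0 e. (pt w (\<mu> t0), pt w (\<mu> t)) \<in> leaf_rel w V)"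
proof -
  obtain k where k: "\<mu> t0 $ k \<noteq> 0" using nz[OF D(2)] by (auto simp: vec_eq_iff)
  define m where "m = w $ k"
  \<comment> \<open>Division by the initial value makes \<open>q t0 = 1\<close>, so near
    \<open>t0\<close> the values stay in the domain where \<open>Ln\<close> is holomorphic.\<close>
  define q where "q = (\<lambda>t. \<mu> t $ k / \<mu> t0 $ k)"
  have qder: "\<exists>q'. (q has_field_derivative q') (at t)" if "t \<in> D" for t
    unfolding q_def using DERIV_cdivide[OF der[OF that]] by blast
  then have "continuous_on D q"
    by (meson DERIV_isCont continuous_at_imp_continuous_on)
  then have "open (D \<inter> q -` ball 1 1)" using D(1) by (intro continuous_open_preimage) auto
  moreover have "t0 \<in> D \<inter> q -` ball 1 1" using D(2) k by (simp add: q_def)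
  ultimately obtain r where r: "r > 0" "ball t0 r \<subseteq> D \<inter> q -` ball 1 1"
    using open_contains_ball by meson
  define B where "B = ball t0 r"
  have openB: "open B" by (simp add: B_def)
  have BD: "t \<in> D" if "t \<in> B" for t using r that by (auto simp: B_def)
  have qB: "q t \<notin> \<real>\<^sub>\<le>\<^sub>0" "q t \<noteq> 0" if "t \<in> B" for t
  proof -
    have "norm (1 - q t) < 1" using r that by (auto simp: B_def dist_norm)
    moreover have "Re (1 - q t) \<le> norm (1 - q t)" by (rule complex_Re_le_cmod)
    ultimately have "Re (q t) > 0" by simp
    then show "q t \<notin> \<real>\<^sub>\<le>\<^sub>0" "q t \<noteq> 0" by (auto simp: complex_nonpos_Reals_iff)
  qed
  obtain \<rho> where \<rho>: "\<rho> \<noteq> 0" "inverse (\<mu> t0 $ k) = \<rho> ^ m"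
    using exists_complex_root_nonzero[of "inverse (\<mu> t0 $ k)" m] k pos[of k] by (auto simp: m_def)
  \<comment> \<open>A holomorphic branch of the power -1/m of the k-th coordinate of \<mu>, with
    \<rho> supplying its value at \<open>t0\<close>. Scaling by \<open>l\<close> with weight
    \<open>m\<close> normalises this coordinate to 1.\<close>
  define l where "l = (\<lambda>t. \<rho> * exp (- Ln (q t) / of_nat m))"
  have l0: "l t \<noteq> 0" for t using \<rho> by (simp add: l_def)
  have lder: "\<exists>l'. (l has_field_derivative l') (at t)" if t: "t \<in> B" for t
  proof -
    obtain q' where q': "(q has_field_derivative q') (at t)" using qder[OF BD[OF t]] by blast
    show ?thesis unfolding l_def using qB[OF t] pos[of k]
      by (auto intro!: exI derivative_eq_intros q' simp: m_def)
  qed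
  define \<eta> where "\<eta> = (\<lambda>t. wscale w (l t) (\<mu> t))"
  have \<eta>k: "\<eta> t $ k = 1" if t: "t \<in> B" for t
  proof -
    have "exp (- Ln (q t) / of_nat m) ^ m = exp (of_nat m * (- Ln (q t) / of_nat m))"
      by (rule exp_of_nat_mult[symmetric])
    also have "\<dots> = inverse (q t)"
      using pos[of k] qB[OF t] by (simp add: m_def exp_minus)
    finally have "l t ^ m * \<mu> t $ k = inverse (\<mu> t0 $ k) * inverse (q t) * \<mu> t $ k"
      using \<rho> by (simp add: l_def power_mult_distrib)
    also have "\<dots> = 1" using qB[OF t] k by (simp add: q_def)
    finally show ?thesis by (simp add: \<eta>_def wscale_def m_def)
  qed
  have \<eta>der: "((\<lambda>t. \<eta> t $ i) has_field_derivative
      a / (l t * of_nat m) * chart_field w k V (\<eta> t) $ i) (at t)" if t: "t \<in> B" for t i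
  proof -
    obtain l' where l': "(l has_field_derivative l') (at t)" using lder[OF t] by blast
    have d: "((\<lambda>t. \<eta> t $ i) has_field_derivative
        (of_nat (w $ i) * \<eta> t $ i * (l' / l t + b t) + a / l t * V (\<eta> t) $ i)) (at t)" for i
    proof -
      have l_pow: "of_nat (w $ i) * l t ^ (w $ i - 1) * l' = of_nat (w $ i) * l t ^ (w $ i) * (l' / l t)"
        using l0[of t] pos[of i] by (cases "w $ i") auto
      have V\<eta>: "a / l t * V (\<eta> t) $ i = a * l t ^ (w $ i) * V (\<mu> t) $ i"
        using l0[of t] unfolding \<eta>_def hom by (simp add: wscale_def)
      have "((\<lambda>t. l t ^ (w $ i) * \<mu> t $ i) has_field_derivative
          (of_nat (w $ i) * l t ^ (w $ i - 1) * l') * \<mu> t $ i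
          + (a * V (\<mu> t) $ i + b t * of_nat (w $ i) * \<mu> t $ i) * l t ^ (w $ i)) (at t)"
        by (auto intro!: derivative_eq_intros der BD t l' simp: algebra_simps)
      moreover have "(of_nat (w $ i) * l t ^ (w $ i - 1) * l') * \<mu> t $ i
          + (a * V (\<mu> t) $ i + b t * of_nat (w $ i) * \<mu> t $ i) * l t ^ (w $ i)
          = of_nat (w $ i) * \<eta> t $ i * (l' / l t + b t) + a / l t * V (\<eta> t) $ i"
        unfolding l_pow V\<eta> by (simp add: \<eta>_def wscale_def algebra_simps)
      moreover have "(\<lambda>t. \<eta> t $ i) = (\<lambda>t. l t ^ (w $ i) * \<mu> t $ i)"
        by (simp add: \<eta>_def wscale_def)
      ultimately show ?thesis by simp
    qed
    have "((\<lambda>t. \<eta> t $ k) has_field_derivative 0) (at t)"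
      by (rule DERIV_cong_ev[THEN iffD2, OF refl _ refl, where g1 = "\<lambda>_. 1"])
        (use t \<eta>k in \<open>auto simp: eventually_nhds B_def intro!: exI[of _ "ball t0 r"]\<close>)
    \<comment> \<open>Constancy of the k-th component determines \<open>l' / l t + b t\<close>.
      Substituting this into the other components eliminates \<open>b\<close> and produces exactly
      the subtracted term of \<open>chart_field\<close>.\<close>
    from DERIV_unique[OF this d[of k]] have sum0: "of_nat m * (l' / l t + b t) + a / l t * V (\<eta> t) $ k = 0"
      by (simp add: \<eta>k[OF t] m_def)
    have solve: "A = - X / c" if "c * A + X = 0" "c \<noteq> 0" for A X c :: complex
      using that by (metis add.inverse_unique minus_minus nonzero_mult_div_cancel_left add.commute)
    have eq: "l' / l t + b t = - (a / l t * V (\<eta> t) $ k) / of_nat m"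
      by (rule solve[OF sum0]) (use pos[of k] in \<open>simp add: m_def\<close>)
    have "of_nat (w $ i) * \<eta> t $ i * (l' / l t + b t) + a / l t * V (\<eta> t) $ i
        = a / (l t * of_nat m) * chart_field w k V (\<eta> t) $ i"
      unfolding eq using pos[of k] l0[of t] by (simp add: chart_field_def \<eta>k[OF t] m_def field_simps)
    with d[of i] show ?thesis by simp
  qed
  \<comment> \<open>The speed of \<eta> relative to the chart field. Its primitive \<open>S\<close>
    is the new time, and \<open>S\<close> is locally invertible because \<omega> has no
    zeros.\<close>
  define \<omega> where "\<omega> = (\<lambda>t. a / (l t * of_nat m))"
  have \<omega>0: "\<omega> t \<noteq> 0" for t using a l0 pos[of k] by (simp add: \<omega>_def m_def)
  have "l holomorphic_on B"
    unfolding holomorphic_on_open[OF openB] using lder by blast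
  then have "\<omega> holomorphic_on B"
    unfolding \<omega>_def using l0 pos[of k] by (intro holomorphic_intros) (auto simp: m_def)
  then obtain S where S: "\<And>t. t \<in> B \<Longrightarrow> (S has_field_derivative \<omega> t) (at t within B)"
    using holomorphic_convex_primitive'[of B \<omega>] by (auto simp: B_def)
  then have S: "(S has_field_derivative \<omega> t) (at t)" if "t \<in> B" for t
  proof -
    have "at t within B = at t" using that openB by (rule at_within_open)
    with S[OF that] show ?thesis by simp
  qed
  have SB: "S holomorphic_on B" unfolding holomorphic_on_open[OF openB] using S by blast
  have dS: "deriv S t = \<omega> t" if "t \<in> B" for t using S[OF that] by (rule DERIV_imp_deriv)
  have "t0 \<in> B" using r(1) by (simp add: B_def)
  then obtain e where e: "e > 0" "ball t0 e \<subseteq> B" "inj_on S (ball t0 e)"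
    using has_complex_derivative_locally_injective[OF SB, of t0] dS \<omega>0 by (metis B_def open_ball)
  define D' where "D' = S ` ball t0 e"
  have Se: "S holomorphic_on ball t0 e" using SB e(2) by (rule holomorphic_on_subset)
  obtain g where g: "g holomorphic_on D'" "\<And>z. z \<in> ball t0 e \<Longrightarrow> deriv S z * deriv g (S z) = 1"
    "\<And>z. z \<in> ball t0 e \<Longrightarrow> g (S z) = z"
    using holomorphic_has_inverse[OF Se open_ball e(3)] unfolding D'_def by metis
  have D': "open D'" "connected D'"
    unfolding D'_def by (rule open_mapping_thm3[OF Se open_ball e(3)])
      (intro connected_continuous_image holomorphic_on_imp_continuous_on Se connected_ball)
  have "integral_curve (chart_field w k V) D' (\<eta> \<circ> g)"
    unfolding integral_curve_def
  proof (intro conjI D' ballI allI)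
    fix y i assume y: "y \<in> D'"
    then obtain z where z: "z \<in> ball t0 e" "y = S z" by (auto simp: D'_def)
    have zB: "z \<in> B" using z(1) e(2) by blast
    have "(g has_field_derivative deriv g y) (at y)"
      using g(1) D'(1) y by (simp add: holomorphic_derivI)
    moreover have "deriv g y = inverse (\<omega> z)"
      using g(2)[OF z(1)] dS[OF zB] \<omega>0[of z] by (simp add: z(2) field_simps)
    ultimately have "(g has_field_derivative inverse (\<omega> z)) (at y)" by simp
    moreover have "((\<lambda>t. \<eta> t $ i) has_field_derivative \<omega> z * chart_field w k V (\<eta> z) $ i) (at (g y))"
      using \<eta>der[OF zB] g(3)[OF z(1)] by (simp add: \<omega>_def z(2))
    ultimately have "((\<lambda>t. \<eta> (g t) $ i) has_field_derivative
        \<omega> z * chart_field w k V (\<eta> z) $ i * inverse (\<omega> z)) (at y)"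
      using DERIV_chain2 by fast
    moreover have "\<omega> z * c * inverse (\<omega> z) = c" for c using \<omega>0[of z] by simp
    ultimately show "((\<lambda>t. (\<eta> \<circ> g) t $ i) has_field_derivative chart_field w k V ((\<eta> \<circ> g) y) $ i) (at y)"
      using g(3)[OF z(1)] by (simp add: z(2))
  qed
  moreover have "\<forall>y\<in>D'. (\<eta> \<circ> g) y $ k = 1" using g(3) e(2) \<eta>k by (auto simp: D'_def)
  ultimately have *: "(pt w ((\<eta> \<circ> g) y), pt w ((\<eta> \<circ> g) y')) \<in> leaf_rel w V" if "y \<in> D'" "y' \<in> D'" for y y'
    using that unfolding leaf_rel_def by blast
  have "(pt w (\<mu> t0), pt w (\<mu> t)) \<in> leaf_rel w V" if t: "t \<in> ball t0 e" for t
  proof -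
    have pt: "pt w ((\<eta> \<circ> g) (S t)) = pt w (\<mu> t)" if "t \<in> ball t0 e" for t
    proof -
      have "\<mu> t \<noteq> 0" using nz BD that e(2) by blast
      then show ?thesis
        using g(3)[OF that] l0[of t] by (simp add: \<eta>_def pt_eq_iff wscale_zero_iff wrel_wscale')
    qed
    have "t0 \<in> ball t0 e" using e(1) by simp
    then show ?thesis using *[of "S t0" "S t"] t by (simp add: pt[symmetric] D'_def del: o_apply)
  qed
  moreover have "ball t0 e \<subseteq> D" using e(2) BD by blast
  ultimately show ?thesis using e(1) by blast
qed

text \<open>No single chart need contain the whole curve, so one step of \<open>leaf_rel\<close>
  covers only a small ball. Connectedness of \<open>D\<close> joins such balls into a finite
  chain.\<close>

lemma tangent_curve_in_leaf:
  fixes V :: "complex ^ 'n \<Rightarrow> complex ^ 'n" and \<mu> :: "complex \<Rightarrow> complex ^ 'n"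
  assumes hom: "\<And>c u. V (wscale w c u) = (\<chi> i. c * wscale w c (V u) $ i)"
    and pos: "\<And>i. w $ i > 0" and D: "open D" "connected D" and a: "a \<noteq> 0"
    and der: "\<And>t i. t \<in> D \<Longrightarrow> ((\<lambda>t. \<mu> t $ i) has_field_derivative
        a * V (\<mu> t) $ i + b t * of_nat (w $ i) * \<mu> t $ i) (at t)"
    and nz: "\<And>t. t \<in> D \<Longrightarrow> \<mu> t \<noteq> 0" and t: "t \<in> D" "t' \<in> D"
  shows "(pt w (\<mu> t), pt w (\<mu> t')) \<in> (leaf_rel w V)\<^sup>*"
proof (rule connected_equivalence_relation[OF D(2) t])
  show "(pt w (\<mu> y), pt w (\<mu> x)) \<in> (leaf_rel w V)\<^sup>*"
    if "(pt w (\<mu> x), pt w (\<mu> y)) \<in> (leaf_rel w V)\<^sup>*" for x y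
    using that by (rule symD[OF sym_rtrancl[OF sym_leaf_rel]])
  show "\<exists>T. openin (top_of_set D) T \<and> x \<in> T \<and> (\<forall>y\<in>T. (pt w (\<mu> x), pt w (\<mu> y)) \<in> (leaf_rel w V)\<^sup>*)"
    if "x \<in> D" for x
  proof -
    obtain e where "e > 0" "ball x e \<subseteq> D"
      "\<forall>t\<in>ball x e. (pt w (\<mu> x), pt w (\<mu> t)) \<in> leaf_rel w V"
      using tangent_curve_local[OF hom pos D(1) \<open>x \<in> D\<close> a der nz] by blast
    then show ?thesis
      by (intro exI[of _ "ball x e"]) (auto intro: open_subset r_into_rtrancl)
  qed
qed (rule rtrancl_trans)

section \<open>Linear symmetries of a vector field\<close>

definition graded_linear :: "nat ^ 'n \<Rightarrow> (complex ^ 'n \<Rightarrow> complex ^ 'n) \<Rightarrow> bool" where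
  "graded_linear w G \<longleftrightarrow> Vector_Spaces.linear (*s) (*s) G \<and> (\<forall>c v. G (wscale w c v) = wscale w c (G v))"

lemma linear_component:
  fixes G :: "complex ^ 'n \<Rightarrow> complex ^ 'm"
  assumes "Vector_Spaces.linear (*s) (*s) G"
  shows "G v $ i = (\<Sum>j\<in>UNIV. matrix G $ i $ j * v $ j)"
proof -
  have "G v $ i = (matrix G *v v) $ i" using matrix_works[OF assms] by simp
  also have "\<dots> = (\<Sum>j\<in>UNIV. matrix G $ i $ j * v $ j)" by (simp only: matrix_vector_mult_def vec_lambda_beta)
  finally show ?thesis .
qed

lemma linear_derivative:
  fixes G :: "complex ^ 'n \<Rightarrow> complex ^ 'm"
  assumes "Vector_Spaces.linear (*s) (*s) G"
    and "\<And>i. ((\<lambda>t. \<gamma> t $ i) has_field_derivative d $ i) (at t)"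
  shows "((\<lambda>t. G (\<gamma> t) $ i) has_field_derivative G d $ i) (at t)"
  unfolding linear_component[OF assms(1)] by (intro DERIV_sum DERIV_cmult assms(2))

text \<open>The Euler field is the derivative of the weighted action at \<open>c = 1\<close>. Both
  sides arise by differentiating \<open>G (wscale w c v)\<close> there, before and after moving
  \<open>G\<close> inside the scaling.\<close>

lemma graded_linear_euler:
  assumes "graded_linear w G"
  shows "G (\<chi> i. of_nat (w $ i) * v $ i) $ i = of_nat (w $ i) * G v $ i"
proof (rule DERIV_unique)
  have d: "((\<lambda>c. wscale w c v $ i) has_field_derivative of_nat (w $ i) * v $ i) (at 1)" for v and i :: 'a
    unfolding wscale_def by (auto intro!: derivative_eq_intros)
  show "((\<lambda>c. G (wscale w c v) $ i) has_field_derivative G (\<chi> i. of_nat (w $ i) * v $ i) $ i) (at 1)"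
    by (rule linear_derivative) (use assms d in \<open>auto simp: graded_linear_def\<close>)
  show "((\<lambda>c. G (wscale w c v) $ i) has_field_derivative of_nat (w $ i) * G v $ i) (at 1)"
    using d[of "G v" i] assms by (simp add: graded_linear_def)
qed

text \<open>The constant \<epsilon> changes only the time of the integral curves; the value -1
  occurs for the fourth equation.\<close>

definition foliation_symmetry ::
  "nat ^ 'n \<Rightarrow> (complex ^ 'n \<Rightarrow> complex ^ 'n) \<Rightarrow> (complex ^ 'n \<Rightarrow> complex ^ 'n) \<Rightarrow> bool" where
  "foliation_symmetry w V G \<longleftrightarrow> graded_linear w G \<and> bij G \<and> (\<exists>\<epsilon>. \<epsilon> \<noteq> 0 \<and> (\<forall>v. V (G v) = \<epsilon> *s G (V v)))"

lemma graded_linear_compose: "graded_linear w G \<Longrightarrow> graded_linear w H \<Longrightarrow> graded_linear w (G \<circ> H)"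
  unfolding graded_linear_def by (auto intro: Vector_Spaces.linear_compose)

lemma foliation_symmetry_compose:
  assumes "foliation_symmetry w V G" "foliation_symmetry w V H"
  shows "foliation_symmetry w V (G \<circ> H)"
proof -
  obtain \<epsilon> \<delta> where e: "\<epsilon> \<noteq> 0" "\<And>v. V (G v) = \<epsilon> *s G (V v)" "\<delta> \<noteq> 0" "\<And>v. V (H v) = \<delta> *s H (V v)"
    using assms unfolding foliation_symmetry_def by blast
  have "Vector_Spaces.linear (*s) (*s) G" using assms(1) by (simp add: foliation_symmetry_def graded_linear_def)
  then have "V ((G \<circ> H) v) = (\<epsilon> * \<delta>) *s (G \<circ> H) (V v)" for v
    using e by (simp add: Vector_Spaces.linear_iff vector_smult_assoc)
  moreover have "\<epsilon> * \<delta> \<noteq> 0" using e by simp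
  ultimately show ?thesis using assms unfolding foliation_symmetry_def
    by (blast intro: graded_linear_compose bij_comp)
qed

lemma foliation_symmetry_id: "foliation_symmetry w V id"
  by (auto simp: foliation_symmetry_def graded_linear_def Vector_Spaces.linear_iff
      vec.vector_space_axioms intro!: exI[of _ 1])

lemma foliation_symmetry_inv:
  assumes "foliation_symmetry w V G"
  shows "foliation_symmetry w V (inv_into UNIV G)"
proof -
  obtain \<epsilon> where e: "\<epsilon> \<noteq> 0" "\<And>v. V (G v) = \<epsilon> *s G (V v)"
    and lin: "Vector_Spaces.linear (*s) (*s) G" and sc: "\<And>c v. G (wscale w c v) = wscale w c (G v)"
    and b: "bij G"
    using assms unfolding foliation_symmetry_def graded_linear_def by blast
  have GG: "G (inv_into UNIV G v) = v" "inv_into UNIV G (G v) = v" for v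
    using b by (simp_all add: bij_is_surj bij_is_inj surj_f_inv_f)
  have inj: "u = v" if "G u = G v" for u v using that b by (metis bij_is_inj injD)
  have lin': "Vector_Spaces.linear (*s) (*s) (inv_into UNIV G)"
    unfolding Vector_Spaces.linear_iff
    by (intro conjI allI; (rule vec.vector_space_axioms)?; rule inj)
      (use lin in \<open>auto simp: Vector_Spaces.linear_iff GG\<close>)
  have "inv_into UNIV G (wscale w c v) = wscale w c (inv_into UNIV G v)" for c v
    by (rule inj) (simp add: sc GG)
  moreover have "V (inv_into UNIV G v) = inverse \<epsilon> *s inv_into UNIV G (V v)" for v
  proof (rule inj)
    have "V v = \<epsilon> *s G (V (inv_into UNIV G v))" using e(2)[of "inv_into UNIV G v"] by (simp add: GG)
    then have "inverse \<epsilon> *s V v = G (V (inv_into UNIV G v))" using e(1) by (simp add: vector_smult_assoc)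
    then show "G (V (inv_into UNIV G v)) = G (inverse \<epsilon> *s inv_into UNIV G (V v))"
      using lin by (simp add: Vector_Spaces.linear_iff GG)
  qed
  moreover have "inverse \<epsilon> \<noteq> 0" using e by simp
  ultimately show ?thesis unfolding foliation_symmetry_def graded_linear_def
    using lin' b bij_imp_bij_inv by blast
qed

lemma foliation_symmetry_nonzero:
  assumes "foliation_symmetry w V G" "v \<noteq> 0"
  shows "G v \<noteq> 0"
proof
  assume "G v = 0"
  moreover have "Vector_Spaces.linear (*s) (*s) G" using assms(1) by (simp add: foliation_symmetry_def graded_linear_def)
  then have "G 0 = 0" by (metis Vector_Spaces.linear_iff vector_smult_lzero)
  ultimately show False using assms unfolding foliation_symmetry_def by (metis bij_is_inj injD)
qed

lemma foliation_symmetry_hom_tuple: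
  assumes "foliation_symmetry w V G"
  shows "hom_tuple w G"
proof -
  have G: "graded_linear w G" using assms by (simp add: foliation_symmetry_def)
  have "poly_fun (\<lambda>v. G v $ i)" for i
  proof -
    have "poly_fun (\<lambda>v::complex^'a. \<Sum>j\<in>J. matrix G $ i $ j * v $ j)" if "finite J" for J
      using that by induction (simp_all add: poly_fun.intros)
    moreover have "Vector_Spaces.linear (*s) (*s) G" using G by (simp add: graded_linear_def)
    ultimately show ?thesis by (simp add: linear_component)
  qed
  moreover have "(1 :: complex ^ 'a) \<noteq> 0" by (simp add: vec_eq_iff)
  then have "\<exists>v. G v \<noteq> 0" using foliation_symmetry_nonzero[OF assms] by blast
  ultimately show ?thesis using G unfolding hom_tuple_def graded_linear_def
    by (auto intro!: exI[of _ 1])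
qed

definition map_pt :: "nat ^ 'n \<Rightarrow> (complex ^ 'n \<Rightarrow> complex ^ 'n) \<Rightarrow> (complex ^ 'n) set \<Rightarrow> (complex ^ 'n) set" where
  "map_pt w G x = wrel w `` (G ` x)"

lemma map_pt_pt:
  assumes G: "foliation_symmetry w V G" and v: "v \<noteq> 0"
  shows "map_pt w G (pt w v) = pt w (G v)"
proof -
  have "(G v, G u) \<in> wrel w" if "(v, u) \<in> wrel w" for u
    using hom_tuple_wrel[OF foliation_symmetry_hom_tuple[OF G] that] foliation_symmetry_nonzero[OF G v] by blast
  then show ?thesis unfolding map_pt_def pt_def
    using wrel_trans wrel_refl[OF v] by blast
qed

section \<open>Action of the symmetries on the leaves\<close>

locale homogeneous_field = weights w j j' for w :: "nat ^ 'n" and j j' +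
  fixes V :: "complex ^ 'n \<Rightarrow> complex ^ 'n"
  assumes hom: "\<And>c u. V (wscale w c u) = (\<chi> i. c * wscale w c (V u) $ i)"
begin

text \<open>The image of a curve under \<open>G\<close> may violate the normalisation of every
  chart, so it need not be an integral curve of a chart field. On the chart with
  \<open>v $ k = 1\<close>, however, the chart field is \<open>w $ k\<close> times \<open>V\<close>
  minus \<open>V v $ k\<close> times the Euler field. As \<open>G\<close> preserves the Euler field
  and changes \<open>V\<close> by a constant, the image curve has the form treated in
  \<open>tangent_curve_in_leaf\<close>.\<close>

lemma map_pt_leaf_rel:
  assumes G: "foliation_symmetry w V G" and xy: "(x, y) \<in> leaf_rel w V"
  shows "(map_pt w G x, map_pt w G y) \<in> (leaf_rel w V)\<^sup>*"
proof -
  obtain k D \<gamma> t t' where x: "x = pt w (\<gamma> t)" "y = pt w (\<gamma> t')" and t: "t \<in> D" "t' \<in> D"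
    and c: "integral_curve (chart_field w k V) D \<gamma>" and k: "\<And>t. t \<in> D \<Longrightarrow> \<gamma> t $ k = 1"
    using xy unfolding leaf_rel_def by blast
  have nz: "\<gamma> t \<noteq> 0" if "t \<in> D" for t using k[OF that] by auto
  obtain \<epsilon> where e: "\<epsilon> \<noteq> 0" "\<And>v. V (G v) = \<epsilon> *s G (V v)"
    and gr: "graded_linear w G" and lin: "Vector_Spaces.linear (*s) (*s) G"
    using G unfolding foliation_symmetry_def graded_linear_def by blast
  have "(pt w (G (\<gamma> t)), pt w (G (\<gamma> t'))) \<in> (leaf_rel w V)\<^sup>*"
  proof (rule tangent_curve_in_leaf[OF hom pos, where \<mu> = "\<lambda>t. G (\<gamma> t)" and D = D
        and a = "of_nat (w $ k) / \<epsilon>" and b = "\<lambda>t. - (V (\<gamma> t) $ k)"])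
    fix t i assume t: "t \<in> D"
    have "((\<lambda>t. G (\<gamma> t) $ i) has_field_derivative G (chart_field w k V (\<gamma> t)) $ i) (at t)"
      by (rule linear_derivative[OF lin]) (use c t in \<open>auto simp: integral_curve_def\<close>)
    moreover have "chart_field w k V (\<gamma> t) = of_nat (w $ k) *s V (\<gamma> t)
        + (- (V (\<gamma> t) $ k)) *s (\<chi> i. of_nat (w $ i) * \<gamma> t $ i)"
      using k[OF t] by (simp add: chart_field_def vec_eq_iff)
    then have "G (chart_field w k V (\<gamma> t)) $ i = of_nat (w $ k) * G (V (\<gamma> t)) $ i
        + (- (V (\<gamma> t) $ k)) * (of_nat (w $ i) * G (\<gamma> t) $ i)"
      using lin graded_linear_euler[OF gr, of "\<gamma> t" i]
      by (simp only: Vector_Spaces.linear_iff vector_add_component vector_smult_component)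
    ultimately show "((\<lambda>t. G (\<gamma> t) $ i) has_field_derivative
        of_nat (w $ k) / \<epsilon> * V (G (\<gamma> t)) $ i + - (V (\<gamma> t) $ k) * of_nat (w $ i) * G (\<gamma> t) $ i) (at t)"
      using e by (simp add: mult.assoc)
  qed (use c t e pos[of k] foliation_symmetry_nonzero[OF G nz] in \<open>auto simp: integral_curve_def\<close>)
  then show ?thesis using x t nz by (simp add: map_pt_pt[OF G])
qed

lemma map_pt_leaf_rel_rtrancl:
  assumes "foliation_symmetry w V G" "(x, y) \<in> (leaf_rel w V)\<^sup>*"
  shows "(map_pt w G x, map_pt w G y) \<in> (leaf_rel w V)\<^sup>*"
  using assms(2) by induction (auto intro: rtrancl_trans map_pt_leaf_rel[OF assms(1)])

text \<open>The symmetry gives one inclusion between the leaf of the image point and the image of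
  the leaf; its inverse, again a symmetry, gives the other.\<close>

lemma map_pt_image_leaf:
  assumes G: "foliation_symmetry w V G" and L: "L \<in> leaves w V"
  shows "map_pt w G ` L \<in> leaves w V"
proof -
  note G' = foliation_symmetry_inv[OF G]
  have GG: "G (inv_into UNIV G v) = v" "inv_into UNIV G (G v) = v" for v
    using G by (simp_all add: foliation_symmetry_def bij_is_surj bij_is_inj surj_f_inv_f)
  have in_wproj: "map_pt w G x \<in> wproj w" if "x \<in> wproj w" for x
    using that map_pt_pt[OF G] foliation_symmetry_nonzero[OF G] by (metis wprojE pt_in_wproj)
  have inv: "map_pt w G (map_pt w (inv_into UNIV G) x) = x" "map_pt w (inv_into UNIV G) (map_pt w G x) = x"
    if "x \<in> wproj w" for x
    using that map_pt_pt[OF G] map_pt_pt[OF G'] GG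
      foliation_symmetry_nonzero[OF G] foliation_symmetry_nonzero[OF G'] by (metis wprojE)+
  obtain x where x: "x \<in> wproj w" "L = (leaf_rel w V)\<^sup>* `` {x}"
    using L unfolding leaves_def by (auto elim: quotientE)
  have "map_pt w G ` L = (leaf_rel w V)\<^sup>* `` {map_pt w G x}"
  proof (intro equalityI subsetI)
    fix y assume "y \<in> (leaf_rel w V)\<^sup>* `` {map_pt w G x}"
    then have y: "(map_pt w G x, y) \<in> (leaf_rel w V)\<^sup>*" by simp
    then have "y \<in> wproj w" using leaf_rel_rtrancl_wproj in_wproj x(1) by blast
    moreover have "(x, map_pt w (inv_into UNIV G) y) \<in> (leaf_rel w V)\<^sup>*"
      using map_pt_leaf_rel_rtrancl[OF G' y] inv(2)[OF x(1)] by simp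
    ultimately show "y \<in> map_pt w G ` L"
      using x(2) inv(1) by (intro image_eqI[of _ _ "map_pt w (inv_into UNIV G) y"]) auto
  qed (use x map_pt_leaf_rel_rtrancl[OF G] in auto)
  then show ?thesis unfolding leaves_def using in_wproj[OF x(1)] by (auto intro: quotientI)
qed

text \<open>The image is taken over all representatives of the class. Each agrees with
  \<open>G\<close> as a map of points wherever it is nonzero, and \<open>G\<close> itself is nonzero
  on all nonzero vectors, so the image is that of the everywhere defined map
  \<open>G\<close>.\<close>

lemma rat_image_leaf:
  assumes G: "foliation_symmetry w V G" and L: "L \<in> leaves w V"
  shows "rat_image w (proj_eq w `` {G}) L \<in> leaves w V"
proof -
  have Lw: "L \<subseteq> wproj w" using L leaf_rel_rtrancl_wproj unfolding leaves_def by (fastforce elim: quotientE)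
  note hG = proj_eq_refl[OF foliation_symmetry_hom_tuple[OF G]]
  have "rat_image w (proj_eq w `` {G}) L = map_pt w G ` L"
  proof (intro equalityI subsetI)
    fix x assume "x \<in> rat_image w (proj_eq w `` {G}) L"
    then obtain F v where F: "(G, F) \<in> proj_eq w" "v \<noteq> 0" "F v \<noteq> 0" "pt w v \<in> L" "x = pt w (F v)"
      unfolding rat_image_def by blast
    have Gv: "G v \<noteq> 0" using foliation_symmetry_nonzero[OF G F(2)] .
    have "x = pt w (G v)"
      using proj_eq_imp_wrel[OF F(1) Gv F(3)] pt_eq_iff[OF Gv F(3)] F(5) by blast
    then show "x \<in> map_pt w G ` L" using F map_pt_pt[OF G] by blast
  next
    fix x assume "x \<in> map_pt w G ` L"
    then obtain y where y: "y \<in> L" "x = map_pt w G y" by blast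
    then obtain v where v: "v \<noteq> 0" "y = pt w v" using Lw wprojE by blast
    then show "x \<in> rat_image w (proj_eq w `` {G}) L"
      unfolding rat_image_def using y map_pt_pt[OF G v(1)] foliation_symmetry_nonzero[OF G v(1)] hG by blast
  qed
  then show ?thesis using map_pt_image_leaf[OF G L] by simp
qed

lemma foliation_symmetry_mod_inverse:
  assumes G: "foliation_symmetry w V G"
  shows "mod_inverse (proj_eq w) G (inv_into UNIV G)"
proof -
  have "G \<circ> inv_into UNIV G = id" "inv_into UNIV G \<circ> G = id"
    using G by (auto simp: foliation_symmetry_def fun_eq_iff bij_is_surj bij_is_inj surj_f_inv_f)
  then show ?thesis unfolding mod_inverse_def
    using foliation_symmetry_hom_tuple[OF G] foliation_symmetry_hom_tuple[OF foliation_symmetry_inv[OF G]]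
    by (simp add: proj_eq_refl hom_tuple_id)
qed

lemma generate_foliation_symmetry:
  assumes K: "\<And>B. B \<in> K \<Longrightarrow> \<exists>G. B = proj_eq w `` {G} \<and> foliation_symmetry w V G"
    and B: "B \<in> generate (Bir_wproj w) K"
  shows "\<exists>G. B = proj_eq w `` {G} \<and> foliation_symmetry w V G"
  using B
proof induction
  case one
  show ?case unfolding Bir_wproj_def proj.one_cls using foliation_symmetry_id by blast
next
  case (inv B)
  interpret group "Bir_wproj w" by (rule group_Bir_wproj)
  obtain G where G: "B = proj_eq w `` {G}" "foliation_symmetry w V G" using K[OF inv] by blast
  note m = foliation_symmetry_mod_inverse[OF G(2)]
  have "inv\<^bsub>Bir_wproj w\<^esub> B = proj_eq w `` {inv_into UNIV G}"
    using proj.mult_cls_inverse[OF m] proj.cls_in_carrier[OF m] proj.cls_in_carrier[OF proj.Inv_sym[OF m]]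
    unfolding G(1) by (intro inv_equality) (simp_all add: Bir_wproj_def)
  with foliation_symmetry_inv[OF G(2)] show ?case by blast
next
  case (eng A B)
  then obtain F G where F: "A = proj_eq w `` {F}" "foliation_symmetry w V F"
    and G: "B = proj_eq w `` {G}" "foliation_symmetry w V G" by blast
  have "A \<otimes>\<^bsub>Bir_wproj w\<^esub> B = proj_eq w `` {F \<circ> G}"
    unfolding F(1) G(1) Bir_wproj_def
    by (rule proj.mult_cls[OF proj_eq_refl[OF foliation_symmetry_hom_tuple[OF F(2)]]
          foliation_symmetry_mod_inverse[OF G(2)]])
  with foliation_symmetry_compose[OF F(2) G(2)] show ?case by blast
qed (rule K)

end

section \<open>Reduction of the Weyl group at infinity\<close>

lemma (in group) generate_involution:
  assumes "a \<in> carrier G" "a \<otimes> a = \<one>" "x \<in> generate G {a}"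
  shows "x = \<one> \<or> x = a"
proof -
  have "inv a = a" using assms by (intro inv_equality) auto
  with assms(3,1,2) show ?thesis by induction auto
qed

text \<open>A complete rewriting system for the symmetric group of degree 3 evaluates the products of
  the six normal forms.\<close>

lemma (in group) generate_S3:
  assumes ab: "a \<in> carrier G" "b \<in> carrier G" and a2: "a \<otimes> a = \<one>" and b2: "b \<otimes> b = \<one>"
    and braid: "b \<otimes> a \<otimes> b = a \<otimes> b \<otimes> a" and x: "x \<in> generate G {a, b}"
  shows "x \<in> {\<one>, a, b, a \<otimes> b, b \<otimes> a, a \<otimes> (b \<otimes> a)}"
proof -
  have inv: "inv a = a" "inv b = b" using ab a2 b2 by (auto intro: inv_equality)
  have rules: "b \<otimes> (a \<otimes> b) = a \<otimes> (b \<otimes> a)"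
    "y \<in> carrier G \<Longrightarrow> a \<otimes> (a \<otimes> y) = y" "y \<in> carrier G \<Longrightarrow> b \<otimes> (b \<otimes> y) = y"
    "y \<in> carrier G \<Longrightarrow> b \<otimes> (a \<otimes> (b \<otimes> y)) = a \<otimes> (b \<otimes> (a \<otimes> y))" for y
    using ab braid a2 b2 by (metis m_assoc m_closed l_one)+
  show ?thesis using x
  proof induction
    case (eng x y)
    then show ?case using ab by (elim insertE emptyE) (simp_all add: m_assoc rules a2 b2)
  qed (auto simp: inv)
qed

lemma (in group_hom) inj_on_generate:
  assumes "K \<subseteq> carrier G" and "\<And>x. x \<in> generate G K \<Longrightarrow> h x = \<one>\<^bsub>H\<^esub> \<Longrightarrow> x = \<one>"
  shows "inj_on h (generate G K)"
proof (rule inj_onI)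
  fix x y assume xy: "x \<in> generate G K" "y \<in> generate G K" "h x = h y"
  then have c: "x \<in> carrier G" "y \<in> carrier G" using G.generate_in_carrier[OF assms(1)] by auto
  have "x \<otimes> inv y = \<one>"
    using xy c generate.eng[OF xy(1) G.generate_m_inv_closed[OF assms(1) xy(2)]]
    by (intro assms(2)) simp_all
  then show "x = y" using c by (metis G.inv_closed G.inv_equality G.inv_inv)
qed

lemma (in group_hom) inj_on_generate_involution:
  assumes "a \<in> carrier G" "a \<otimes> a = \<one>" "h a \<noteq> \<one>\<^bsub>H\<^esub>"
  shows "inj_on h (generate G {a})"
  by (rule inj_on_generate) (use assms G.generate_involution in auto)

text \<open>The normal forms of length two are excluded from the kernel by
  \<open>h a \<noteq> h b\<close>, since \<open>h a\<close> is its own inverse. The form of length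
  three is a conjugate of \<open>b\<close>, which is not in the kernel.\<close>

lemma (in group_hom) inj_on_generate_S3:
  assumes ab: "a \<in> carrier G" "b \<in> carrier G" and a2: "a \<otimes> a = \<one>" and b2: "b \<otimes> b = \<one>"
    and braid: "b \<otimes> a \<otimes> b = a \<otimes> b \<otimes> a"
    and h: "h a \<noteq> \<one>\<^bsub>H\<^esub>" "h b \<noteq> \<one>\<^bsub>H\<^esub>" "h a \<noteq> h b"
  shows "inj_on h (generate G {a, b})"
proof (rule inj_on_generate)
  fix x assume x: "x \<in> generate G {a, b}" "h x = \<one>\<^bsub>H\<^esub>"
  have ha2: "h a \<otimes>\<^bsub>H\<^esub> h a = \<one>\<^bsub>H\<^esub>" using ab a2 by (metis hom_mult hom_one)
  have *: "h b = h a" if "h a \<otimes>\<^bsub>H\<^esub> h b = \<one>\<^bsub>H\<^esub> \<or> h b \<otimes>\<^bsub>H\<^esub> h a = \<one>\<^bsub>H\<^esub>"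
    using that ha2 ab by (metis H.inv_equality H.inv_comm hom_closed)
  have "h b = \<one>\<^bsub>H\<^esub>" if "h a \<otimes>\<^bsub>H\<^esub> (h b \<otimes>\<^bsub>H\<^esub> h a) = \<one>\<^bsub>H\<^esub>"
  proof -
    have "h b \<otimes>\<^bsub>H\<^esub> h a = h a"
      using that ha2 ab by (metis H.inv_equality H.inv_comm H.m_closed hom_closed)
    then show ?thesis using ab by (metis H.r_cancel_one' hom_closed)
  qed
  with * h have "x \<notin> {a, b, a \<otimes> b, b \<otimes> a, a \<otimes> (b \<otimes> a)}" using x(2) ab by auto
  with G.generate_S3[OF ab a2 b2 braid x(1)] show "x = \<one>" by blast
qed (use ab in simp)

lemma (in group_hom) generate_in_kernel:
  assumes "K \<subseteq> carrier G" "\<And>k. k \<in> K \<Longrightarrow> h k = \<one>\<^bsub>H\<^esub>" "x \<in> generate G K"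
  shows "h x = \<one>\<^bsub>H\<^esub>"
  using assms(3)
proof induction
  case (eng x y)
  then show ?case using G.generate_in_carrier[OF assms(1)] by simp
qed (use assms in auto)

context weighted_pair
begin

lemma reduction_at_infinity:
  fixes S P :: "(('p, 3) param_maps \<times> ('p, 4) param_maps \<times> 3 maps) set"
  assumes S: "\<And>\<sigma> \<tau> C. (\<sigma>, \<tau>, C) \<in> S \<Longrightarrow> generator_triple \<sigma> \<tau> C \<and> C = \<one>\<^bsub>Bir_wproj w3\<^esub>"
    and P: "\<And>\<sigma> \<tau> C. (\<sigma>, \<tau>, C) \<in> P \<Longrightarrow> generator_triple \<sigma> \<tau> C"
    and N: "\<And>x. x \<in> N \<Longrightarrow> x \<in> fst ` S \<or>
      (\<exists>\<pi>\<in>fst ` P. \<exists>\<sigma>\<in>fst ` S. x = \<pi> \<otimes>\<^bsub>Bir_aff\<^esub> \<sigma> \<otimes>\<^bsub>Bir_aff\<^esub> \<pi>)"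
  defines "W \<equiv> generate Bir_aff (fst ` (S \<union> P))"
  obtains ext res where "extension_hom w4 W ext" "restriction_hom w4 w3 (ext ` W) res"
    "\<And>\<sigma>. \<sigma> \<in> generate Bir_aff N \<Longrightarrow> res (ext \<sigma>) = \<one>\<^bsub>Bir_wproj w3\<^esub>"
    "res ` ext ` W = res ` ext ` generate Bir_aff (fst ` P)"
    "ext ` generate Bir_aff (fst ` P) = generate (Bir_param_wproj w4\<lparr>carrier := ext ` W\<rparr>) ((fst \<circ> snd) ` P)"
    "\<And>\<sigma> \<tau> C. (\<sigma>, \<tau>, C) \<in> P \<Longrightarrow> \<tau> \<in> ext ` W \<and> res \<tau> = C"
    "res ` ext ` generate Bir_aff (fst ` P) = generate (Bir_wproj w3) ((snd \<circ> snd) ` P)"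
proof -
  interpret A: group "Bir_aff :: ('p, 3) param_maps monoid" by (rule group_Bir_aff)
  interpret PP: group "Bir_param_wproj w4 :: ('p, 4) param_maps monoid" by (rule w4.group_Bir_param_wproj)
  interpret Q: group "Bir_wproj w3" by (rule w3.group_Bir_wproj)
  have triple: "generator_triple \<sigma> \<tau> C" if "(\<sigma>, \<tau>, C) \<in> S \<union> P" for \<sigma> \<tau> C using that S P by blast
  obtain ext res where ext: "extension_hom w4 W ext" and res: "restriction_hom w4 w3 (ext ` W) res"
    and er: "\<And>\<sigma> \<tau> C. (\<sigma>, \<tau>, C) \<in> S \<union> P \<Longrightarrow> ext \<sigma> = \<tau> \<and> res \<tau> = C"
    unfolding W_def using extension_and_restriction[OF triple] by blast
  have erk: "ext (fst k) = fst (snd k)" "res (fst (snd k)) = snd (snd k)"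
    "generator_triple (fst k) (fst (snd k)) (snd (snd k))" if "k \<in> S \<union> P" for k
    using er[of "fst k" "fst (snd k)" "snd (snd k)"] triple that by auto
  have KA: "fst ` (S \<union> P) \<subseteq> carrier Bir_aff"
    by (rule image_subsetI) (use erk(3) in \<open>simp add: generator_triple_def\<close>)
  have sW: "subgroup W Bir_aff" unfolding W_def by (rule A.generate_is_subgroup[OF KA])
  have KW: "fst ` (S \<union> P) \<subseteq> W" unfolding W_def by (auto intro: generate.incl)
  interpret e: group_hom "Bir_aff\<lparr>carrier := W\<rparr>" "Bir_param_wproj w4" ext
    using ext by (simp add: extension_hom_def)
  interpret r: group_hom "Bir_param_wproj w4\<lparr>carrier := ext ` W\<rparr>" "Bir_wproj w3" res
    using res by (simp add: restriction_hom_def)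
  have "res \<circ> ext \<in> hom (Bir_aff\<lparr>carrier := W\<rparr>) (Bir_wproj w3)"
    using e.homh r.homh by (auto simp: hom_def Pi_def)
  then interpret h: group_hom "Bir_aff\<lparr>carrier := W\<rparr>" "Bir_wproj w3" "res \<circ> ext"
    by (simp add: group_hom_def group_hom_axioms_def e.is_group w3.group_Bir_wproj)
  have hS: "(res \<circ> ext) \<sigma> = \<one>\<^bsub>Bir_wproj w3\<^esub>" if \<sigma>: "\<sigma> \<in> fst ` S" for \<sigma>
  proof -
    obtain k where "k \<in> S" "\<sigma> = fst k" using \<sigma> by blast
    then show ?thesis using erk(1,2)[of k] S[of "fst k" "fst (snd k)" "snd (snd k)"] by simp
  qed
  \<comment> \<open>In \<open>Bir_aff\<close> the square of \<pi> may differ from one. Its extension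
    is an involution, which is enough to make the conjugated reflections trivial at
    infinity.\<close>
  have hP: "(res \<circ> ext) \<pi> \<otimes>\<^bsub>Bir_wproj w3\<^esub> (res \<circ> ext) \<pi> = \<one>\<^bsub>Bir_wproj w3\<^esub>" if \<pi>: "\<pi> \<in> fst ` P" for \<pi>
  proof -
    obtain k where k: "k \<in> P" "\<pi> = fst k" using \<pi> by blast
    define \<tau> where "\<tau> = fst (snd k)"
    have "ext \<pi> = \<tau>" "\<tau> \<otimes>\<^bsub>Bir_param_wproj w4\<^esub> \<tau> = \<one>\<^bsub>Bir_param_wproj w4\<^esub>"
      using erk(1,3)[of k] k by (simp_all add: generator_triple_def \<tau>_def)
    moreover have "\<pi> \<in> W" using k KW by blast
    ultimately show ?thesis using r.hom_mult[of \<tau> \<tau>] r.hom_one by auto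
  qed
  have NW: "N \<subseteq> W"
  proof
    fix x assume "x \<in> N"
    moreover have "\<sigma> \<in> W" if "\<sigma> \<in> fst ` S \<union> fst ` P" for \<sigma> using KW that by (simp only: image_Un) blast
    ultimately show "x \<in> W" using subgroup.m_closed[OF sW] N by (metis UnI1 UnI2)
  qed
  have hN: "(res \<circ> ext) x = \<one>\<^bsub>Bir_wproj w3\<^esub>" if x: "x \<in> N" for x
  proof -
    consider "x \<in> fst ` S" | \<pi> \<sigma> where "\<pi> \<in> fst ` P" "\<sigma> \<in> fst ` S" "x = \<pi> \<otimes>\<^bsub>Bir_aff\<^esub> \<sigma> \<otimes>\<^bsub>Bir_aff\<^esub> \<pi>"
      using N[OF x] by blast
    then show ?thesis
    proof cases
      case (2 \<pi> \<sigma>)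
      then have m: "\<pi> \<in> W" "\<sigma> \<in> W" using KW by auto
      then have "(res \<circ> ext) x = (res \<circ> ext) \<pi> \<otimes>\<^bsub>Bir_wproj w3\<^esub> (res \<circ> ext) \<sigma> \<otimes>\<^bsub>Bir_wproj w3\<^esub> (res \<circ> ext) \<pi>"
        using h.hom_mult[of \<pi> \<sigma>] h.hom_mult[of "\<pi> \<otimes>\<^bsub>Bir_aff\<^esub> \<sigma>" \<pi>] subgroup.m_closed[OF sW m] 2(3)
        by simp
      also have "\<dots> = \<one>\<^bsub>Bir_wproj w3\<^esub>"
        using hS[OF 2(2)] hP[OF 2(1)] h.hom_closed[of \<pi>] m by simp
      finally show ?thesis .
    qed (rule hS)
  qed
  have PW: "fst ` P \<subseteq> W" using KW by blast
  have genP: "generate Bir_aff (fst ` P) = generate (Bir_aff\<lparr>carrier := W\<rparr>) (fst ` P)"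
    by (rule A.generate_consistent[OF PW sW, symmetric])
  have erP: "ext (fst k) = fst (snd k)" "res (fst (snd k)) = snd (snd k)" if "k \<in> P" for k
    using erk(1,2) that by blast+
  show ?thesis
  proof (rule that[OF ext res])
    show "res (ext \<sigma>) = \<one>\<^bsub>Bir_wproj w3\<^esub>" if "\<sigma> \<in> generate Bir_aff N" for \<sigma>
      using h.generate_in_kernel[of N \<sigma>] NW hN that A.generate_consistent[OF NW sW] by simp
    have img: "(res \<circ> ext) ` generate Bir_aff (fst ` P) = generate (Bir_wproj w3) ((res \<circ> ext) ` fst ` P)"
      unfolding genP using h.generate_img[of "fst ` P"] PW by simp
    have "(res \<circ> ext) ` fst ` P = (snd \<circ> snd) ` P"
      by (simp add: image_image erP cong: image_cong_simp)
    with img show 1: "res ` ext ` generate Bir_aff (fst ` P) = generate (Bir_wproj w3) ((snd \<circ> snd) ` P)"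
      by (simp add: image_comp)
    have "(res \<circ> ext) ` W = generate (Bir_wproj w3) ((res \<circ> ext) ` fst ` (S \<union> P))"
      using h.generate_img[of "fst ` (S \<union> P)"] KW A.generate_consistent[OF KW sW] by (simp add: W_def)
    also have "\<dots> \<subseteq> generate (Bir_wproj w3) ((res \<circ> ext) ` fst ` P)"
    proof (rule Q.generate_subgroup_incl)
      have "(res \<circ> ext) ` fst ` P \<subseteq> carrier (Bir_wproj w3)"
        using h.hom_closed PW by auto
      then show "subgroup (generate (Bir_wproj w3) ((res \<circ> ext) ` fst ` P)) (Bir_wproj w3)"
        by (rule Q.generate_is_subgroup)
      show "(res \<circ> ext) ` fst ` (S \<union> P) \<subseteq> generate (Bir_wproj w3) ((res \<circ> ext) ` fst ` P)"
        unfolding image_Un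
      proof (intro Un_least)
        show "(res \<circ> ext) ` fst ` S \<subseteq> generate (Bir_wproj w3) ((res \<circ> ext) ` fst ` P)"
          by (rule image_subsetI) (simp only: hS generate.one)
      qed (rule subsetI, rule generate.incl)
    qed
    finally have "(res \<circ> ext) ` W \<subseteq> (res \<circ> ext) ` generate Bir_aff (fst ` P)" unfolding img .
    moreover have "generate Bir_aff (fst ` P) \<subseteq> W" by (rule A.generate_subgroup_incl[OF PW sW])
    ultimately show "res ` ext ` W = res ` ext ` generate Bir_aff (fst ` P)"
      by (simp add: image_comp) blast
    have "ext ` fst ` P = (fst \<circ> snd) ` P"
      by (simp add: image_image erP cong: image_cong_simp)
    moreover have "subgroup (ext ` W) (Bir_param_wproj w4)"
      using e.img_is_subgroup by simp
    moreover have "ext ` fst ` P \<subseteq> ext ` W" using PW by blast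
    ultimately show "ext ` generate Bir_aff (fst ` P)
        = generate (Bir_param_wproj w4\<lparr>carrier := ext ` W\<rparr>) ((fst \<circ> snd) ` P)"
      unfolding genP using e.generate_img[of "fst ` P"] PW PP.generate_consistent by simp
    show "\<tau> \<in> ext ` W \<and> res \<tau> = C" if "(\<sigma>, \<tau>, C) \<in> P" for \<sigma> \<tau> C
      using erP[OF that] imageI[OF that, of fst] PW by (auto intro!: image_eqI[of _ _ \<sigma>])
  qed
qed

end

text \<open>The scalars \<open>c\<close> and \<open>d\<close> account for the difference between a
  map of the chart and its tuple. They are 1 for \<pi>, while for the automorphisms of the fourth
  equation they are -i for the map and i for its inverse.\<close>

lemma (in weighted_pair) linear_generator_tripleI:
  fixes \<phi> :: "'p \<Rightarrow> 'p"
  assumes \<phi>: "\<And>a. \<phi> (\<phi> a) = a" and "rational_map f" "rational_map g"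
    and fg: "\<And>v. g (f v) = v" "\<And>v. f (g v) = v"
    and F: "hom_tuple w4 F" "\<And>v. F (F v) = v"
    and Ff: "\<And>v. F (app4 v 1) = wscale w4 c (app4 (f v) 1)" "c \<noteq> 0"
    and Fg: "\<And>v. F (app4 v 1) = wscale w4 d (app4 (g v) 1)" "d \<noteq> 0"
    and G: "hom_tuple w3 G" "\<And>u. G (G u) = u" and FG: "\<And>u. F (app4 u 0) = app4 (G u) 0"
  shows "generator_triple (\<phi>, \<lambda>_. aff_eq `` {f}) (\<phi>, \<lambda>_. proj_eq w4 `` {F}) (proj_eq w3 `` {G})"
proof (rule generator_tripleI[where g = "\<lambda>_. g"])
  show "generically (\<lambda>v. (F (F v), v) \<in> wrel w4)" "generically (\<lambda>u. (G (G u), u) \<in> wrel w3)"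
    unfolding F(2) G(2)
    by (rule generically_mono[OF hom_tuple_nonzero[OF hom_tuple_id]]; simp add: wrel_refl)+
  show "generically (\<lambda>v. (F (app4 v 1), app4 (f v) 1) \<in> wrel w4)" unfolding Ff(1)
    by (rule generically_True) (simp add: wrel_wscale' app4_eq_0_iff Ff(2))
  show "generically (\<lambda>v. (F (app4 v 1), app4 (g v) 1) \<in> wrel w4)" unfolding Fg(1)
    by (rule generically_True) (simp add: wrel_wscale' app4_eq_0_iff Fg(2))
  show "generically (\<lambda>u. (F (app4 u 0), app4 (G u) 0) \<in> wrel w4)" unfolding FG
    by (rule generically_mono[OF hom_tuple_nonzero[OF G(1)]]) (simp add: wrel_refl app4_eq_0_iff)
qed (use assms in \<open>simp_all add: generically_True\<close>)

text \<open>Equivalent tuples agree wherever both are nonzero, so one point separates the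
  classes.\<close>

lemma (in weights) proj_eq_class_neq:
  assumes "hom_tuple w F" "F v \<noteq> 0" "G v \<noteq> 0" "(F v, G v) \<notin> wrel w"
  shows "proj_eq w `` {F} \<noteq> proj_eq w `` {G}"
  using proj.cls_eq_iff[OF proj_eq_refl[OF assms(1)]] proj_eq_imp_wrel assms(2-4) by blast

lemma (in homogeneous_field) rat_image_leaf_generate:
  assumes "\<And>B. B \<in> K \<Longrightarrow> \<exists>G. B = proj_eq w `` {G} \<and> foliation_symmetry w V G"
    and "B \<in> generate (Bir_wproj w) K" "L \<in> leaves w V"
  shows "rat_image w B L \<in> leaves w V"
  using generate_foliation_symmetry[OF assms(1,2)] rat_image_leaf[OF _ assms(3)] by blast

section \<open>The second Painleve equation\<close>

text \<open>In both spaces the coordinate of weight 1 is y, of index 2; index 1 serves as the second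
  one.\<close>

interpretation PII: weighted_pair 2 1 2 3 2 1 2 1
proof -
  have "\<forall>i. PII_wt4 $ i > 0" "\<forall>i. PII_wt3 $ i > 0" by (simp_all add: forall_4 forall_3 coord_defs)
  then show "weighted_pair 2 1 2 3 2 1 2 1" by unfold_locales (simp_all add: coord_defs)
qed

section \<open>The reflection s_1 of the second equation\<close>

definition PII_s1_denom :: "complex ^ 4 \<Rightarrow> complex" where
  "PII_s1_denom v = v $ 2 ^ 2 - v $ 1 + v $ 3 / 2"

text \<open>With \<open>a\<close> = \<alpha> - 1/2 and \<open>f\<close> of weight 2, the homogenised
  map is [x + 2 a \<epsilon> y/f + (a \<epsilon>/f)^2, y + a \<epsilon>/f, z, \<epsilon>]. The tuple
  is its multiple by the scalar \<open>f\<close> with the weights 2, 1, 2, 3.\<close>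

definition PII_s1_hom :: "complex \<Rightarrow> complex ^ 4 \<Rightarrow> complex ^ 4" where
  "PII_s1_hom a v = (let f = PII_s1_denom v; e = v $ 4 in
     vector [f ^ 2 * v $ 1 + 2 * a * e * v $ 2 * f + a ^ 2 * e ^ 2, f * v $ 2 + a * e,
             f ^ 2 * v $ 3, f ^ 3 * e])"

lemma PII_s1_hom_simps:
  "PII_s1_hom a v $ 1 = PII_s1_denom v ^ 2 * v $ 1 + 2 * a * v $ 4 * v $ 2 * PII_s1_denom v + a ^ 2 * v $ 4 ^ 2"
  "PII_s1_hom a v $ 2 = PII_s1_denom v * v $ 2 + a * v $ 4"
  "PII_s1_hom a v $ 3 = PII_s1_denom v ^ 2 * v $ 3"
  "PII_s1_hom a v $ 4 = PII_s1_denom v ^ 3 * v $ 4"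
  by (simp_all add: PII_s1_hom_def Let_def vector_4)

lemma poly_fun_PII_s1_denom: "poly_fun PII_s1_denom"
  unfolding PII_s1_denom_def[abs_def] by (intro poly_fun_intros poly_fun_divide)

lemma PII_s1_denom_wscale: "PII_s1_denom (wscale PII_wt4 c v) = c ^ 2 * PII_s1_denom v"
  by (simp add: PII_s1_denom_def wscale_def coord_defs algebra_simps)

text \<open>Before scaling, the map shifts y by t = a \<epsilon>/f and x by 2 t y + t^2, so y^2 - x
  and hence \<open>f\<close> are unchanged. Scaling by \<open>f\<close> multiplies this form of
  weight 2 by \<open>f ^ 2\<close>.\<close>

lemma PII_s1_denom_invariant: "PII_s1_denom (PII_s1_hom a v) = PII_s1_denom v ^ 3"
proof -
  have "PII_s1_denom (PII_s1_hom a v) = PII_s1_denom v ^ 2 * (v $ 2 ^ 2 - v $ 1 + v $ 3 / 2)"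
    unfolding PII_s1_denom_def[of "PII_s1_hom a v"] PII_s1_hom_simps
    by (simp add: algebra_simps power2_eq_square)
  then show ?thesis
    unfolding PII_s1_denom_def[of v, symmetric] by (simp add: power2_eq_square power3_eq_cube)
qed

text \<open>The shifts by \<open>a\<close> and \<open>- a\<close> cancel. The inner tuple
  contributes the scalar \<open>f\<close> and the outer one the value \<open>f ^ 3\<close> of the
  form at the image, together \<open>f ^ 4\<close>.\<close>

lemma PII_s1_hom_involution:
  "PII_s1_hom (- a) (PII_s1_hom a v) = wscale PII_wt4 (PII_s1_denom v ^ 4) v"
  unfolding vec_eq_iff forall_4 PII_s1_hom_simps(1-4)[of "- a"] PII_s1_denom_invariant
  unfolding PII_s1_hom_simps by (simp add: wscale_def coord_defs algebra_simps eval_nat_numeral)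

lemma hom_tuple_PII_s1: "hom_tuple PII_wt4 (PII_s1_hom a)"
proof -
  \<comment> \<open>The degree 3 is one for the coordinates themselves plus two for the scalar
    \<open>f\<close> of weight 2.\<close>
  have "PII_s1_hom a (wscale PII_wt4 c v) = wscale PII_wt4 (c ^ 3) (PII_s1_hom a v)" for c v
    unfolding vec_eq_iff forall_4 PII_s1_hom_simps PII_s1_denom_wscale
    by (simp add: wscale_def coord_defs PII_s1_hom_simps algebra_simps eval_nat_numeral)
  moreover have "PII_s1_hom a (vector [0, 1, 0, 0]) $ 2 \<noteq> 0"
    by (simp add: PII_s1_hom_simps PII_s1_denom_def vector_4)
  then have "\<exists>v. PII_s1_hom a v \<noteq> 0" by (metis zero_index)
  moreover have "\<forall>i. poly_fun (\<lambda>v. PII_s1_hom a v $ i)"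
    unfolding forall_4 PII_s1_hom_simps by (intro conjI poly_fun_intros poly_fun_PII_s1_denom)
  ultimately show ?thesis unfolding hom_tuple_def by blast
qed

lemma PII_s1_denom_app4: "PII_s1_denom (app4 v e) = v $ 2 ^ 2 - v $ 1 + v $ 3 / 2"
  by (simp add: PII_s1_denom_def coord_defs)

lemma generically_PII_s1_denom:
  "generically (\<lambda>v. PII_s1_denom v \<noteq> 0)" "generically (\<lambda>v. PII_s1_denom (app4 v e) \<noteq> 0)"
proof -
  have "PII_s1_denom (vector [0, 1, 0, 0]) \<noteq> 0" by (simp add: PII_s1_denom_def vector_4)
  then show "generically (\<lambda>v. PII_s1_denom v \<noteq> 0)"
    using poly_fun_PII_s1_denom by (intro generically_nonzero) auto
  have "PII_s1_denom (app4 (vector [0, 1, 0]) e) \<noteq> 0" by (simp add: PII_s1_denom_app4 vector_3)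
  moreover have "poly_fun (\<lambda>v. PII_s1_denom (app4 v e))"
    unfolding PII_s1_denom_app4 by (intro poly_fun_intros poly_fun_divide)
  ultimately show "generically (\<lambda>v. PII_s1_denom (app4 v e) \<noteq> 0)"
    by (intro generically_nonzero) auto
qed

lemma PII_s1_generator:
  "PII.generator_triple A1_s1 (\<lambda>\<alpha>. - \<alpha> + 1, \<lambda>\<alpha>. proj_eq PII_wt4 `` {PII_s1_hom (\<alpha> - 1 / 2)})
     \<one>\<^bsub>Bir_wproj PII_wt3\<^esub>"
proof -
  define f :: "complex \<Rightarrow> complex ^ 3 \<Rightarrow> complex ^ 3" where "f = (\<lambda>\<alpha> v.
     let x = v $ 1; y = v $ 2; z = v $ 3; f = y ^ 2 - x + z / 2 in
     vector [x + (2 * \<alpha> - 1) * y / f + (\<alpha> - 1 / 2) ^ 2 / f ^ 2, y + (\<alpha> - 1 / 2) / f, z])"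
  define Q where "Q = (\<lambda>v :: complex ^ 3. PII_s1_denom (app4 v 1))"
  have f: "f \<alpha> v $ 1 = v $ 1 + 2 * ((\<alpha> - 1 / 2) / Q v) * v $ 2 + ((\<alpha> - 1 / 2) / Q v) ^ 2"
    "f \<alpha> v $ 2 = v $ 2 + (\<alpha> - 1 / 2) / Q v" "f \<alpha> v $ 3 = v $ 3" for \<alpha> v
  proof -
    have "2 * \<alpha> - 1 = 2 * (\<alpha> - 1 / 2)" by simp
    moreover have "f \<alpha> v $ 1 = v $ 1 + (2 * \<alpha> - 1) * v $ 2 / Q v + (\<alpha> - 1 / 2) ^ 2 / Q v ^ 2"
      by (simp add: f_def Q_def PII_s1_denom_app4 vector_3 Let_def)
    ultimately show "f \<alpha> v $ 1 = v $ 1 + 2 * ((\<alpha> - 1 / 2) / Q v) * v $ 2 + ((\<alpha> - 1 / 2) / Q v) ^ 2"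
      by (simp only: power_divide times_divide_eq_right times_divide_eq_left)
  qed (simp_all add: f_def Q_def PII_s1_denom_app4 vector_3 Let_def)
  have Qf: "Q (f \<alpha> v) = Q v" for \<alpha> v
    unfolding Q_def PII_s1_denom_app4 f by (simp add: algebra_simps power2_eq_square)
  have ff: "f (- \<alpha> + 1) (f \<alpha> v) = v" for \<alpha> v
  proof -
    \<comment> \<open>The parameter map is the reflection at 1/2, so the shift changes sign while
      \<open>Q\<close> is invariant.\<close>
    have "(- \<alpha> + 1 - 1 / 2) / Q v = - ((\<alpha> - 1 / 2) / Q v)"
    proof -
      have "- \<alpha> + 1 - 1 / 2 = - (\<alpha> - 1 / 2)" by simp
      then show ?thesis by (simp only: minus_divide_left)
    qed
    then show ?thesis
      unfolding vec_eq_iff forall_3 f(1-3)[of "- \<alpha> + 1"] Qf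
      unfolding f by (simp add: algebra_simps power2_eq_square)
  qed
  have rat: "rational_map (f \<alpha>)" for \<alpha>
    unfolding rational_map_iff forall_3 f unfolding Q_def PII_s1_denom_app4
    by (intro conjI rat_fun_intros)
  have Ff: "generically (\<lambda>v. (PII_s1_hom (\<alpha> - 1 / 2) (app4 v 1), app4 (f \<alpha> v) 1) \<in> wrel PII_wt4)" for \<alpha>
  proof (rule generically_mono[OF generically_PII_s1_denom(2)[of 1]])
    fix v :: "complex ^ 3" assume "PII_s1_denom (app4 v 1) \<noteq> 0"
    then have Q: "Q v \<noteq> 0" by (simp add: Q_def)
    have Qv: "PII_s1_denom (app4 v 1) = Q v" by (simp add: Q_def)
    define b where "b = \<alpha> - 1 / 2"
    have "PII_s1_hom (\<alpha> - 1 / 2) (app4 v 1) = wscale PII_wt4 (Q v) (app4 (f \<alpha> v) 1)"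
      using Q unfolding vec_eq_iff forall_4 PII_s1_hom_simps Qv b_def[symmetric]
      by (simp add: wscale_def coord_defs f[of \<alpha>, folded b_def] field_simps power2_eq_square)
    with Q show "(PII_s1_hom (\<alpha> - 1 / 2) (app4 v 1), app4 (f \<alpha> v) 1) \<in> wrel PII_wt4"
      by (simp add: wrel_wscale' app4_eq_0_iff)
  qed
  have "PII.generator_triple (\<lambda>\<alpha>. - \<alpha> + 1, \<lambda>\<alpha>. aff_eq `` {f \<alpha>})
     (\<lambda>\<alpha>. - \<alpha> + 1, \<lambda>\<alpha>. proj_eq PII_wt4 `` {PII_s1_hom (\<alpha> - 1 / 2)}) (proj_eq PII_wt3 `` {id})"
  \<comment> \<open>The reflection is an involution already on the affine chart, so \<open>f\<close>
    takes the place of \<open>g\<close> as well.\<close>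
  proof (rule PII.generator_tripleI[OF _ rat rat _ _ _ _ Ff Ff])
    fix \<alpha> :: complex
    show "- (- \<alpha> + 1) + 1 = \<alpha>" by simp
    show "generically (\<lambda>v. f (- \<alpha> + 1) (f \<alpha> v) = v)" "generically (\<lambda>v. f (- \<alpha> + 1) (f \<alpha> v) = v)"
      by (simp_all only: ff generically_True)
    show "hom_tuple PII_wt4 (PII_s1_hom (\<alpha> - 1 / 2))" by (rule hom_tuple_PII_s1)
    show "generically (\<lambda>v. (PII_s1_hom (- \<alpha> + 1 - 1 / 2) (PII_s1_hom (\<alpha> - 1 / 2) v), v) \<in> wrel PII_wt4)"
    proof (rule generically_mono[OF generically_PII_s1_denom(1)])
      fix v assume Q: "PII_s1_denom v \<noteq> 0"
      then have "v \<noteq> 0" by (auto simp: PII_s1_denom_def)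
      moreover have "- \<alpha> + 1 - 1 / 2 = - (\<alpha> - 1 / 2)" by (simp add: field_simps)
      ultimately show "(PII_s1_hom (- \<alpha> + 1 - 1 / 2) (PII_s1_hom (\<alpha> - 1 / 2) v), v) \<in> wrel PII_wt4"
        using Q by (simp only: PII_s1_hom_involution) (simp add: wrel_wscale')
    qed
    show "generically (\<lambda>u. (PII_s1_hom (\<alpha> - 1 / 2) (app4 u 0), app4 (id u) 0) \<in> wrel PII_wt4)"
    proof (rule generically_mono[OF generically_PII_s1_denom(2)[of 0]])
      fix u :: "complex ^ 3" assume Q: "PII_s1_denom (app4 u 0) \<noteq> 0"
      then have "u \<noteq> 0" by (auto simp: PII_s1_denom_app4)
      moreover have "PII_s1_hom (\<alpha> - 1 / 2) (app4 u 0) = wscale PII_wt4 (PII_s1_denom (app4 u 0)) (app4 u 0)"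
        unfolding vec_eq_iff forall_4 PII_s1_hom_simps by (simp add: wscale_def coord_defs)
      ultimately show "(PII_s1_hom (\<alpha> - 1 / 2) (app4 u 0), app4 (id u) 0) \<in> wrel PII_wt4"
        using Q by (simp add: wrel_wscale' app4_eq_0_iff)
    qed
  next
    show "hom_tuple PII_wt3 id" by (rule hom_tuple_id)
    show "generically (\<lambda>u. (id (id u), u) \<in> wrel PII_wt3)"
      by (rule generically_mono[OF hom_tuple_nonzero[OF hom_tuple_id]]) (simp add: wrel_refl)
  qed
  then show ?thesis unfolding A1_s1_def f_def Bir_wproj_def PII.w3.proj.one_cls .
qed

section \<open>The automorphism \<pi> of the second equation\<close>

definition PII_pi_hom :: "complex ^ 4 \<Rightarrow> complex ^ 4" where
  "PII_pi_hom v = vector [- v $ 1, - v $ 2, v $ 3, v $ 4]"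

definition PII_pi_infinity :: "complex ^ 3 \<Rightarrow> complex ^ 3" where
  "PII_pi_infinity v = vector [- v $ 1, - v $ 2, v $ 3]"

interpretation PII_field: homogeneous_field PII_wt3 2 1 "at_infinity_set (PII_hom \<alpha>)"
  by unfold_locales (simp add: at_infinity_set_def PII_hom_def wscale_def Let_def vec_eq_iff forall_3
      coord_defs power2_eq_square power3_eq_cube algebra_simps)

lemma PII_pi_symmetry: "foliation_symmetry PII_wt3 (at_infinity_set (PII_hom \<alpha>)) PII_pi_infinity"
proof -
  have "PII_pi_infinity (PII_pi_infinity v) = v" for v
    by (simp add: PII_pi_infinity_def vec_eq_iff forall_3 vector_3)
  then have "bij PII_pi_infinity" by (rule involuntory_imp_bij)
  moreover have "graded_linear PII_wt3 PII_pi_infinity"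
    by (simp add: graded_linear_def Vector_Spaces.linear_iff vec.vector_space_axioms
        PII_pi_infinity_def wscale_def vec_eq_iff forall_3 coord_defs)
  moreover have "at_infinity_set (PII_hom \<alpha>) (PII_pi_infinity v)
      = 1 *s PII_pi_infinity (at_infinity_set (PII_hom \<alpha>) v)" for v
    by (simp add: PII_pi_infinity_def at_infinity_set_def PII_hom_def Let_def vec_eq_iff forall_3 coord_defs)
  ultimately show ?thesis unfolding foliation_symmetry_def by (metis zero_neq_one)
qed

lemma PII_pi_generator:
  "PII.generator_triple A1_pi (\<lambda>\<alpha>. - \<alpha>, \<lambda>_. proj_eq PII_wt4 `` {PII_pi_hom}) (proj_eq PII_wt3 `` {PII_pi_infinity})"
  unfolding A1_pi_def
proof (rule PII.linear_generator_tripleI)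
  let ?f = "\<lambda>v :: complex ^ 3. vector [- v $ 1, - v $ 2, v $ 3] :: complex ^ 3"
  show "rational_map ?f" "rational_map ?f"
    unfolding rational_map_iff forall_3 vector_3 by (intro conjI rat_fun_intros)+
  show "?f (?f v) = v" "?f (?f v) = v" for v
    by (simp_all add: vec_eq_iff forall_3 vector_3)
  have "PII_pi_hom (vector [0, 1, 0, 0]) $ 2 \<noteq> 0" by (simp add: PII_pi_hom_def vector_4)
  then have "\<exists>v. PII_pi_hom v \<noteq> 0" by (metis zero_index)
  moreover have "\<forall>i. poly_fun (\<lambda>v. PII_pi_hom v $ i)"
    unfolding forall_4 PII_pi_hom_def vector_4 by (intro conjI poly_fun_intros)
  moreover have "PII_pi_hom (wscale PII_wt4 c v) = wscale PII_wt4 (c ^ 1) (PII_pi_hom v)" for c v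
    by (simp add: PII_pi_hom_def wscale_def vec_eq_iff forall_4 coord_defs)
  ultimately show "hom_tuple PII_wt4 PII_pi_hom" unfolding hom_tuple_def by blast
  show "PII_pi_hom (app4 v 1) = wscale PII_wt4 1 (app4 (?f v) 1)"
    "PII_pi_hom (app4 v 1) = wscale PII_wt4 1 (app4 (?f v) 1)" for v
    by (simp_all add: PII_pi_hom_def wscale_1 vec_eq_iff forall_4 coord_defs)
  show "hom_tuple PII_wt3 PII_pi_infinity" by (rule foliation_symmetry_hom_tuple[OF PII_pi_symmetry])
qed (simp_all add: PII_pi_hom_def PII_pi_infinity_def vec_eq_iff forall_4 forall_3 coord_defs)

section \<open>The fourth Painleve equation\<close>

interpretation PIV: weighted_pair 1 1 1 2 1 2 1 2
proof -
  have "\<forall>i. PIV_wt4 $ i > 0" "\<forall>i. PIV_wt3 $ i > 0" by (simp_all add: forall_4 forall_3 coord_defs)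
  then show "weighted_pair 1 1 1 2 1 2 1 2" by unfold_locales (simp_all add: coord_defs)
qed

text \<open>The three generators of the Weyl group are of one shape: they translate \<open>(x, y)\<close> by a multiple
  of a vector \<open>p\<close> divided by a linear form \<open>l\<close> that vanishes on \<open>p\<close>, hence is invariant.\<close>

definition linear_form :: "complex ^ 3 \<Rightarrow> complex ^ 4 \<Rightarrow> complex" where
  "linear_form l v = l $ 1 * v $ 1 + l $ 2 * v $ 2 + l $ 3 * v $ 3"

text \<open>The translation of (x, y) by a \<epsilon>/f times \<open>p\<close>, multiplied by the
  scalar \<open>f\<close> with the weights 1, 1, 1, 2.\<close>

definition PIV_reflection_hom :: "complex ^ 3 \<Rightarrow> complex ^ 2 \<Rightarrow> complex \<Rightarrow> complex ^ 4 \<Rightarrow> complex ^ 4" where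
  "PIV_reflection_hom l p a v = (let f = linear_form l v; e = v $ 4 in
     vector [v $ 1 * f + p $ 1 * a * e, v $ 2 * f + p $ 2 * a * e, v $ 3 * f, f ^ 2 * e])"

lemma PIV_reflection_hom_simps:
  "PIV_reflection_hom l p a v $ 1 = v $ 1 * linear_form l v + p $ 1 * a * v $ 4"
  "PIV_reflection_hom l p a v $ 2 = v $ 2 * linear_form l v + p $ 2 * a * v $ 4"
  "PIV_reflection_hom l p a v $ 3 = v $ 3 * linear_form l v"
  "PIV_reflection_hom l p a v $ 4 = linear_form l v ^ 2 * v $ 4"
  by (simp_all add: PIV_reflection_hom_def Let_def vector_4)

lemma poly_fun_linear_form: "poly_fun (linear_form l)"
  unfolding linear_form_def[abs_def] by (intro poly_fun_intros)

lemma linear_form_wscale: "linear_form l (wscale PIV_wt4 c v) = c * linear_form l v"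
  by (simp add: linear_form_def wscale_def coord_defs algebra_simps)

lemma linear_form_app4: "linear_form l (app4 v e) = l $ 1 * v $ 1 + l $ 2 * v $ 2 + l $ 3 * v $ 3"
  by (simp add: linear_form_def coord_defs)

lemma generically_linear_form:
  assumes "l \<noteq> 0"
  shows "generically (\<lambda>v. linear_form l v \<noteq> 0)" "generically (\<lambda>v. linear_form l (app4 v e) \<noteq> 0)"
proof -
  have "linear_form l (app4 (axis i 1) e) = l $ i" for i
    using exhaust_3[of i] by (auto simp: linear_form_app4 axis_def)
  then obtain v where v: "linear_form l (app4 v e) \<noteq> 0" using assms by (metis vec_eq_iff zero_index)
  then show "generically (\<lambda>v. linear_form l v \<noteq> 0)"
    by (intro generically_nonzero poly_fun_linear_form) blast
  have "poly_fun (\<lambda>v. linear_form l (app4 v e))" unfolding linear_form_app4 by (intro poly_fun_intros)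
  then show "generically (\<lambda>v. linear_form l (app4 v e) \<noteq> 0)"
    using v by (rule genericallyI)
qed

lemma hom_tuple_PIV_reflection:
  assumes "l \<noteq> 0"
  shows "hom_tuple PIV_wt4 (PIV_reflection_hom l p a)"
proof -
  have "PIV_reflection_hom l p a (wscale PIV_wt4 c v) = wscale PIV_wt4 (c ^ 2) (PIV_reflection_hom l p a v)" for c v
    unfolding vec_eq_iff forall_4 PIV_reflection_hom_simps linear_form_wscale
    by (simp add: wscale_def coord_defs PIV_reflection_hom_simps algebra_simps power2_eq_square)
  moreover obtain v where "linear_form l (app4 v 1) \<noteq> 0"
    using generically_ex[OF generically_linear_form(2)[OF assms]] by blast
  then have "PIV_reflection_hom l p a (app4 v 1) $ 4 \<noteq> 0"
    by (simp add: PIV_reflection_hom_simps) (simp add: coord_defs)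
  then have "\<exists>v. PIV_reflection_hom l p a v \<noteq> 0" by (metis zero_index)
  moreover have "\<forall>i. poly_fun (\<lambda>v. PIV_reflection_hom l p a v $ i)"
    unfolding forall_4 PIV_reflection_hom_simps by (intro conjI poly_fun_intros poly_fun_linear_form)
  ultimately show ?thesis unfolding hom_tuple_def by blast
qed

text \<open>The function \<open>k\<close> is the coefficient of the translation, an affine function
  of the parameters in each application, whose sign \<phi> reverses. As the linear form is
  invariant, the translations over \<open>a\<close> and over \<open>\<phi> a\<close> cancel.\<close>

lemma PIV_reflection_generator:
  fixes \<phi> :: "'p \<Rightarrow> 'p" and l :: "complex ^ 3" and p :: "complex ^ 2"
  assumes \<phi>: "\<And>a. \<phi> (\<phi> a) = a" and k: "\<And>a. k (\<phi> a) = - k a"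
    and l: "l \<noteq> 0" and lp: "l $ 1 * p $ 1 + l $ 2 * p $ 2 = 0"
  shows "PIV.generator_triple
     (\<phi>, \<lambda>a. aff_eq `` {\<lambda>v. vector [v $ 1 + p $ 1 * k a / linear_form l (app4 v 1),
                                   v $ 2 + p $ 2 * k a / linear_form l (app4 v 1), v $ 3]})
     (\<phi>, \<lambda>a. proj_eq PIV_wt4 `` {PIV_reflection_hom l p (k a)}) \<one>\<^bsub>Bir_wproj PIV_wt3\<^esub>"
proof -
  define Q where "Q = (\<lambda>v :: complex ^ 3. linear_form l (app4 v 1))"
  define f :: "'p \<Rightarrow> complex ^ 3 \<Rightarrow> complex ^ 3" where "f = (\<lambda>a v.
    vector [v $ 1 + p $ 1 * k a / Q v, v $ 2 + p $ 2 * k a / Q v, v $ 3])"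
  have f: "f a v $ 1 = v $ 1 + p $ 1 * k a / Q v" "f a v $ 2 = v $ 2 + p $ 2 * k a / Q v"
    "f a v $ 3 = v $ 3" for a v
    by (simp_all add: f_def vector_3)
  have lp': "(l $ 1 * p $ 1 + l $ 2 * p $ 2) * c = 0" for c using lp by simp
  have Qf: "Q (f a v) = Q v" for a v
  proof -
    have "Q (f a v) = Q v + (l $ 1 * p $ 1 + l $ 2 * p $ 2) * (k a / Q v)"
      unfolding Q_def[THEN fun_cong, of "f a v"] linear_form_app4 f
      by (simp add: Q_def linear_form_app4 algebra_simps add_divide_distrib)
    then show ?thesis by (simp only: lp' add_0_right)
  qed
  have ff: "f (\<phi> a) (f a v) = v" for a v
    unfolding vec_eq_iff forall_3 f(1-3)[of "\<phi> a"] Qf unfolding f k by simp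
  have rat: "rational_map (f a)" for a
    unfolding rational_map_iff forall_3 f unfolding Q_def linear_form_app4
    by (intro conjI rat_fun_intros)
  have Ff: "generically (\<lambda>v. (PIV_reflection_hom l p (k a) (app4 v 1), app4 (f a v) 1) \<in> wrel PIV_wt4)" for a
  proof (rule generically_mono[OF generically_linear_form(2)[OF l, of 1]])
    fix v :: "complex ^ 3" assume "linear_form l (app4 v 1) \<noteq> 0"
    then have Q: "Q v \<noteq> 0" by (simp add: Q_def)
    have Qv: "linear_form l (app4 v 1) = Q v" by (simp add: Q_def)
    have "PIV_reflection_hom l p (k a) (app4 v 1) = wscale PIV_wt4 (Q v) (app4 (f a v) 1)"
      using Q unfolding vec_eq_iff forall_4 PIV_reflection_hom_simps Qv
      by (simp add: wscale_def coord_defs f field_simps)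
    with Q show "(PIV_reflection_hom l p (k a) (app4 v 1), app4 (f a v) 1) \<in> wrel PIV_wt4"
      by (simp add: wrel_wscale' app4_eq_0_iff)
  qed
  \<comment> \<open>The form vanishes on \<open>p\<close>, so its value at the image is the square
    of its value at \<open>v\<close>. The outer tuple thus scales by the square and the inner one by
    the first power, which gives the cube.\<close>
  have FF: "PIV_reflection_hom l p (- a) (PIV_reflection_hom l p a v) = wscale PIV_wt4 (linear_form l v ^ 3) v" for a v
  proof -
    have "linear_form l (PIV_reflection_hom l p a v)
        = linear_form l v * linear_form l v + (l $ 1 * p $ 1 + l $ 2 * p $ 2) * (a * v $ 4)"
      unfolding linear_form_def[of _ "PIV_reflection_hom l p a v"] PIV_reflection_hom_simps
      by (simp add: linear_form_def algebra_simps)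
    then have *: "linear_form l (PIV_reflection_hom l p a v) = linear_form l v * linear_form l v"
      by (simp only: lp' add_0_right)
    show ?thesis
      unfolding vec_eq_iff forall_4 PIV_reflection_hom_simps(1-4)[of _ _ "- a"] *
      unfolding PIV_reflection_hom_simps by (simp add: wscale_def coord_defs algebra_simps eval_nat_numeral)
  qed
  have "PIV.generator_triple (\<phi>, \<lambda>a. aff_eq `` {f a})
     (\<phi>, \<lambda>a. proj_eq PIV_wt4 `` {PIV_reflection_hom l p (k a)}) (proj_eq PIV_wt3 `` {id})"
  proof (rule PIV.generator_tripleI[OF \<phi> rat rat _ _ _ _ Ff Ff])
    fix a
    show "generically (\<lambda>v. f (\<phi> a) (f a v) = v)" "generically (\<lambda>v. f (\<phi> a) (f a v) = v)"
      by (simp_all only: ff generically_True)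
    show "hom_tuple PIV_wt4 (PIV_reflection_hom l p (k a))" by (rule hom_tuple_PIV_reflection[OF l])
    show "generically (\<lambda>v. (PIV_reflection_hom l p (k (\<phi> a)) (PIV_reflection_hom l p (k a) v), v) \<in> wrel PIV_wt4)"
      unfolding k FF
    proof (rule generically_mono[OF generically_linear_form(1)[OF l]])
      fix v assume "linear_form l v \<noteq> 0"
      moreover from this have "v \<noteq> 0" by (auto simp: linear_form_def)
      ultimately show "(wscale PIV_wt4 (linear_form l v ^ 3) v, v) \<in> wrel PIV_wt4"
        by (intro wrel_wscale') simp_all
    qed
    show "generically (\<lambda>u. (PIV_reflection_hom l p (k a) (app4 u 0), app4 (id u) 0) \<in> wrel PIV_wt4)"
    proof (rule generically_mono[OF generically_linear_form(2)[OF l, of 0]])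
      fix u :: "complex ^ 3" assume Q: "linear_form l (app4 u 0) \<noteq> 0"
      then have "u \<noteq> 0" by (auto simp: linear_form_app4)
      moreover have "PIV_reflection_hom l p (k a) (app4 u 0)
          = wscale PIV_wt4 (linear_form l (app4 u 0)) (app4 u 0)"
        unfolding vec_eq_iff forall_4 PIV_reflection_hom_simps by (simp add: wscale_def coord_defs)
      ultimately show "(PIV_reflection_hom l p (k a) (app4 u 0), app4 (id u) 0) \<in> wrel PIV_wt4"
        using Q by (simp add: wrel_wscale' app4_eq_0_iff)
    qed
  next
    show "hom_tuple PIV_wt3 id" by (rule hom_tuple_id)
    show "generically (\<lambda>u. (id (id u), u) \<in> wrel PIV_wt3)"
      by (rule generically_mono[OF hom_tuple_nonzero[OF hom_tuple_id]]) (simp add: wrel_refl)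
  qed
  then show ?thesis unfolding f_def Q_def Bir_wproj_def PIV.w3.proj.one_cls .
qed

lemma PIV_s0_generator: "\<exists>\<tau>. PIV.generator_triple A2_s0 \<tau> \<one>\<^bsub>Bir_wproj PIV_wt3\<^esub>"
proof -
  have eq: "A2_s0 = (\<lambda>(\<kappa>, \<theta>). (1 + \<theta>, \<kappa> - 1), \<lambda>a. aff_eq `` {\<lambda>v.
     vector [v $ 1 + (vector [1, 1] :: complex ^ 2) $ 1 * (2 * (1 - fst a + snd a)) / linear_form (vector [1, -1, -2]) (app4 v 1),
             v $ 2 + (vector [1, 1] :: complex ^ 2) $ 2 * (2 * (1 - fst a + snd a)) / linear_form (vector [1, -1, -2]) (app4 v 1),
             v $ 3]})"
    by (simp add: A2_s0_def fun_eq_iff linear_form_app4 vector_3 vector_2 Let_def)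
  show ?thesis unfolding eq
    by (rule exI, rule PIV_reflection_generator)
      (auto simp: vector_2 vector_3 vec_eq_iff forall_3 split: prod.splits)
qed

lemma PIV_s1_generator: "\<exists>\<tau>. PIV.generator_triple A2_s1 \<tau> \<one>\<^bsub>Bir_wproj PIV_wt3\<^esub>"
proof -
  have eq: "A2_s1 = (\<lambda>(\<kappa>, \<theta>). (- \<kappa>, \<theta> - \<kappa>), \<lambda>a. aff_eq `` {\<lambda>v.
     vector [v $ 1 + (vector [1, 0] :: complex ^ 2) $ 1 * (- 2 * fst a) / linear_form (vector [0, 1, 0]) (app4 v 1),
             v $ 2 + (vector [1, 0] :: complex ^ 2) $ 2 * (- 2 * fst a) / linear_form (vector [0, 1, 0]) (app4 v 1),
             v $ 3]})"
    by (simp add: A2_s1_def fun_eq_iff linear_form_app4 vector_3 vector_2 Let_def)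
  show ?thesis unfolding eq
    by (rule exI, rule PIV_reflection_generator)
      (auto simp: vector_2 vector_3 vec_eq_iff forall_3 split: prod.splits)
qed

lemma PIV_s2_generator: "\<exists>\<tau>. PIV.generator_triple A2_s2 \<tau> \<one>\<^bsub>Bir_wproj PIV_wt3\<^esub>"
proof -
  have eq: "A2_s2 = (\<lambda>(\<kappa>, \<theta>). (\<kappa> - \<theta>, - \<theta>), \<lambda>a. aff_eq `` {\<lambda>v.
     vector [v $ 1 + (vector [0, 1] :: complex ^ 2) $ 1 * (- 2 * snd a) / linear_form (vector [1, 0, 0]) (app4 v 1),
             v $ 2 + (vector [0, 1] :: complex ^ 2) $ 2 * (- 2 * snd a) / linear_form (vector [1, 0, 0]) (app4 v 1),
             v $ 3]})"
    by (simp add: A2_s2_def fun_eq_iff linear_form_app4 vector_3 vector_2 Let_def)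
  show ?thesis unfolding eq
    by (rule exI, rule PIV_reflection_generator)
      (auto simp: vector_2 vector_3 vec_eq_iff forall_3 split: prod.splits)
qed

section \<open>Diagram automorphisms of the fourth equation\<close>

interpretation PIV_field: homogeneous_field PIV_wt3 1 2 "at_infinity_set (PIV_hom a)"
  by unfold_locales (simp add: at_infinity_set_def PIV_hom_def wscale_def Let_def vec_eq_iff forall_3
      coord_defs power2_eq_square algebra_simps split: prod.split)

definition PIV_sigma1_infinity :: "complex ^ 3 \<Rightarrow> complex ^ 3" where
  "PIV_sigma1_infinity v = vector [- v $ 2, - v $ 1, v $ 3]"

definition PIV_sigma2_infinity :: "complex ^ 3 \<Rightarrow> complex ^ 3" where
  "PIV_sigma2_infinity v = vector [v $ 1, v $ 1 - v $ 2 - 2 * v $ 3, v $ 3]"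

text \<open>Both automorphisms reverse the field, whence the factor -1. The parameter enters
  \<open>PIV_hom\<close> only with the factor \<open>e\<close>, so one computation at
  \<open>e = 0\<close> covers all parameter values.\<close>

lemma PIV_sigma_symmetry:
  "foliation_symmetry PIV_wt3 (at_infinity_set (PIV_hom a)) PIV_sigma1_infinity"
  "foliation_symmetry PIV_wt3 (at_infinity_set (PIV_hom a)) PIV_sigma2_infinity"
proof -
  have "PIV_sigma1_infinity (PIV_sigma1_infinity v) = v" "PIV_sigma2_infinity (PIV_sigma2_infinity v) = v" for v
    by (simp_all add: PIV_sigma1_infinity_def PIV_sigma2_infinity_def vec_eq_iff forall_3 vector_3)
  then have "bij PIV_sigma1_infinity" "bij PIV_sigma2_infinity" by (auto intro: involuntory_imp_bij)
  moreover have "graded_linear PIV_wt3 PIV_sigma1_infinity" "graded_linear PIV_wt3 PIV_sigma2_infinity"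
    by (simp_all add: graded_linear_def Vector_Spaces.linear_iff vec.vector_space_axioms
        PIV_sigma1_infinity_def PIV_sigma2_infinity_def wscale_def vec_eq_iff forall_3 coord_defs algebra_simps)
  moreover have "at_infinity_set (PIV_hom a) (PIV_sigma1_infinity v)
      = (- 1) *s PIV_sigma1_infinity (at_infinity_set (PIV_hom a) v)"
    "at_infinity_set (PIV_hom a) (PIV_sigma2_infinity v)
      = (- 1) *s PIV_sigma2_infinity (at_infinity_set (PIV_hom a) v)" for v
    by (simp_all add: PIV_sigma1_infinity_def PIV_sigma2_infinity_def at_infinity_set_def PIV_hom_def
        Let_def vec_eq_iff forall_3 coord_defs power2_eq_square algebra_simps split: prod.split)
  moreover have "(- 1 :: complex) \<noteq> 0" by simp
  ultimately show "foliation_symmetry PIV_wt3 (at_infinity_set (PIV_hom a)) PIV_sigma1_infinity"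
    "foliation_symmetry PIV_wt3 (at_infinity_set (PIV_hom a)) PIV_sigma2_infinity"
    unfolding foliation_symmetry_def by blast+
qed

text \<open>The affine value [-i y, -i x, i z, 1] multiplied by the scalar -i; the weight 2 of the
  last coordinate produces the sign there. The second automorphism is treated with the same
  scalar.\<close>

definition PIV_sigma1_hom :: "complex ^ 4 \<Rightarrow> complex ^ 4" where
  "PIV_sigma1_hom v = vector [- v $ 2, - v $ 1, v $ 3, - v $ 4]"

definition PIV_sigma2_hom :: "complex ^ 4 \<Rightarrow> complex ^ 4" where
  "PIV_sigma2_hom v = vector [v $ 1, v $ 1 - v $ 2 - 2 * v $ 3, v $ 3, - v $ 4]"

lemmas PIV_sigma_defs = PIV_sigma1_infinity_def PIV_sigma2_infinity_def PIV_sigma1_hom_def PIV_sigma2_hom_def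

lemma hom_tuple_PIV_sigma: "hom_tuple PIV_wt4 PIV_sigma1_hom" "hom_tuple PIV_wt4 PIV_sigma2_hom"
proof -
  have "PIV_sigma1_hom 1 $ 3 \<noteq> 0" "PIV_sigma2_hom 1 $ 3 \<noteq> 0"
    by (simp_all add: PIV_sigma_defs vector_4)
  then have "\<exists>v. PIV_sigma1_hom v \<noteq> 0" "\<exists>v. PIV_sigma2_hom v \<noteq> 0" by (metis zero_index)+
  moreover have "\<forall>i. poly_fun (\<lambda>v. PIV_sigma1_hom v $ i)" "\<forall>i. poly_fun (\<lambda>v. PIV_sigma2_hom v $ i)"
    unfolding forall_4 PIV_sigma_defs vector_4 by (intro conjI poly_fun_intros)+
  moreover have "PIV_sigma1_hom (wscale PIV_wt4 c v) = wscale PIV_wt4 (c ^ 1) (PIV_sigma1_hom v)"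
    "PIV_sigma2_hom (wscale PIV_wt4 c v) = wscale PIV_wt4 (c ^ 1) (PIV_sigma2_hom v)" for c v
    by (simp_all add: PIV_sigma_defs wscale_def vec_eq_iff forall_4 coord_defs algebra_simps)
  ultimately show "hom_tuple PIV_wt4 PIV_sigma1_hom" "hom_tuple PIV_wt4 PIV_sigma2_hom"
    unfolding hom_tuple_def by blast+
qed

lemma PIV_sigma1_generator:
  "PIV.generator_triple A2_sigma1 (\<lambda>(\<kappa>, \<theta>). (- \<theta>, - \<kappa>), \<lambda>_. proj_eq PIV_wt4 `` {PIV_sigma1_hom})
     (proj_eq PIV_wt3 `` {PIV_sigma1_infinity})"
  unfolding A2_sigma1_def Let_def
proof (rule PIV.linear_generator_tripleI)
  let ?f = "\<lambda>v :: complex ^ 3. vector [- \<i> * v $ 2, - \<i> * v $ 1, \<i> * v $ 3] :: complex ^ 3"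
  let ?g = "\<lambda>v :: complex ^ 3. vector [\<i> * v $ 2, \<i> * v $ 1, - \<i> * v $ 3] :: complex ^ 3"
  show "rational_map ?f" "rational_map ?g"
    unfolding rational_map_iff forall_3 vector_3 by (intro conjI rat_fun_intros)+
  show "?g (?f v) = v" "?f (?g v) = v" for v
    by (simp_all add: vec_eq_iff forall_3 vector_3)
  show "PIV_sigma1_hom (app4 v 1) = wscale PIV_wt4 (- \<i>) (app4 (?f v) 1)"
    "PIV_sigma1_hom (app4 v 1) = wscale PIV_wt4 \<i> (app4 (?g v) 1)" for v
    by (simp_all add: PIV_sigma_defs wscale_def vec_eq_iff forall_4 coord_defs)
  show "hom_tuple PIV_wt4 PIV_sigma1_hom" by (rule hom_tuple_PIV_sigma)
  show "hom_tuple PIV_wt3 PIV_sigma1_infinity" by (rule foliation_symmetry_hom_tuple[OF PIV_sigma_symmetry(1)])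
qed (simp_all add: PIV_sigma_defs vec_eq_iff forall_4 forall_3 coord_defs split: prod.split)

lemma PIV_sigma2_generator:
  "PIV.generator_triple A2_sigma2 (\<lambda>(\<kappa>, \<theta>). (\<kappa>, \<kappa> - \<theta> - 1), \<lambda>_. proj_eq PIV_wt4 `` {PIV_sigma2_hom})
     (proj_eq PIV_wt3 `` {PIV_sigma2_infinity})"
  unfolding A2_sigma2_def Let_def
proof (rule PIV.linear_generator_tripleI)
  let ?f = "\<lambda>v :: complex ^ 3. vector [\<i> * v $ 1, \<i> * (v $ 1 - v $ 2 - 2 * v $ 3), \<i> * v $ 3] :: complex ^ 3"
  let ?g = "\<lambda>v :: complex ^ 3. vector [- \<i> * v $ 1, - \<i> * (v $ 1 - v $ 2 - 2 * v $ 3), - \<i> * v $ 3] :: complex ^ 3"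
  show "rational_map ?f" "rational_map ?g"
    unfolding rational_map_iff forall_3 vector_3 by (intro conjI rat_fun_intros)+
  show "?g (?f v) = v" "?f (?g v) = v" for v
    by (simp_all add: vec_eq_iff forall_3 vector_3 algebra_simps)
  show "PIV_sigma2_hom (app4 v 1) = wscale PIV_wt4 (- \<i>) (app4 (?f v) 1)"
    "PIV_sigma2_hom (app4 v 1) = wscale PIV_wt4 \<i> (app4 (?g v) 1)" for v
    by (simp_all add: PIV_sigma_defs wscale_def vec_eq_iff forall_4 coord_defs algebra_simps)
  show "hom_tuple PIV_wt4 PIV_sigma2_hom" by (rule hom_tuple_PIV_sigma)
  show "hom_tuple PIV_wt3 PIV_sigma2_infinity" by (rule foliation_symmetry_hom_tuple[OF PIV_sigma_symmetry(2)])
qed (simp_all add: PIV_sigma_defs vec_eq_iff forall_4 forall_3 coord_defs split: prod.split)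

lemma PII_pi_nontrivial: "proj_eq PII_wt3 `` {PII_pi_infinity} \<noteq> \<one>\<^bsub>Bir_wproj PII_wt3\<^esub>"
  unfolding Bir_wproj_def PII.w3.proj.one_cls
  \<comment> \<open>The automorphism sends [1, 0, 1] to [-1, 0, 1]. Both outer coordinates have
    weight 2, so a scalar relating the two vectors would satisfy c^2 = -1 and c^2 = 1.\<close>
  by (rule PII.w3.proj_eq_class_neq[OF foliation_symmetry_hom_tuple[OF PII_pi_symmetry], of "vector [1, 0, 1]"])
    (auto simp: PII_pi_infinity_def wrel_def wscale_def vec_eq_iff forall_3 coord_defs)

lemma PII_extension_and_reduction:
  "\<exists>ext res.
       extension_hom PII_wt4 A1_ext_Weyl ext \<and>
       restriction_hom PII_wt4 PII_wt3 (ext ` A1_ext_Weyl) res \<and>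
       (\<forall>\<sigma>\<in>A1_Weyl. res (ext \<sigma>) = \<one>\<^bsub>Bir_wproj PII_wt3\<^esub>) \<and>
       res ` ext ` A1_ext_Weyl = res ` ext ` A1_Aut \<and>
       inj_on res (ext ` A1_Aut) \<and>
       (\<forall>\<sigma>\<in>A1_Aut. \<forall>\<alpha>. \<forall>L\<in>leaves PII_wt3 (at_infinity_set (PII_hom \<alpha>)).
          rat_image PII_wt3 (res (ext \<sigma>)) L \<in> leaves PII_wt3 (at_infinity_set (PII_hom \<alpha>)))"
proof -
  obtain \<tau>s where s1: "PII.generator_triple A1_s1 \<tau>s \<one>\<^bsub>Bir_wproj PII_wt3\<^esub>"
    using PII_s1_generator by blast
  define C where "C = proj_eq PII_wt3 `` {PII_pi_infinity}"
  obtain \<tau> where pi: "PII.generator_triple A1_pi \<tau> C" using PII_pi_generator unfolding C_def by blast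
  define S where "S = {(A1_s1, \<tau>s, \<one>\<^bsub>Bir_wproj PII_wt3\<^esub>)}"
  define P where "P = {(A1_pi, \<tau>, C)}"
  define N where "N = {A1_s1, A1_pi \<otimes>\<^bsub>Bir_aff\<^esub> A1_s1 \<otimes>\<^bsub>Bir_aff\<^esub> A1_pi}"
  have W: "generate Bir_aff (fst ` (S \<union> P)) = A1_ext_Weyl" "generate Bir_aff (fst ` P) = A1_Aut"
    "generate Bir_aff N = A1_Weyl"
    by (simp_all add: S_def P_def N_def A1_ext_Weyl_def A1_Aut_def A1_Weyl_def insert_commute)
  have hS: "PII.generator_triple \<sigma> \<tau> D \<and> D = \<one>\<^bsub>Bir_wproj PII_wt3\<^esub>" if "(\<sigma>, \<tau>, D) \<in> S" for \<sigma> \<tau> D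
    using that s1 unfolding S_def by blast
  have hP: "PII.generator_triple \<sigma> \<tau> D" if "(\<sigma>, \<tau>, D) \<in> P" for \<sigma> \<tau> D
    using that pi unfolding P_def by blast
  have hN: "x \<in> fst ` S \<or> (\<exists>\<pi>\<in>fst ` P. \<exists>\<sigma>\<in>fst ` S. x = \<pi> \<otimes>\<^bsub>Bir_aff\<^esub> \<sigma> \<otimes>\<^bsub>Bir_aff\<^esub> \<pi>)"
    if "x \<in> N" for x using that unfolding N_def S_def P_def by simp
  obtain ext res where ext: "extension_hom PII_wt4 A1_ext_Weyl ext"
    and res: "restriction_hom PII_wt4 PII_wt3 (ext ` A1_ext_Weyl) res"
    and triv: "\<And>\<sigma>. \<sigma> \<in> A1_Weyl \<Longrightarrow> res (ext \<sigma>) = \<one>\<^bsub>Bir_wproj PII_wt3\<^esub>"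
    and img: "res ` ext ` A1_ext_Weyl = res ` ext ` A1_Aut"
    and extP: "ext ` A1_Aut = generate (Bir_param_wproj PII_wt4\<lparr>carrier := ext ` A1_ext_Weyl\<rparr>) ((fst \<circ> snd) ` P)"
    and resP: "\<And>\<sigma> \<tau> D. (\<sigma>, \<tau>, D) \<in> P \<Longrightarrow> \<tau> \<in> ext ` A1_ext_Weyl \<and> res \<tau> = D"
    and resAut: "res ` ext ` A1_Aut = generate (Bir_wproj PII_wt3) ((snd \<circ> snd) ` P)"
    by (rule PII.reduction_at_infinity[of S P N, OF hS hP hN]) (assumption | simp only: W)+
  interpret r: group_hom "Bir_param_wproj PII_wt4\<lparr>carrier := ext ` A1_ext_Weyl\<rparr>" "Bir_wproj PII_wt3" res
    using res unfolding restriction_hom_def by blast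
  have \<tau>: "\<tau> \<in> ext ` A1_ext_Weyl" "res \<tau> = C" using resP[of A1_pi \<tau> C] by (simp_all add: P_def)
  have inj: "inj_on res (ext ` A1_Aut)"
    unfolding extP P_def using r.inj_on_generate_involution[of \<tau>] \<tau> pi PII_pi_nontrivial
    by (simp add: PII.generator_triple_def C_def del: One_nat_def)
  have fol: "rat_image PII_wt3 (res (ext \<sigma>)) L \<in> leaves PII_wt3 (at_infinity_set (PII_hom \<alpha>))"
    if "\<sigma> \<in> A1_Aut" "L \<in> leaves PII_wt3 (at_infinity_set (PII_hom \<alpha>))" for \<sigma> \<alpha> L
  proof (rule PII_field.rat_image_leaf_generate[OF _ _ that(2)])
    show "res (ext \<sigma>) \<in> generate (Bir_wproj PII_wt3) ((snd \<circ> snd) ` P)"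
      using that(1) unfolding resAut[symmetric] by blast
    show "\<exists>G. B = proj_eq PII_wt3 `` {G} \<and> foliation_symmetry PII_wt3 (at_infinity_set (PII_hom \<alpha>)) G"
      if B: "B \<in> (snd \<circ> snd) ` P" for B
    proof -
      have "B = proj_eq PII_wt3 `` {PII_pi_infinity}" using B by (simp add: P_def C_def)
      then show ?thesis using PII_pi_symmetry by blast
    qed
  qed
  show ?thesis
    by (rule exI[of _ ext], rule exI[of _ res]) (intro conjI ballI allI ext res triv img inj fol; assumption)
qed

text \<open>The point [1, 0, 0] and its images [0, -1, 0] and [1, 1, 0] are pairwise different,
  which separates the identity and the two automorphisms at once.\<close>

lemma PIV_sigma_nontrivial:
  "proj_eq PIV_wt3 `` {PIV_sigma1_infinity} \<noteq> \<one>\<^bsub>Bir_wproj PIV_wt3\<^esub>"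
  "proj_eq PIV_wt3 `` {PIV_sigma2_infinity} \<noteq> \<one>\<^bsub>Bir_wproj PIV_wt3\<^esub>"
  "proj_eq PIV_wt3 `` {PIV_sigma1_infinity} \<noteq> proj_eq PIV_wt3 `` {PIV_sigma2_infinity}"
  unfolding Bir_wproj_def PIV.w3.proj.one_cls
  by (rule PIV.w3.proj_eq_class_neq[OF foliation_symmetry_hom_tuple, OF PIV_sigma_symmetry(1), of "vector [1, 0, 0]"]
      PIV.w3.proj_eq_class_neq[OF foliation_symmetry_hom_tuple, OF PIV_sigma_symmetry(2), of "vector [1, 0, 0]"];
    auto simp: PIV_sigma_defs wrel_def wscale_def vec_eq_iff forall_3 coord_defs)+

text \<open>For these representatives the braid relation holds exactly on
  \<open>complex ^ 4\<close>, not just up to scalars, and therefore passes to the classes.\<close>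

lemma PIV_sigma_braid:
  fixes a :: "'p \<Rightarrow> 'p" and b :: "'p \<Rightarrow> 'p"
  defines "\<tau>1 \<equiv> (a, \<lambda>_. proj_eq PIV_wt4 `` {PIV_sigma1_hom})" and "\<tau>2 \<equiv> (b, \<lambda>_. proj_eq PIV_wt4 `` {PIV_sigma2_hom})"
  assumes "\<And>x. b (a (b x)) = a (b (a x))"
  shows "\<tau>2 \<otimes>\<^bsub>Bir_param_wproj PIV_wt4\<^esub> \<tau>1 \<otimes>\<^bsub>Bir_param_wproj PIV_wt4\<^esub> \<tau>2
    = \<tau>1 \<otimes>\<^bsub>Bir_param_wproj PIV_wt4\<^esub> \<tau>2 \<otimes>\<^bsub>Bir_param_wproj PIV_wt4\<^esub> \<tau>1"
proof -
  have "PIV_sigma1_hom \<circ> PIV_sigma1_hom = id" "PIV_sigma2_hom \<circ> PIV_sigma2_hom = id"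
    by (simp_all add: PIV_sigma_defs fun_eq_iff vec_eq_iff forall_4 vector_4)
  then have I: "mod_inverse (proj_eq PIV_wt4) PIV_sigma1_hom PIV_sigma1_hom"
    "mod_inverse (proj_eq PIV_wt4) PIV_sigma2_hom PIV_sigma2_hom"
    by (simp_all add: mod_inverse_def proj_eq_refl hom_tuple_PIV_sigma hom_tuple_id del: One_nat_def)
  note I' = PIV.w4.proj.Inv_comp[OF I] PIV.w4.proj.Inv_comp[OF I(2,1)]
  note r = I[THEN mod_inverse_def[THEN iffD1], THEN conjunct1] I'[THEN mod_inverse_def[THEN iffD1], THEN conjunct1]
  have "PIV_sigma2_hom \<circ> PIV_sigma1_hom \<circ> PIV_sigma2_hom = PIV_sigma1_hom \<circ> PIV_sigma2_hom \<circ> PIV_sigma1_hom"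
    by (simp add: PIV_sigma_defs fun_eq_iff vec_eq_iff forall_4 vector_4)
  moreover have "b \<circ> a \<circ> b = a \<circ> b \<circ> a" using assms(3) by (simp add: fun_eq_iff)
  ultimately show ?thesis
    unfolding \<tau>1_def \<tau>2_def Bir_param_wproj_def Bir_wproj_def param_group_simps fst_conv snd_conv
      PIV.w4.proj.mult_cls[OF r(1) I(2)] PIV.w4.proj.mult_cls[OF r(2) I(1)]
      PIV.w4.proj.mult_cls[OF r(3) I(1)] PIV.w4.proj.mult_cls[OF r(4) I(2)] by simp
qed

lemma PIV_extension_and_reduction:
  "\<exists>ext res.
       extension_hom PIV_wt4 A2_ext_Weyl ext \<and>
       restriction_hom PIV_wt4 PIV_wt3 (ext ` A2_ext_Weyl) res \<and>
       (\<forall>\<sigma>\<in>A2_Weyl. res (ext \<sigma>) = \<one>\<^bsub>Bir_wproj PIV_wt3\<^esub>) \<and>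
       res ` ext ` A2_ext_Weyl = res ` ext ` A2_Aut \<and>
       inj_on res (ext ` A2_Aut) \<and>
       (\<forall>\<sigma>\<in>A2_Aut. \<forall>a. \<forall>L\<in>leaves PIV_wt3 (at_infinity_set (PIV_hom a)).
          rat_image PIV_wt3 (res (ext \<sigma>)) L \<in> leaves PIV_wt3 (at_infinity_set (PIV_hom a)))"
proof -
  obtain \<rho>0 \<rho>1 \<rho>2 where s: "PIV.generator_triple A2_s0 \<rho>0 \<one>\<^bsub>Bir_wproj PIV_wt3\<^esub>"
    "PIV.generator_triple A2_s1 \<rho>1 \<one>\<^bsub>Bir_wproj PIV_wt3\<^esub>" "PIV.generator_triple A2_s2 \<rho>2 \<one>\<^bsub>Bir_wproj PIV_wt3\<^esub>"
    using PIV_s0_generator PIV_s1_generator PIV_s2_generator by blast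
  define C1 where "C1 = proj_eq PIV_wt3 `` {PIV_sigma1_infinity}"
  define C2 where "C2 = proj_eq PIV_wt3 `` {PIV_sigma2_infinity}"
  define \<tau>1 :: "(complex \<times> complex, 4) param_maps"
    where "\<tau>1 = (\<lambda>(\<kappa>, \<theta>). (- \<theta>, - \<kappa>), \<lambda>_. proj_eq PIV_wt4 `` {PIV_sigma1_hom})"
  define \<tau>2 :: "(complex \<times> complex, 4) param_maps"
    where "\<tau>2 = (\<lambda>(\<kappa>, \<theta>). (\<kappa>, \<kappa> - \<theta> - 1), \<lambda>_. proj_eq PIV_wt4 `` {PIV_sigma2_hom})"
  have sigma: "PIV.generator_triple A2_sigma1 \<tau>1 C1" "PIV.generator_triple A2_sigma2 \<tau>2 C2"
    unfolding \<tau>1_def \<tau>2_def C1_def C2_def by (rule PIV_sigma1_generator PIV_sigma2_generator)+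
  have braid: "\<tau>2 \<otimes>\<^bsub>Bir_param_wproj PIV_wt4\<^esub> \<tau>1 \<otimes>\<^bsub>Bir_param_wproj PIV_wt4\<^esub> \<tau>2
    = \<tau>1 \<otimes>\<^bsub>Bir_param_wproj PIV_wt4\<^esub> \<tau>2 \<otimes>\<^bsub>Bir_param_wproj PIV_wt4\<^esub> \<tau>1"
    unfolding \<tau>1_def \<tau>2_def by (rule PIV_sigma_braid) (simp split: prod.split)
  define S where "S = {(A2_s0, \<rho>0, \<one>\<^bsub>Bir_wproj PIV_wt3\<^esub>), (A2_s1, \<rho>1, \<one>\<^bsub>Bir_wproj PIV_wt3\<^esub>),
    (A2_s2, \<rho>2, \<one>\<^bsub>Bir_wproj PIV_wt3\<^esub>)}"
  define P where "P = {(A2_sigma1, \<tau>1, C1), (A2_sigma2, \<tau>2, C2)}"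
  define N where "N = {A2_s0, A2_s1, A2_s2}"
  have W: "generate Bir_aff (fst ` (S \<union> P)) = A2_ext_Weyl" "generate Bir_aff (fst ` P) = A2_Aut"
    "generate Bir_aff N = A2_Weyl"
    by (simp_all add: S_def P_def N_def A2_ext_Weyl_def A2_Aut_def A2_Weyl_def insert_commute)
  have hS: "PIV.generator_triple \<sigma> \<tau> D \<and> D = \<one>\<^bsub>Bir_wproj PIV_wt3\<^esub>" if "(\<sigma>, \<tau>, D) \<in> S" for \<sigma> \<tau> D
    using that s unfolding S_def by blast
  have hP: "PIV.generator_triple \<sigma> \<tau> D" if "(\<sigma>, \<tau>, D) \<in> P" for \<sigma> \<tau> D
    using that sigma unfolding P_def by blast
  have hN: "x \<in> fst ` S \<or> (\<exists>\<pi>\<in>fst ` P. \<exists>\<sigma>\<in>fst ` S. x = \<pi> \<otimes>\<^bsub>Bir_aff\<^esub> \<sigma> \<otimes>\<^bsub>Bir_aff\<^esub> \<pi>)"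
    if "x \<in> N" for x using that unfolding N_def S_def by simp
  obtain ext res where ext: "extension_hom PIV_wt4 A2_ext_Weyl ext"
    and res: "restriction_hom PIV_wt4 PIV_wt3 (ext ` A2_ext_Weyl) res"
    and triv: "\<And>\<sigma>. \<sigma> \<in> A2_Weyl \<Longrightarrow> res (ext \<sigma>) = \<one>\<^bsub>Bir_wproj PIV_wt3\<^esub>"
    and img: "res ` ext ` A2_ext_Weyl = res ` ext ` A2_Aut"
    and extP: "ext ` A2_Aut = generate (Bir_param_wproj PIV_wt4\<lparr>carrier := ext ` A2_ext_Weyl\<rparr>) ((fst \<circ> snd) ` P)"
    and resP: "\<And>\<sigma> \<tau> D. (\<sigma>, \<tau>, D) \<in> P \<Longrightarrow> \<tau> \<in> ext ` A2_ext_Weyl \<and> res \<tau> = D"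
    and resAut: "res ` ext ` A2_Aut = generate (Bir_wproj PIV_wt3) ((snd \<circ> snd) ` P)"
    by (rule PIV.reduction_at_infinity[of S P N, OF hS hP hN]) (assumption | simp only: W)+
  interpret r: group_hom "Bir_param_wproj PIV_wt4\<lparr>carrier := ext ` A2_ext_Weyl\<rparr>" "Bir_wproj PIV_wt3" res
    using res unfolding restriction_hom_def by blast
  have \<tau>: "\<tau>1 \<in> ext ` A2_ext_Weyl" "res \<tau>1 = C1" "\<tau>2 \<in> ext ` A2_ext_Weyl" "res \<tau>2 = C2"
    using resP[of A2_sigma1 \<tau>1 C1] resP[of A2_sigma2 \<tau>2 C2] by (simp_all add: P_def)
  have "inj_on res (generate (Bir_param_wproj PIV_wt4\<lparr>carrier := ext ` A2_ext_Weyl\<rparr>) {\<tau>1, \<tau>2})"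
    by (rule r.inj_on_generate_S3)
      (use \<tau> sigma braid PIV_sigma_nontrivial in \<open>simp_all add: PIV.generator_triple_def C1_def C2_def del: One_nat_def\<close>)
  then have inj: "inj_on res (ext ` A2_Aut)" unfolding extP P_def by simp
  have fol: "rat_image PIV_wt3 (res (ext \<sigma>)) L \<in> leaves PIV_wt3 (at_infinity_set (PIV_hom a))"
    if "\<sigma> \<in> A2_Aut" "L \<in> leaves PIV_wt3 (at_infinity_set (PIV_hom a))" for \<sigma> a L
  proof (rule PIV_field.rat_image_leaf_generate[OF _ _ that(2)])
    show "res (ext \<sigma>) \<in> generate (Bir_wproj PIV_wt3) ((snd \<circ> snd) ` P)"
      using that(1) unfolding resAut[symmetric] by blast
    show "\<exists>G. B = proj_eq PIV_wt3 `` {G} \<and> foliation_symmetry PIV_wt3 (at_infinity_set (PIV_hom a)) G"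
      if B: "B \<in> (snd \<circ> snd) ` P" for B
    proof -
      have "B = proj_eq PIV_wt3 `` {PIV_sigma1_infinity} \<or> B = proj_eq PIV_wt3 `` {PIV_sigma2_infinity}"
        using B by (auto simp: P_def C1_def C2_def)
      then show ?thesis using PIV_sigma_symmetry by blast
    qed
  qed
  show ?thesis
    by (rule exI[of _ ext], rule exI[of _ res]) (intro conjI ballI allI ext res triv img inj fol; assumption)
qed

theorem theorem7p1:
  shows "(\<exists>ext res.
       extension_hom PII_wt4 A1_ext_Weyl ext \<and>
       restriction_hom PII_wt4 PII_wt3 (ext ` A1_ext_Weyl) res \<and>
       (\<forall>\<sigma>\<in>A1_Weyl. res (ext \<sigma>) = \<one>\<^bsub>Bir_wproj PII_wt3\<^esub>) \<and>
       res ` ext ` A1_ext_Weyl = res ` ext ` A1_Aut \<and>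
       inj_on res (ext ` A1_Aut) \<and>
       (\<forall>\<sigma>\<in>A1_Aut. \<forall>\<alpha>. \<forall>L\<in>leaves PII_wt3 (at_infinity_set (PII_hom \<alpha>)).
          rat_image PII_wt3 (res (ext \<sigma>)) L \<in> leaves PII_wt3 (at_infinity_set (PII_hom \<alpha>)))) \<and>
    (\<exists>ext res.
       extension_hom PIV_wt4 A2_ext_Weyl ext \<and>
       restriction_hom PIV_wt4 PIV_wt3 (ext ` A2_ext_Weyl) res \<and>
       (\<forall>\<sigma>\<in>A2_Weyl. res (ext \<sigma>) = \<one>\<^bsub>Bir_wproj PIV_wt3\<^esub>) \<and>
       res ` ext ` A2_ext_Weyl = res ` ext ` A2_Aut \<and>
       inj_on res (ext ` A2_Aut) \<and>
       (\<forall>\<sigma>\<in>A2_Aut. \<forall>a. \<forall>L\<in>leaves PIV_wt3 (at_infinity_set (PIV_hom a)).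
          rat_image PIV_wt3 (res (ext \<sigma>)) L \<in> leaves PIV_wt3 (at_infinity_set (PIV_hom a))))"
  using PII_extension_and_reduction PIV_extension_and_reduction by (rule conjI)

end
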